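(* Let $\theta(z),\varphi(w)$ be two nonconstant inner functions on the unit disk. Then the submodule $[\theta(z)-\varphi(w)]$ of $H^2(\mathbb{D}^2)$ is Hilbert-Schmidt and $$\|C_{[\theta(z)-\varphi(w)]}\|_{H.S.}^2=2\,\Sigma_1^{[z-w]}(\theta(0),\varphi(0))+1\le 5,$$ where $C_{[\theta(z)-\varphi(w)]}$ is the core operator of $[\theta(z)-\varphi(w)]$.
   Context: $\mathbb{D}$ is the open unit disk and $H^2(\mathbb{D}^2)$ the Hardy space over the bidisk. A submodule is a closed subspace of $H^2(\mathbb{D}^2)$ invariant under multiplication by $z$ and $w$. $[h]$ is the submodule generated by $h$, i.e. the norm closure of $\mathbb{C}[z,w]\cdot h$. An inner function is a bounded analytic function on $\mathbb{D}$ whose boundary values have modulus 1 a.e. For a submodule $M$ and bounded analytic $\phi$ with $\phi M\subseteq M$, $R_\phi$ denotes multiplication by $\phi$ on $M$; $[A,B]=AB-BA$ for operators. $M$ is Hilbert-Schmidt if $[R_z^*,R_z][R_w^*,R_w]$ and $[R_z^*,R_w]$ are Hilbert-Schmidt operators. The core operator $C_M$ is the operator that is zero on $H^2(\mathbb{D}^2)\ominus M$ and equals $I-R_zR_z^*-R_wR_w^*+R_zR_wR_z^*R_w^*$ on $M$. For $a\in\mathbb{D}$ let $\varphi_a(\zeta)=\frac{a-\zeta}{1-\bar a\zeta}$. For $(a,b)\in\mathbb{D}^2$ let $P_a',Q_b'$ be the orthogonal projections from $M$ onto $(z-a)(M\ominus(w-b)M)$ and $(w-b)(M\ominus(z-a)M)$,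 respectively. The numerical invariant function $\Sigma_1^M$ of a Hilbert-Schmidt submodule $M$ is $$\Sigma_1^M(a,b)=\|P_a'Q_b'\|_{H.S.}^2=\|[R_{\varphi_a(z)}^*,R_{\varphi_b(w)}]\|_{H.S.}^2,$$ where $\|\cdot\|_{H.S.}$ is the Hilbert-Schmidt norm. *)

theory Defs
  imports "HOL-Analysis.Analysis"
begin

section \<open>The Hardy space over the bidisk\<close>

definition bidisk :: "(complex \<times> complex) set" where
  "bidisk = ball 0 1 \<times> ball 0 1"

text \<open>
  \<open>hardy_expansion a f\<close>: the function \<open>f\<close> has on the bidisk the power series with
  square summable coefficient array \<open>a\<close>. Only the values on the bidisk matter; outside of it
  \<open>f\<close> is normalised to 0, so that elements of the Hardy space are equal iff they agree there.
\<close>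

definition hardy_expansion :: "(nat \<times> nat \<Rightarrow> complex) \<Rightarrow> (complex \<times> complex \<Rightarrow> complex) \<Rightarrow> bool" where
  "hardy_expansion a f \<longleftrightarrow>
     (\<lambda>k. (cmod (a k))\<^sup>2) summable_on UNIV \<and>
     (\<forall>z w. (z, w) \<in> bidisk \<longrightarrow> ((\<lambda>(i, j). a (i, j) * z ^ i * w ^ j) has_sum f (z, w)) UNIV) \<and>
     (\<forall>p. p \<notin> bidisk \<longrightarrow> f p = 0)"

lemma sq_summable_add:
  assumes "(\<lambda>k. (cmod (a k))\<^sup>2) summable_on A" "(\<lambda>k. (cmod (b k))\<^sup>2) summable_on A"
  shows "(\<lambda>k. (cmod (a k + b k))\<^sup>2) summable_on A"
proof (rule summable_on_comparison_test)
  show "(\<lambda>k. 2 * (cmod (a k))\<^sup>2 + 2 * (cmod (b k))\<^sup>2) summable_on A"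
    by (intro summable_on_add summable_on_cmult_right assms)
  fix k
  have "(cmod (a k + b k))\<^sup>2 \<le> (cmod (a k) + cmod (b k))\<^sup>2"
    by (intro power_mono norm_triangle_ineq) auto
  also have "\<dots> \<le> 2 * (cmod (a k))\<^sup>2 + 2 * (cmod (b k))\<^sup>2"
    using sum_squares_bound[of "cmod (a k)" "cmod (b k)"] by (simp add: power2_sum)
  finally show "(cmod (a k + b k))\<^sup>2 \<le> 2 * (cmod (a k))\<^sup>2 + 2 * (cmod (b k))\<^sup>2" .
qed auto

lemma sq_summable_mult:
  assumes "(\<lambda>k. (cmod (a k))\<^sup>2) summable_on A" "(\<lambda>k. (cmod (b k))\<^sup>2) summable_on A"
  shows "(\<lambda>k. norm (a k * b k)) summable_on A"
proof (rule summable_on_comparison_test)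
  show "(\<lambda>k. (cmod (a k))\<^sup>2 + (cmod (b k))\<^sup>2) summable_on A"
    by (intro summable_on_add assms)
  fix k
  show "norm (a k * b k) \<le> (cmod (a k))\<^sup>2 + (cmod (b k))\<^sup>2"
    using sum_squares_bound[of "cmod (a k)" "cmod (b k)"]
      mult_nonneg_nonneg[of "cmod (a k)" "cmod (b k)"]
    by (simp add: norm_mult del: mult_nonneg_nonneg)
qed auto

lemma hardy_expansion_0: "hardy_expansion (\<lambda>_. 0) (\<lambda>_. 0)"
  by (auto simp: hardy_expansion_def case_prod_unfold)

lemma hardy_expansion_add:
  assumes "hardy_expansion a f" "hardy_expansion b g"
  shows "hardy_expansion (\<lambda>k. a k + b k) (\<lambda>p. f p + g p)"
proof -
  have "((\<lambda>(i, j). (a (i, j) + b (i, j)) * z ^ i * w ^ j) has_sum f (z, w) + g (z, w)) UNIV"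
    if "(z, w) \<in> bidisk" for z w
    using has_sum_add[where f = "\<lambda>(i, j). a (i, j) * z ^ i * w ^ j"
        and g = "\<lambda>(i, j). b (i, j) * z ^ i * w ^ j" and A = UNIV] assms that
    by (fastforce simp: hardy_expansion_def case_prod_unfold ring_distribs)
  then show ?thesis
    using assms by (auto simp: hardy_expansion_def intro!: sq_summable_add)
qed

lemma hardy_expansion_scale:
  assumes "hardy_expansion a f"
  shows "hardy_expansion (\<lambda>k. c * a k) (\<lambda>p. c * f p)"
proof -
  have "((\<lambda>(i, j). c * a (i, j) * z ^ i * w ^ j) has_sum c * f (z, w)) UNIV"
    if "(z, w) \<in> bidisk" for z w
    using has_sum_cmult_right[where f = "\<lambda>(i, j). a (i, j) * z ^ i * w ^ j"
        and A = UNIV and c = c] assms that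
    by (fastforce simp: hardy_expansion_def case_prod_unfold mult.assoc)
  then show ?thesis
    using assms
    by (auto simp: hardy_expansion_def norm_mult power_mult_distrib intro!: summable_on_cmult_right)
qed

lemma powser_coeff_eq_0:
  fixes c :: "nat \<Rightarrow> complex"
  assumes "\<And>z. norm z < 1 \<Longrightarrow> ((\<lambda>i. c i * z ^ i) has_sum 0) UNIV"
  shows "c n = 0"
proof -
  have sums: "(\<lambda>i. c i * z ^ i) sums 0" if "norm z < 1" for z
    using has_sum_imp_sums[OF assms[OF that]] .
  have "summable (\<lambda>i. c i * (1/2) ^ i)"
    using sums[of "1/2"] by (simp add: sums_iff)
  from conv_radius_geI[OF this] have "fps_conv_radius (Abs_fps c) > 0"
    by (simp add: fps_conv_radius_def) (metis ereal_less(2) half_gt_zero_iff less_le_trans zero_less_one)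
  moreover have "eventually (\<lambda>z. eval_fps (Abs_fps c) z = eval_fps 0 z) (nhds 0)"
  proof (rule eventually_nhds_in_open[of "ball 0 1", THEN eventually_mono])
    fix z :: complex assume "z \<in> ball 0 1"
    then show "eval_fps (Abs_fps c) z = eval_fps 0 z"
      using sums[of z] by (simp add: eval_fps_def sums_iff)
  qed auto
  ultimately have "Abs_fps c = 0"
    by (intro eval_fps_eqD) auto
  then show ?thesis
    by (metis Abs_fps_inverse UNIV_I fps_zero_nth fps_nth_Abs_fps)
qed

lemma hardy_expansion_zero_unique:
  assumes "hardy_expansion a (\<lambda>_. 0)"
  shows "a k = 0"
proof -
  obtain m n where k: "k = (m, n)" by force
  have hs: "((\<lambda>(i, j). a (i, j) * z ^ i * w ^ j) has_sum 0) (UNIV \<times> UNIV)"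
    if "norm z < 1" "norm w < 1" for z w
    using assms that by (auto simp: hardy_expansion_def bidisk_def)
  have row: "(\<lambda>j. a (i, j) * w ^ j) summable_on UNIV" if w: "norm w < 1" for i w
  proof -
    have "(\<lambda>(i, j). a (i, j) * (1/2) ^ i * w ^ j) summable_on (UNIV \<times> UNIV)"
      using hs[of "1/2" w] w by (intro has_sum_imp_summable) auto
    from summable_on_SigmaD1[OF this, of i]
    have "(\<lambda>j. 2 ^ i * (a (i, j) * (1/2) ^ i * w ^ j)) summable_on UNIV"
      by (intro summable_on_cmult_right) auto
    then show ?thesis
      by (simp add: field_simps)
  qed
  have "(\<Sum>\<^sub>\<infinity>j. a (i, j) * w ^ j) = 0" if w: "norm w < 1" for i w
  proof (rule powser_coeff_eq_0)
    fix z :: complex assume z: "norm z < 1"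
    have "((\<lambda>j. a (i, j) * z ^ i * w ^ j) has_sum (\<Sum>\<^sub>\<infinity>j. a (i, j) * w ^ j) * z ^ i) UNIV" for i
      using has_sum_cmult_left[OF has_sum_infsum[OF row[OF w, of i]], of "z ^ i"]
      by (simp add: mult_ac)
    then show "((\<lambda>i. (\<Sum>\<^sub>\<infinity>j. a (i, j) * w ^ j) * z ^ i) has_sum 0) UNIV"
      by (intro has_sum_SigmaD[OF hs[OF z w]]) auto
  qed
  then have "((\<lambda>j. a (m, j) * w ^ j) has_sum 0) UNIV" if "norm w < 1" for w
    using has_sum_infsum[OF row[OF that, of m]] that by simp
  from powser_coeff_eq_0[OF this] show ?thesis
    by (simp add: k)
qed

lemma hardy_expansion_unique:
  assumes "hardy_expansion a f" "hardy_expansion b f"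
  shows "a = b"
proof
  fix k
  have "hardy_expansion (\<lambda>k. a k + (-1) * b k) (\<lambda>p. f p + (-1) * f p)"
    by (intro hardy_expansion_add hardy_expansion_scale assms)
  then have "a k + (-1) * b k = 0"
    by (intro hardy_expansion_zero_unique[of "\<lambda>k. a k + (-1) * b k"]) simp
  then show "a k = b k"
    by simp
qed

lemma hardy_expansion_det:
  assumes "hardy_expansion a f" "hardy_expansion a g"
  shows "f = g"
proof (rule ext, clarify)
  fix z w :: complex
  show "f (z, w) = g (z, w)"
  proof (cases "(z, w) \<in> bidisk")
    case True
    then have "((\<lambda>(i, j). a (i, j) * z ^ i * w ^ j) has_sum f (z, w)) UNIV"
      "((\<lambda>(i, j). a (i, j) * z ^ i * w ^ j) has_sum g (z, w)) UNIV"
      using assms by (simp_all add: hardy_expansion_def)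
    then show ?thesis
      by (rule has_sum_unique)
  next
    case False
    then show ?thesis
      using assms by (simp add: hardy_expansion_def)
  qed
qed

typedef hardy2 = "{f. \<exists>a. hardy_expansion a f}"
  morphisms hfun Abs_hardy2
  using hardy_expansion_0 by blast

setup_lifting type_definition_hardy2

text \<open>Restricts a function to the bidisk; meaningful if the restriction belongs to the space.\<close>

definition to_hardy :: "(complex \<times> complex \<Rightarrow> complex) \<Rightarrow> hardy2" where
  "to_hardy g = Abs_hardy2 (\<lambda>p. if p \<in> bidisk then g p else 0)"

definition hcoeff :: "hardy2 \<Rightarrow> nat \<times> nat \<Rightarrow> complex" where
  "hcoeff f = (THE a. hardy_expansion a (hfun f))"

lemma hardy_expansion_hcoeff: "hardy_expansion (hcoeff f) (hfun f)"
proof -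
  have "\<exists>!a. hardy_expansion a (hfun f)"
    using hfun[of f] hardy_expansion_unique by blast
  from theI'[OF this] show ?thesis
    by (simp add: hcoeff_def)
qed

lemma hcoeff_eqI: "hardy_expansion a (hfun f) \<Longrightarrow> hcoeff f = a"
  using hardy_expansion_hcoeff hardy_expansion_unique by blast

lemma hardy2_eqI: "hcoeff f = hcoeff g \<Longrightarrow> f = g"
  by (metis hardy_expansion_det hardy_expansion_hcoeff hfun_inject)

lemma hcoeff_sq_summable: "(\<lambda>k. (cmod (hcoeff f k))\<^sup>2) summable_on UNIV"
  using hardy_expansion_hcoeff by (auto simp: hardy_expansion_def)

instantiation hardy2 :: ab_group_add
begin

lift_definition zero_hardy2 :: hardy2 is "\<lambda>_. 0"
  using hardy_expansion_0 by blast

lift_definition plus_hardy2 :: "hardy2 \<Rightarrow> hardy2 \<Rightarrow> hardy2" is "\<lambda>f g p. f p + g p"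
  using hardy_expansion_add by blast

lift_definition uminus_hardy2 :: "hardy2 \<Rightarrow> hardy2" is "\<lambda>f p. - f p"
  using hardy_expansion_scale[of _ _ "-1"] by fastforce

lift_definition minus_hardy2 :: "hardy2 \<Rightarrow> hardy2 \<Rightarrow> hardy2" is "\<lambda>f g p. f p - g p"
proof clarify
  fix f g a b
  assume "hardy_expansion a f" "hardy_expansion b g"
  then have "hardy_expansion (\<lambda>k. a k + (-1) * b k) (\<lambda>p. f p + (-1) * g p)"
    by (intro hardy_expansion_add hardy_expansion_scale)
  then show "\<exists>a. hardy_expansion a (\<lambda>p. f p - g p)"
    by auto
qed

instance
  by standard (transfer; simp add: fun_eq_iff add_ac)+

end

lift_definition scaleC :: "complex \<Rightarrow> hardy2 \<Rightarrow> hardy2" is "\<lambda>c f p. c * f p"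
  using hardy_expansion_scale by blast

lemma hcoeff_zero [simp]: "hcoeff 0 k = 0"
  using hcoeff_eqI[of "\<lambda>_. 0" 0] hardy_expansion_0 by (simp add: zero_hardy2.rep_eq)

lemma hcoeff_add [simp]: "hcoeff (f + g) k = hcoeff f k + hcoeff g k"
  using hcoeff_eqI[of "\<lambda>k. hcoeff f k + hcoeff g k" "f + g"]
    hardy_expansion_add[OF hardy_expansion_hcoeff[of f] hardy_expansion_hcoeff[of g]]
  by (simp add: plus_hardy2.rep_eq)

lemma hcoeff_scaleC [simp]: "hcoeff (scaleC c f) k = c * hcoeff f k"
  using hcoeff_eqI[of "\<lambda>k. c * hcoeff f k" "scaleC c f"]
    hardy_expansion_scale[OF hardy_expansion_hcoeff[of f], of c]
  by (simp add: scaleC.rep_eq)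

text \<open>The inner product is linear in the first and conjugate linear in the second argument.\<close>

definition cinner :: "hardy2 \<Rightarrow> hardy2 \<Rightarrow> complex" where
  "cinner f g = (\<Sum>\<^sub>\<infinity>k. hcoeff f k * cnj (hcoeff g k))"

lemma cinner_summable: "(\<lambda>k. hcoeff f k * cnj (hcoeff g k)) summable_on UNIV"
  using abs_summable_summable[OF sq_summable_mult[of "hcoeff f" UNIV "\<lambda>k. cnj (hcoeff g k)"]]
  by (simp add: hcoeff_sq_summable)

lemma cinner_add_left: "cinner (f + g) h = cinner f h + cinner g h"
  by (simp add: cinner_def ring_distribs infsum_add cinner_summable)

lemma cinner_scaleC_left: "cinner (scaleC c f) h = c * cinner f h"
  by (simp add: cinner_def mult.assoc infsum_cmult_right cinner_summable)

lemma cinner_commute: "cinner f g = cnj (cinner g f)"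
  by (simp add: cinner_def flip: infsum_cnj) (simp add: mult.commute)

lemma Re_cinner_self: "Re (cinner f f) = (\<Sum>\<^sub>\<infinity>k. (cmod (hcoeff f k))\<^sup>2)"
  by (simp add: cinner_def cinner_summable cmod_power2 flip: infsum_Re)
    (simp add: power2_eq_square)

instantiation hardy2 :: real_inner
begin

definition scaleR_hardy2 :: "real \<Rightarrow> hardy2 \<Rightarrow> hardy2" where
  "scaleR_hardy2 r = scaleC (of_real r)"

definition inner_hardy2 :: "hardy2 \<Rightarrow> hardy2 \<Rightarrow> real" where
  "inner_hardy2 f g = Re (cinner f g)"

definition norm_hardy2 :: "hardy2 \<Rightarrow> real" where
  "norm_hardy2 f = sqrt (\<Sum>\<^sub>\<infinity>k. (cmod (hcoeff f k))\<^sup>2)"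

definition sgn_hardy2 :: "hardy2 \<Rightarrow> hardy2" where
  "sgn_hardy2 f = inverse (norm f) *\<^sub>R f"

definition dist_hardy2 :: "hardy2 \<Rightarrow> hardy2 \<Rightarrow> real" where
  "dist_hardy2 f g = norm (f - g)"

definition uniformity_hardy2 :: "(hardy2 \<times> hardy2) filter" where
  "uniformity_hardy2 = (INF e\<in>{0<..}. principal {(f, g). dist f g < e})"

definition open_hardy2 :: "hardy2 set \<Rightarrow> bool" where
  "open_hardy2 U \<longleftrightarrow> (\<forall>f\<in>U. \<forall>\<^sub>F (f', g) in uniformity. f' = f \<longrightarrow> g \<in> U)"

instance
proof
  fix f g h :: hardy2 and r s :: real
  show "r *\<^sub>R (f + g) = r *\<^sub>R f + r *\<^sub>R g" "(r + s) *\<^sub>R f = r *\<^sub>R f + s *\<^sub>R f"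
    "r *\<^sub>R s *\<^sub>R f = (r * s) *\<^sub>R f" "1 *\<^sub>R f = f"
    by (auto intro!: hardy2_eqI simp: fun_eq_iff scaleR_hardy2_def ring_distribs)
  show "inner f g = inner g f"
    using cinner_commute[of f g] by (simp add: inner_hardy2_def)
  show "inner (f + g) h = inner f h + inner g h"
    by (simp add: inner_hardy2_def cinner_add_left)
  show "inner (r *\<^sub>R f) g = r * inner f g"
    by (simp add: inner_hardy2_def scaleR_hardy2_def cinner_scaleC_left)
  show "0 \<le> inner f f"
    by (simp add: inner_hardy2_def Re_cinner_self infsum_nonneg)
  show "inner f f = 0 \<longleftrightarrow> f = 0"
  proof
    assume "inner f f = 0"
    then have "(cmod (hcoeff f k))\<^sup>2 = 0" for k
      using nonneg_infsum_le_0D[OF _ hcoeff_sq_summable[of f], of k]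
      by (simp add: inner_hardy2_def Re_cinner_self)
    then show "f = 0"
      by (intro hardy2_eqI) auto
  qed (simp add: inner_hardy2_def Re_cinner_self)
  show "norm f = sqrt (inner f f)"
    by (simp add: norm_hardy2_def inner_hardy2_def Re_cinner_self)
qed (simp_all add: sgn_hardy2_def dist_hardy2_def uniformity_hardy2_def open_hardy2_def)

end

section \<open>Submodules and multiplication operators\<close>

definition mult_op :: "(complex \<times> complex \<Rightarrow> complex) \<Rightarrow> hardy2 \<Rightarrow> hardy2" where
  "mult_op \<phi> f = to_hardy (\<lambda>p. \<phi> p * hfun f p)"

definition submodule :: "hardy2 set \<Rightarrow> bool" where
  "submodule M \<longleftrightarrow>
     closed M \<and> 0 \<in> M \<and> (\<forall>f\<in>M. \<forall>g\<in>M. f + g \<in> M) \<and> (\<forall>c. \<forall>f\<in>M. scaleC c f \<in> M) \<and>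
     (\<forall>f\<in>M. mult_op fst f \<in> M) \<and> (\<forall>f\<in>M. mult_op snd f \<in> M)"

definition bivariate_polynomials :: "(complex \<times> complex \<Rightarrow> complex) set" where
  "bivariate_polynomials =
     {q. \<exists>n c. \<forall>z w. q (z, w) = (\<Sum>i\<le>n. \<Sum>j\<le>n. c i j * z ^ i * w ^ j)}"

definition generated_submodule :: "(complex \<times> complex \<Rightarrow> complex) \<Rightarrow> hardy2 set" where
  "generated_submodule h = closure {to_hardy (\<lambda>p. q p * h p) |q. q \<in> bivariate_polynomials}"

section \<open>Operators on a submodule\<close>

text \<open>
  An operator on a closed subspace \<open>M\<close> is represented by a function on the whole space of which
  only the values on \<open>M\<close> are relevant; the adjoint is the one in the Hilbert space \<open>M\<close>.
\<close>

definition adj_on :: "hardy2 set \<Rightarrow> (hardy2 \<Rightarrow> hardy2) \<Rightarrow> hardy2 \<Rightarrow> hardy2" where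
  "adj_on M T g = (THE h. h \<in> M \<and> (\<forall>f\<in>M. cinner (T f) g = cinner f h))"

definition commutator :: "(hardy2 \<Rightarrow> hardy2) \<Rightarrow> (hardy2 \<Rightarrow> hardy2) \<Rightarrow> hardy2 \<Rightarrow> hardy2" where
  "commutator A B f = A (B f) - B (A f)"

definition orth_proj :: "hardy2 set \<Rightarrow> hardy2 \<Rightarrow> hardy2" where
  "orth_proj M f = (THE g. g \<in> M \<and> (\<forall>h\<in>M. cinner (f - g) h = 0))"

definition orthonormal_basis :: "hardy2 set \<Rightarrow> hardy2 set \<Rightarrow> bool" where
  "orthonormal_basis M B \<longleftrightarrow>
     B \<subseteq> M \<and> (\<forall>e\<in>B. norm e = 1) \<and> (\<forall>e\<in>B. \<forall>e'\<in>B. e \<noteq> e' \<longrightarrow> cinner e e' = 0) \<and>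
     (\<forall>f\<in>M. (\<forall>e\<in>B. cinner f e = 0) \<longrightarrow> f = 0)"

text \<open>
  The squared Hilbert-Schmidt norm of a bounded linear operator \<open>T\<close> on the closed subspace \<open>M\<close>,
  with value \<open>\<infinity>\<close> iff \<open>T\<close> is not Hilbert-Schmidt. It does not depend on the orthonormal basis chosen.
\<close>

definition hs_norm_sq :: "hardy2 set \<Rightarrow> (hardy2 \<Rightarrow> hardy2) \<Rightarrow> ennreal" where
  "hs_norm_sq M T = (\<Sum>\<^sub>\<infinity>e\<in>(SOME B. orthonormal_basis M B). ennreal ((norm (T e))\<^sup>2))"

definition hilbert_schmidt_submodule :: "hardy2 set \<Rightarrow> bool" where
  "hilbert_schmidt_submodule M \<longleftrightarrow>
     (let Rz = mult_op fst; Rw = mult_op snd in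
      submodule M \<and>
      hs_norm_sq M (commutator (adj_on M Rz) Rz \<circ> commutator (adj_on M Rw) Rw) < \<infinity> \<and>
      hs_norm_sq M (commutator (adj_on M Rz) Rw) < \<infinity>)"

definition core_operator :: "hardy2 set \<Rightarrow> hardy2 \<Rightarrow> hardy2" where
  "core_operator M f =
     (let Rz = mult_op fst; Rw = mult_op snd; Rz' = adj_on M Rz; Rw' = adj_on M Rw;
          g = orth_proj M f
      in g - Rz (Rz' g) - Rw (Rw' g) + Rz (Rw (Rz' (Rw' g))))"

definition disk_automorphism :: "complex \<Rightarrow> complex \<Rightarrow> complex" where
  "disk_automorphism a \<zeta> = (a - \<zeta>) / (1 - cnj a * \<zeta>)"

text \<open>
  Equivalently the squared Hilbert-Schmidt norm of the product of the orthogonal projections of \<open>M\<close>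
  onto \<open>\<phi>\<^sub>a(z)(M \<ominus> (w - b)M)\<close> and \<open>\<phi>\<^sub>b(w)(M \<ominus> (z - a)M)\<close>, where \<open>\<phi>\<^sub>c\<close> is \<^term>\<open>disk_automorphism c\<close>.
  For \<open>(a, b) \<noteq> (0, 0)\<close> the outer factors cannot in general be replaced by \<open>z - a\<close> and \<open>w - b\<close>.
\<close>

definition Sigma1 :: "hardy2 set \<Rightarrow> complex \<Rightarrow> complex \<Rightarrow> ennreal" where
  "Sigma1 M a b =
     hs_norm_sq M (commutator (adj_on M (mult_op (\<lambda>(z, w). disk_automorphism a z)))
                              (mult_op (\<lambda>(z, w). disk_automorphism b w)))"

section \<open>Inner functions\<close>

definition inner_function :: "(complex \<Rightarrow> complex) \<Rightarrow> bool" where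
  "inner_function \<theta> \<longleftrightarrow>
     \<theta> holomorphic_on ball 0 1 \<and> bounded (\<theta> ` ball 0 1) \<and>
     (AE t in lborel. \<exists>l. ((\<lambda>r. \<theta> (of_real r * cis t)) \<longlongrightarrow> l) (at_left 1) \<and> cmod l = 1)"

end

theory Submission
  imports Defs "HOL-Complex_Analysis.Cauchy_Integral_Formula"
begin

text \<open>
  Write \<open>a = \<theta>(0)\<close> and \<open>b = \<phi>(0)\<close>, let \<open>N = [\<theta>(z) - \<phi>(w)]\<close> and \<open>M = [z - w]\<close>, and let \<open>\<tau>\<^sub>c\<close> stand
  for \<^term>\<open>disk_automorphism c\<close>. The proof compares the core operator of \<open>N\<close> with the
  operator \<open>C'\<close> that arises from the core operator of \<open>M\<close> when the coordinate multiplications \<open>z\<close>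
  and \<open>w\<close> are replaced by \<open>\<tau>\<^sub>a(z)\<close> and \<open>\<tau>\<^sub>b(w)\<close>.

  \<^emph>\<open>Transfer.\<close> Multiplication by \<open>\<theta>(z)\<close> and \<open>\<phi>(w)\<close> is a doubly commuting pair of isometries. For a
  unit vector \<open>l\<close> in the kernels of both adjoints, \<open>V f = l \<cdot> f(\<theta>(z), \<phi>(w))\<close> is therefore an isometry of
  the Hardy space. It intertwines the coordinate multiplications, and also their adjoints, with the
  pair. Since \<open>N\<close> is the closed range of \<open>\<theta>(z) - \<phi>(w)\<close> and its complement the space where the two
  adjoints agree, \<open>V\<close> maps \<open>M\<close> into \<open>N\<close> and the complement of \<open>M\<close> into that of \<open>N\<close>. Up to a constant,
  the Szego kernel at a point is the image of the Szego kernel at the image point under such a map,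
  which yields the reproducing kernel of \<open>N\<close> (\<open>orth_proj_szego\<close>). In the kernel of the core operator of
  \<open>N\<close> all factors except \<open>\<theta>\<close> and \<open>\<phi>\<close> cancel, and the outcome is that this operator equals \<open>V C' V*\<close>
  with \<open>l\<close> the normalized reproducing kernel at the origin of the joint kernel of the two adjoints
  (\<open>hs_core_transfer\<close>). Hence the two operators have the
  same Hilbert-Schmidt norm.

  \<^emph>\<open>Index.\<close> Let \<open>A\<close>, \<open>B\<close> be doubly commuting isometries that leave a closed subspace invariant, \<open>C\<close> the
  associated core operator, \<open>K\<close> the cross commutator of the restrictions, and \<open>p\<close>, \<open>q\<close> the projections
  onto the ranges of the two self-commutators. On the subspace \<open>C B = - A K\<close>, and
  \<open>\<parallel>p f\<parallel>\<^sup>2 - \<parallel>p B f\<parallel>\<^sup>2 = \<parallel>K f\<parallel>\<^sup>2\<close>. Summed over the Wold decomposition of the subspace with respect to \<open>B\<close>,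
  these two identities express \<open>\<parallel>C\<parallel>\<^sup>2\<close> as \<open>2 \<parallel>K\<parallel>\<^sup>2\<close> plus a limit of \<open>\<parallel>p B\<^sup>n q\<parallel>\<^sup>2\<close>. If the compressions of
  \<open>B\<^sup>n\<close> to the complement tend strongly to 0, that limit is the trace of \<open>q\<close> on the kernel of \<open>A*\<close>. If
  moreover \<open>B\<close> is pure and the joint defect of \<open>A\<close> and \<open>B\<close> has rank one, this trace telescopes to 1
  (\<open>hs_core_eq\<close>). For \<open>\<tau>\<^sub>a(z)\<close> and \<open>\<tau>\<^sub>b(w)\<close> on \<open>M\<close> these conditions hold, and \<open>\<parallel>K\<parallel>\<^sup>2\<close> is by
  definition \<open>\<Sigma>\<^sub>1(a, b)\<close>. The identities \<open>p q = p C\<close> and \<open>A K = - C B\<close> also show that the submodule \<open>N\<close> is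
  Hilbert-Schmidt as soon as its core operator is.

  \<^emph>\<open>Bound.\<close> The complement of \<open>M\<close> is a copy of the Bergman space, and the compression of \<open>z\<close> or \<open>w\<close> to it
  is the Bergman shift, whose defect is diagonal with entries \<open>d\<^sub>m = 1/(m + 2)\<close>. The transfer map for
  the pair \<open>\<tau>\<^sub>a(z)\<close>, \<open>\<tau>\<^sub>a(w)\<close> is a unitary that preserves \<open>M\<close> (\<open>ex_unitary\<close>), so the defects of \<open>\<tau>\<^sub>a\<close> and
  \<open>\<tau>\<^sub>b\<close> are diagonal with the same entries in orthonormal bases \<open>\<nu>\<close> and \<open>\<eta>\<close>. Consequently \<open>\<Sigma>\<^sub>1(a, b)\<close> is
  the sum of \<open>d\<^sub>m d\<^sub>n |\<langle>\<eta>\<^sub>m, \<nu>\<^sub>n\<rangle>|\<^sup>2\<close>, which is at most \<open>2 \<Sum> d\<^sub>m\<^sup>2 \<le> 2\<close> (\<open>Sigma1_le\<close>).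
\<close>

section \<open>Sums of nonnegative extended reals\<close>

lemma infsum_ennreal_mono:
  fixes f g :: "'a \<Rightarrow> ennreal"
  assumes "\<And>x. x \<in> A \<Longrightarrow> f x \<le> g x"
  shows "infsum f A \<le> infsum g A"
  using assms by (intro infsum_mono nonneg_summable_on_complete) auto

lemma infsum_ennreal_sum:
  fixes f :: "'a \<Rightarrow> 'b \<Rightarrow> ennreal"
  assumes "finite F"
  shows "(\<Sum>x\<in>F. \<Sum>\<^sub>\<infinity>y\<in>B. f x y) = (\<Sum>\<^sub>\<infinity>y\<in>B. \<Sum>x\<in>F. f x y)"
  using assms by (induction F rule: finite_induct) (auto simp: infsum_add nonneg_summable_on_complete)

lemma infsum_ennreal_ge_sum:
  fixes f :: "'a \<Rightarrow> ennreal"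
  assumes "finite F" "F \<subseteq> A"
  shows "sum f F \<le> infsum f A"
  using assms by (subst nonneg_infsum_complete) (auto intro!: Sup_upper)

lemma infsum_ennreal_leI:
  fixes f :: "'a \<Rightarrow> ennreal"
  assumes "\<And>F. finite F \<Longrightarrow> F \<subseteq> A \<Longrightarrow> sum f F \<le> b"
  shows "infsum f A \<le> b"
  using assms by (intro infsum_le_finite_sums nonneg_summable_on_complete) auto

lemma infsum_ennreal_swap:
  fixes f :: "'a \<Rightarrow> 'b \<Rightarrow> ennreal"
  shows "(\<Sum>\<^sub>\<infinity>x\<in>A. \<Sum>\<^sub>\<infinity>y\<in>B. f x y) = (\<Sum>\<^sub>\<infinity>y\<in>B. \<Sum>\<^sub>\<infinity>x\<in>A. f x y)"
proof -
  have le: "(\<Sum>\<^sub>\<infinity>x\<in>A. \<Sum>\<^sub>\<infinity>y\<in>B. f x y) \<le> (\<Sum>\<^sub>\<infinity>y\<in>B. \<Sum>\<^sub>\<infinity>x\<in>A. f x y)"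
    for A :: "'c set" and B :: "'d set" and f :: "'c \<Rightarrow> 'd \<Rightarrow> ennreal"
  proof (rule infsum_ennreal_leI)
    fix F assume "finite F" "F \<subseteq> A"
    then show "(\<Sum>x\<in>F. \<Sum>\<^sub>\<infinity>y\<in>B. f x y) \<le> (\<Sum>\<^sub>\<infinity>y\<in>B. \<Sum>\<^sub>\<infinity>x\<in>A. f x y)"
      by (simp add: infsum_ennreal_sum infsum_ennreal_mono infsum_ennreal_ge_sum)
  qed
  show ?thesis
    by (intro antisym le)
qed

lemma infsum_ennreal_cmult:
  fixes f :: "'a \<Rightarrow> ennreal"
  shows "(\<Sum>\<^sub>\<infinity>x\<in>A. ennreal c * f x) = ennreal c * infsum f A"
proof (intro infsumI)
  have "(f has_sum infsum f A) A"
    by (intro has_sum_infsum nonneg_summable_on_complete) auto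
  then have "((\<lambda>F. ennreal c * sum f F) \<longlongrightarrow> ennreal c * infsum f A) (finite_subsets_at_top A)"
    unfolding has_sum_def by (intro ennreal_tendsto_cmult) auto
  then show "((\<lambda>x. ennreal c * f x) has_sum ennreal c * infsum f A) A"
    by (simp add: has_sum_def sum_distrib_left)
qed

lemma infsum_ennreal_has_sum:
  fixes f :: "'a \<Rightarrow> real"
  assumes "(f has_sum s) A" "\<And>x. x \<in> A \<Longrightarrow> 0 \<le> f x"
  shows "(\<Sum>\<^sub>\<infinity>x\<in>A. ennreal (f x)) = ennreal s"
proof (intro infsumI)
  have "((\<lambda>F. ennreal (sum f F)) \<longlongrightarrow> ennreal s) (finite_subsets_at_top A)"
    using assms(1) by (intro tendsto_ennrealI) (auto simp: has_sum_def)
  moreover have "\<forall>\<^sub>F F in finite_subsets_at_top A. ennreal (sum f F) = (\<Sum>x\<in>F. ennreal (f x))"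
    by (rule eventually_finite_subsets_at_top_weakI) (use assms(2) in \<open>auto intro!: sum_ennreal[symmetric]\<close>)
  ultimately show "((\<lambda>x. ennreal (f x)) has_sum ennreal s) A"
    by (simp add: has_sum_def tendsto_cong)
qed

lemma has_sum_real_ennreal:
  fixes f :: "'a \<Rightarrow> real"
  assumes "(\<Sum>\<^sub>\<infinity>x\<in>A. ennreal (f x)) = ennreal s" "\<And>x. x \<in> A \<Longrightarrow> 0 \<le> f x" "0 \<le> s"
  shows "(f has_sum s) A"
proof -
  have "f summable_on A"
  proof (rule nonneg_bdd_above_summable_on)
    show "bdd_above (sum f ` {F. F \<subseteq> A \<and> finite F})"
    proof (rule bdd_aboveI2[where M = s])
      fix F assume F: "F \<in> {F. F \<subseteq> A \<and> finite F}"
      then have "ennreal (sum f F) = (\<Sum>x\<in>F. ennreal (f x))"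
        using assms(2) by (intro sum_ennreal[symmetric]) auto
      also have "\<dots> \<le> ennreal s"
        using F infsum_ennreal_ge_sum[of F A "\<lambda>x. ennreal (f x)"] assms(1) by auto
      finally show "sum f F \<le> s"
        using assms(3) by simp
    qed
  qed (use assms in auto)
  then have hs: "(f has_sum infsum f A) A"
    by (rule has_sum_infsum)
  from infsum_ennreal_has_sum[OF this] assms have "ennreal (infsum f A) = ennreal s"
    by simp
  then have "infsum f A = s"
    using assms by (simp add: infsum_nonneg)
  with hs show ?thesis by simp
qed

lemma infsum_ennreal_telescope:
  fixes u :: "nat \<Rightarrow> real"
  assumes "u \<longlonglongrightarrow> l" "\<And>n. u (Suc n) \<le> u n"
  shows "(\<Sum>\<^sub>\<infinity>n. ennreal (u n - u (Suc n))) = ennreal (u 0 - l)"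
proof (rule infsum_ennreal_has_sum)
  have "(\<lambda>n. u n - u (Suc n)) sums (u 0 - l)"
    using telescope_sums'[OF assms(1)] by simp
  then show "((\<lambda>n. u n - u (Suc n)) has_sum u 0 - l) UNIV"
    using assms(2) by (intro sums_nonneg_imp_has_sum) (auto)
qed (use assms(2) in auto)

lemma infsum_ennreal_Suc:
  fixes f :: "nat \<Rightarrow> ennreal"
  shows "infsum f UNIV = f 0 + (\<Sum>\<^sub>\<infinity>n. f (Suc n))"
proof -
  have "UNIV = insert 0 (range Suc)"
    by (metis UNIV_eq_I image_eqI insertCI not0_implies_Suc rangeI)
  then have "infsum f UNIV = infsum f (insert 0 (range Suc))"
    by simp
  also have "\<dots> = f 0 + infsum f (range Suc)"
    by (subst infsum_insert) (auto intro: nonneg_summable_on_complete)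
  also have "infsum f (range Suc) = (\<Sum>\<^sub>\<infinity>n. f (Suc n))"
    by (subst infsum_reindex) (auto simp: o_def)
  finally show ?thesis .
qed

section \<open>The Hilbert space structure\<close>

lemma cinner_scaleC_right: "cinner f (scaleC c g) = cnj c * cinner f g"
  by (metis cinner_commute cinner_scaleC_left complex_cnj_mult)

lemma cinner_add_right: "cinner f (g + h) = cinner f g + cinner f h"
  by (metis cinner_add_left cinner_commute complex_cnj_add)

lemma hcoeff_diff [simp]: "hcoeff (f - g) k = hcoeff f k - hcoeff g k"
  using hcoeff_add[of "f - g" g k] by simp

lemma cinner_zero_left [simp]: "cinner 0 g = 0"
  by (simp add: cinner_def)

lemma cinner_zero_right [simp]: "cinner f 0 = 0"
  by (simp add: cinner_def)

lemma cinner_diff_left: "cinner (f - g) h = cinner f h - cinner g h"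
  using cinner_add_left[of "f - g" g h] by simp

lemma cinner_diff_right: "cinner f (g - h) = cinner f g - cinner f h"
  using cinner_add_right[of f "g - h" h] by simp

lemma hcoeff_uminus [simp]: "hcoeff (- f) k = - hcoeff f k"
  using hcoeff_diff[of 0 f k] by simp

lemma cinner_uminus_right: "cinner f (- g) = - cinner f g"
  using cinner_diff_right[of f 0 g] by simp

lemma cinner_uminus_left: "cinner (- f) g = - cinner f g"
  using cinner_diff_left[of 0 f g] by simp

lemma cinner_sum_left: "cinner (sum f A) g = (\<Sum>x\<in>A. cinner (f x) g)"
  by (induction A rule: infinite_finite_induct) (auto simp: cinner_add_left)

lemma cinner_sum_right: "cinner g (sum f A) = (\<Sum>x\<in>A. cinner g (f x))"
  by (induction A rule: infinite_finite_induct) (auto simp: cinner_add_right)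

lemmas cinner_simps = cinner_add_left cinner_add_right cinner_diff_left cinner_diff_right
  cinner_uminus_left cinner_uminus_right cinner_scaleC_left cinner_scaleC_right

lemma norm_hardy2_sq: "(norm (f :: hardy2))\<^sup>2 = (\<Sum>\<^sub>\<infinity>k. (cmod (hcoeff f k))\<^sup>2)"
  by (simp add: norm_hardy2_def infsum_nonneg)

lemma cinner_self: "cinner f f = of_real ((norm f)\<^sup>2)"
proof -
  have "Im (cinner f f) = 0"
    by (metis cinner_commute complex_cnj_cancel_iff Reals_cnj_iff complex_is_Real_iff)
  then show ?thesis
    by (simp add: complex_eq_iff Re_cinner_self norm_hardy2_sq)
qed

lemma cinner_self_eq_0: "cinner f f = 0 \<longleftrightarrow> f = 0"
  by (simp add: cinner_self)

lemma cinner_eqI: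
  assumes "\<And>h. cinner f h = cinner g h"
  shows "f = g"
  using assms[of "f - g"] cinner_self_eq_0[of "f - g"] by (simp add: cinner_diff_left)

lemma norm_scaleC [simp]: "norm (scaleC c f) = cmod c * norm f"
proof (rule power2_eq_imp_eq)
  have "of_real ((norm (scaleC c f))\<^sup>2) = cinner (scaleC c f) (scaleC c f)"
    by (simp only: cinner_self)
  also have "\<dots> = c * cnj c * cinner f f"
    by (simp add: cinner_simps)
  also have "\<dots> = of_real ((cmod c * norm f)\<^sup>2)"
    by (simp add: cinner_self power_mult_distrib flip: complex_norm_square)
  finally have "of_real ((norm (scaleC c f))\<^sup>2) = (of_real ((cmod c * norm f)\<^sup>2) :: complex)" .
  then show "(norm (scaleC c f))\<^sup>2 = (cmod c * norm f)\<^sup>2"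
    using of_real_eq_iff by blast
qed auto

lemma scaleC_of_real: "scaleC (of_real r) f = r *\<^sub>R f"
  by (simp add: scaleR_hardy2_def)

lemma scaleC_one [simp]: "scaleC 1 f = f"
  and scaleC_zero [simp]: "scaleC 0 f = 0"
  and scaleC_zero_right [simp]: "scaleC c 0 = 0"
  and scaleC_scaleC [simp]: "scaleC a (scaleC b f) = scaleC (a * b) f"
  and scaleC_add_right: "scaleC c (f + g) = scaleC c f + scaleC c g"
  and scaleC_add_left: "scaleC (a + b) f = scaleC a f + scaleC b f"
  and scaleC_diff_right: "scaleC c (f - g) = scaleC c f - scaleC c g"
  and scaleC_minus_one: "scaleC (- 1) f = - f"
  by (auto intro!: hardy2_eqI simp: fun_eq_iff algebra_simps)

lemma inner_eq_Re_cinner: "inner f g = Re (cinner f g)"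
  by (simp add: inner_hardy2_def)

lemma cauchy_schwarz: "cmod (cinner f g) \<le> norm f * norm g"
proof (cases "cinner f g = 0")
  case False
  define c where "c = cnj (cinner f g) / of_real (cmod (cinner f g))"
  have c: "cmod c = 1"
    using False by (simp add: c_def norm_divide)
  have "c * cinner f g = of_real (cmod (cinner f g))"
    using False complex_norm_square[of "cinner f g"]
    by (simp add: c_def field_simps power2_eq_square)
  then have "cmod (cinner f g) = inner (scaleC c f) g"
    by (simp add: inner_eq_Re_cinner cinner_simps)
  also have "\<dots> \<le> norm (scaleC c f) * norm g"
    by (rule norm_cauchy_schwarz)
  finally show ?thesis
    by (simp add: c)
qed auto

lemma bounded_linear_cinner_left: "bounded_linear (\<lambda>f. cinner f g)"
proof (rule bounded_linear_intro[where K = "norm g"])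
  show "cinner (r *\<^sub>R f) g = r *\<^sub>R cinner f g" for r f
    by (simp add: cinner_simps scaleR_conv_of_real flip: scaleC_of_real)
qed (auto simp: cinner_simps cauchy_schwarz)

lemma bounded_linear_cinner_right: "bounded_linear (\<lambda>g. cinner f g)"
proof (rule bounded_linear_intro[where K = "norm f"])
  show "cinner f (r *\<^sub>R g) = r *\<^sub>R cinner f g" for r g
    by (simp add: cinner_simps scaleR_conv_of_real flip: scaleC_of_real)
qed (auto simp: cinner_simps, metis cauchy_schwarz mult.commute)

lemmas tendsto_cinner_left [tendsto_intros] = bounded_linear.tendsto[OF bounded_linear_cinner_left]
lemmas tendsto_cinner_right [tendsto_intros] = bounded_linear.tendsto[OF bounded_linear_cinner_right]

lemma norm_add_sq_orthogonal:
  assumes "cinner f g = 0"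
  shows "(norm (f + g))\<^sup>2 = (norm f)\<^sup>2 + (norm g)\<^sup>2"
proof -
  have "inner f g = 0"
    using assms by (simp add: inner_eq_Re_cinner)
  then show ?thesis
    by (simp add: power2_norm_eq_inner inner_simps inner_commute)
qed

subsection \<open>Vectors with prescribed coefficients\<close>

lemma powers_abs_summable:
  fixes z w :: complex
  assumes "cmod z < 1" "cmod w < 1"
  shows "(\<lambda>k. (cmod (z ^ fst k * w ^ snd k))\<^sup>2) summable_on UNIV"
proof -
  have geo: "((\<lambda>i. ((cmod u)\<^sup>2) ^ i) has_sum 1 / (1 - (cmod u)\<^sup>2)) UNIV" if "cmod u < 1" for u :: complex
    using that by (intro sums_nonneg_imp_has_sum geometric_sums) (auto simp: abs_square_less_1)
  have "(\<lambda>k. (cmod (z ^ fst k * w ^ snd k))\<^sup>2) summable_on UNIV \<times> UNIV"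
  proof (rule summable_on_SigmaI)
    fix i :: nat
    show "((\<lambda>j. (cmod (z ^ fst (i, j) * w ^ snd (i, j)))\<^sup>2) has_sum ((cmod z)\<^sup>2) ^ i * (1 / (1 - (cmod w)\<^sup>2))) UNIV"
      using has_sum_cmult_right[OF geo[OF assms(2)], of "((cmod z)\<^sup>2) ^ i"]
      by (simp add: norm_mult norm_power power_mult_distrib flip: power_mult mult.commute[of 2])
    show "(\<lambda>i. ((cmod z)\<^sup>2) ^ i * (1 / (1 - (cmod w)\<^sup>2))) summable_on UNIV"
      using geo[OF assms(1)] by (intro summable_on_cmult_left) (auto simp: has_sum_imp_summable)
  qed auto
  then show ?thesis by simp
qed

lemma ex_hcoeff:
  assumes "(\<lambda>k. (cmod (a k))\<^sup>2) summable_on UNIV"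
  shows "\<exists>f. hcoeff f = a"
proof -
  define F where "F p = (if p \<in> bidisk then \<Sum>\<^sub>\<infinity>(i, j). a (i, j) * fst p ^ i * snd p ^ j else 0)" for p
  have "hardy_expansion a F"
    unfolding hardy_expansion_def
  proof (intro conjI allI impI assms)
    fix z w :: complex assume "(z, w) \<in> bidisk"
    moreover from this have "(\<lambda>k. a k * (z ^ fst k * w ^ snd k)) summable_on UNIV"
      by (intro abs_summable_summable[OF sq_summable_mult[OF assms]] powers_abs_summable) (auto simp: bidisk_def)
    ultimately show "((\<lambda>(i, j). a (i, j) * z ^ i * w ^ j) has_sum F (z, w)) UNIV"
      by (simp add: F_def case_prod_unfold mult.assoc)
  qed (auto simp: F_def)
  then obtain f where "hfun f = F"
    using hfun_cases by blast
  with \<open>hardy_expansion a F\<close> show ?thesis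
    by (metis hcoeff_eqI)
qed

definition of_coeffs :: "(nat \<times> nat \<Rightarrow> complex) \<Rightarrow> hardy2" where
  "of_coeffs a = (THE f. hcoeff f = a)"

lemma hcoeff_of_coeffs:
  assumes "(\<lambda>k. (cmod (a k))\<^sup>2) summable_on UNIV"
  shows "hcoeff (of_coeffs a) = a"
proof -
  have "\<exists>!f. hcoeff f = a"
    using ex_hcoeff[OF assms] hardy2_eqI by blast
  from theI'[OF this] show ?thesis
    by (simp add: of_coeffs_def)
qed

lemma sq_summable_finite_bound:
  assumes "\<And>F. finite F \<Longrightarrow> (\<Sum>k\<in>F. (cmod (a k))\<^sup>2) \<le> K"
  shows "(\<lambda>k. (cmod (a k))\<^sup>2) summable_on UNIV" "(\<Sum>\<^sub>\<infinity>k. (cmod (a k))\<^sup>2) \<le> K"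
proof -
  show "(\<lambda>k. (cmod (a k))\<^sup>2) summable_on UNIV"
    by (rule nonneg_bdd_above_summable_on) (use assms in \<open>auto intro!: bdd_aboveI2[where M = K]\<close>)
  then show "(\<Sum>\<^sub>\<infinity>k. (cmod (a k))\<^sup>2) \<le> K"
    by (rule infsum_le_finite_sums) (use assms in auto)
qed

definition monomial :: "nat \<times> nat \<Rightarrow> hardy2" where
  "monomial k = of_coeffs (\<lambda>l. if l = k then 1 else 0)"

lemma hcoeff_monomial: "hcoeff (monomial k) l = (if l = k then 1 else 0)"
proof -
  have "(\<lambda>l. (cmod (if l = k then 1 else 0))\<^sup>2) summable_on UNIV"
  proof (rule summable_on_cong_neutral[THEN iffD2])
    show "(\<lambda>l. 1) summable_on {k}" by simp
  qed auto
  from hcoeff_of_coeffs[OF this] show ?thesis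
    by (simp add: monomial_def)
qed

lemma cinner_monomial_right [simp]: "cinner f (monomial k) = hcoeff f k"
proof -
  have "cinner f (monomial k) = (\<Sum>\<^sub>\<infinity>l\<in>{k}. hcoeff f l)"
    unfolding cinner_def by (rule infsum_cong_neutral) (auto simp: hcoeff_monomial)
  then show ?thesis by simp
qed

lemma cinner_monomial_left: "cinner (monomial k) f = cnj (hcoeff f k)"
  using cinner_commute[of "monomial k" f] by simp

lemma has_sum_norm_sq: "((\<lambda>k. (cmod (hcoeff f k))\<^sup>2) has_sum (norm f)\<^sup>2) UNIV"
  by (simp add: norm_hardy2_sq hcoeff_sq_summable)

lemma sum_hcoeff_le: 
  assumes "finite F"
  shows "(\<Sum>k\<in>F. (cmod (hcoeff f k))\<^sup>2) \<le> (norm f)\<^sup>2"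
  unfolding norm_hardy2_sq
  by (rule finite_sum_le_infsum) (use hcoeff_sq_summable assms in auto)

lemma hcoeff_le_norm: "cmod (hcoeff f k) \<le> norm f"
  using sum_hcoeff_le[of "{k}" f] by (simp add: abs_le_square_iff[symmetric])

lemma norm_le_of_coeff_sums:
  assumes "\<And>F. finite F \<Longrightarrow> (\<Sum>k\<in>F. (cmod (hcoeff f k))\<^sup>2) \<le> K\<^sup>2" "0 \<le> K"
  shows "norm f \<le> K"
  using sq_summable_finite_bound(2)[OF assms(1)] assms(2)
  by (simp add: norm_hardy2_sq[symmetric] flip: abs_le_square_iff)

definition szego :: "complex \<times> complex \<Rightarrow> hardy2" where
  "szego p = of_coeffs (\<lambda>(i, j). cnj (fst p) ^ i * cnj (snd p) ^ j)"

lemma hcoeff_szego: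
  assumes "p \<in> bidisk"
  shows "hcoeff (szego p) (i, j) = cnj (fst p) ^ i * cnj (snd p) ^ j"
proof -
  have "(\<lambda>k. (cmod (case k of (i, j) \<Rightarrow> cnj (fst p) ^ i * cnj (snd p) ^ j))\<^sup>2) summable_on UNIV"
    using powers_abs_summable[of "cnj (fst p)" "cnj (snd p)"] assms
    by (auto simp: bidisk_def case_prod_unfold)
  from hcoeff_of_coeffs[OF this] show ?thesis
    by (simp add: szego_def)
qed

lemma hfun_has_sum:
  assumes "p \<in> bidisk"
  shows "((\<lambda>k. hcoeff f k * fst p ^ fst k * snd p ^ snd k) has_sum hfun f p) UNIV"
  using hardy_expansion_hcoeff[of f] assms
  by (cases p) (auto simp: hardy_expansion_def case_prod_unfold)

lemma cinner_szego:
  assumes "p \<in> bidisk"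
  shows "cinner f (szego p) = hfun f p"
proof -
  have "hcoeff f k * cnj (hcoeff (szego p) k) = hcoeff f k * fst p ^ fst k * snd p ^ snd k" for k
    using hcoeff_szego[OF assms, of "fst k" "snd k"] by simp
  then show ?thesis
    using hfun_has_sum[OF assms, of f] unfolding cinner_def by (simp only: infsumI)
qed

lemma hfun_outside: "p \<notin> bidisk \<Longrightarrow> hfun f p = 0"
  using hardy_expansion_hcoeff[of f] unfolding hardy_expansion_def by blast

lemma hardy2_eq_iff: "f = g \<longleftrightarrow> (\<forall>p\<in>bidisk. hfun f p = hfun g p)"
proof
  assume "\<forall>p\<in>bidisk. hfun f p = hfun g p"
  then have "hfun f = hfun g"
    by (metis ext hfun_outside)
  then show "f = g"
    by (simp add: hfun_inject)
qed auto

subsection \<open>Completeness and orthogonal projections\<close>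

instance hardy2 :: complete_space
proof
  fix X :: "nat \<Rightarrow> hardy2"
  assume X: "Cauchy X"
  have "Cauchy (\<lambda>n. hcoeff (X n) k)" for k
  proof (rule metric_CauchyI)
    fix e :: real assume "0 < e"
    from metric_CauchyD[OF X this] obtain N where N: "\<And>m n. m \<ge> N \<Longrightarrow> n \<ge> N \<Longrightarrow> dist (X m) (X n) < e"
      by blast
    have "dist (hcoeff (X m) k) (hcoeff (X n) k) < e" if "m \<ge> N" "n \<ge> N" for m n
      using hcoeff_le_norm[of "X m - X n" k] N[OF that] by (simp add: dist_norm)
    then show "\<exists>N. \<forall>m\<ge>N. \<forall>n\<ge>N. dist (hcoeff (X m) k) (hcoeff (X n) k) < e"
      by blast
  qed
  then have "\<exists>l. (\<lambda>n. hcoeff (X n) k) \<longlonglongrightarrow> l" for k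
    by (simp add: Cauchy_convergent_iff convergent_def)
  then obtain a where a: "\<And>k. (\<lambda>n. hcoeff (X n) k) \<longlonglongrightarrow> a k"
    by metis
  have bound: "\<exists>N. \<forall>m\<ge>N. \<forall>F. finite F \<longrightarrow> (\<Sum>k\<in>F. (cmod (hcoeff (X m) k - a k))\<^sup>2) \<le> e\<^sup>2"
    if e: "e > 0" for e
  proof -
    from metric_CauchyD[OF X e] obtain N where N: "\<And>m n. m \<ge> N \<Longrightarrow> n \<ge> N \<Longrightarrow> dist (X m) (X n) < e"
      by blast
    have "(\<Sum>k\<in>F. (cmod (hcoeff (X m) k - a k))\<^sup>2) \<le> e\<^sup>2" if "m \<ge> N" "finite F" for m F
    proof (rule tendsto_upperbound)
      show "(\<lambda>n. \<Sum>k\<in>F. (cmod (hcoeff (X m) k - hcoeff (X n) k))\<^sup>2)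
              \<longlonglongrightarrow> (\<Sum>k\<in>F. (cmod (hcoeff (X m) k - a k))\<^sup>2)"
        by (intro tendsto_intros a)
      have "(\<Sum>k\<in>F. (cmod (hcoeff (X m) k - hcoeff (X n) k))\<^sup>2) \<le> e\<^sup>2" if "n \<ge> N" for n
      proof -
        have "(\<Sum>k\<in>F. (cmod (hcoeff (X m) k - hcoeff (X n) k))\<^sup>2) \<le> (norm (X m - X n))\<^sup>2"
          using sum_hcoeff_le[OF \<open>finite F\<close>, of "X m - X n"] by simp
        also have "\<dots> \<le> e\<^sup>2"
          using N[OF \<open>m \<ge> N\<close> that] by (intro power_mono) (auto simp: dist_norm)
        finally show ?thesis .
      qed
      then show "\<forall>\<^sub>F n in sequentially. (\<Sum>k\<in>F. (cmod (hcoeff (X m) k - hcoeff (X n) k))\<^sup>2) \<le> e\<^sup>2"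
        by (auto simp: eventually_at_top_linorder)
    qed auto
    then show ?thesis by blast
  qed
  obtain N where "\<And>F. finite F \<Longrightarrow> (\<Sum>k\<in>F. (cmod (hcoeff (X N) k - a k))\<^sup>2) \<le> 1\<^sup>2"
    using bound[of 1] by auto
  then have "(\<lambda>k. (cmod (hcoeff (X N) k - a k))\<^sup>2) summable_on UNIV"
    by (intro sq_summable_finite_bound(1)[of _ 1]) simp
  from sq_summable_add[OF this hcoeff_sq_summable[of "- X N"]]
  have "(\<lambda>k. (cmod (a k))\<^sup>2) summable_on UNIV"
    by (simp add: norm_minus_commute)
  then have f: "hcoeff (of_coeffs a) = a"
    by (rule hcoeff_of_coeffs)
  have "X \<longlonglongrightarrow> of_coeffs a"
  proof (rule metric_LIMSEQ_I)
    fix r :: real assume "0 < r"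
    then obtain N where N: "\<And>m F. m \<ge> N \<Longrightarrow> finite F \<Longrightarrow> (\<Sum>k\<in>F. (cmod (hcoeff (X m) k - a k))\<^sup>2) \<le> (r/2)\<^sup>2"
      using bound[of "r/2"] by auto
    have "dist (X m) (of_coeffs a) < r" if "m \<ge> N" for m
    proof -
      have "norm (X m - of_coeffs a) \<le> r/2"
        using N[OF that] \<open>0 < r\<close> by (intro norm_le_of_coeff_sums) (auto simp: f)
      then show ?thesis
        using \<open>0 < r\<close> by (simp add: dist_norm)
    qed
    then show "\<exists>N. \<forall>m\<ge>N. dist (X m) (of_coeffs a) < r"
      by blast
  qed
  then show "convergent X"
    by (auto simp: convergent_def)
qed

definition closed_csubspace :: "hardy2 set \<Rightarrow> bool" where
  "closed_csubspace M \<longleftrightarrow> closed M \<and> 0 \<in> M \<and> (\<forall>f\<in>M. \<forall>g\<in>M. f + g \<in> M) \<and> (\<forall>c. \<forall>f\<in>M. scaleC c f \<in> M)"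

lemma closed_csubspace_UNIV: "closed_csubspace UNIV"
  by (simp add: closed_csubspace_def)

lemma closed_csubspace_diff:
  assumes "closed_csubspace M" "f \<in> M" "g \<in> M"
  shows "f - g \<in> M"
proof -
  have "f + scaleC (-1) g \<in> M"
    using assms unfolding closed_csubspace_def by blast
  then show ?thesis by (simp add: scaleC_minus_one)
qed

lemma inner_eq_0_of_minimal:
  fixes x h :: "'a :: real_inner"
  assumes "\<And>t. (norm x)\<^sup>2 \<le> (norm (x - t *\<^sub>R h))\<^sup>2"
  shows "inner x h = 0"
proof (cases "h = 0")
  case False
  define t where "t = inner x h / inner h h"
  have h: "inner h h > 0"
    using False by simp
  have "(norm (x - t *\<^sub>R h))\<^sup>2 = (norm x)\<^sup>2 - 2 * t * inner x h + t\<^sup>2 * inner h h"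
    by (simp add: power2_norm_eq_inner inner_diff inner_commute power2_eq_square[of t] algebra_simps)
  also have "\<dots> = (norm x)\<^sup>2 - (inner x h)\<^sup>2 / inner h h"
    using h by (simp add: t_def field_simps power2_eq_square)
  finally have "(inner x h)\<^sup>2 / inner h h \<le> 0"
    using assms[of t] by simp
  then show ?thesis
    using h by (simp add: divide_le_0_iff)
qed auto

text \<open>
  The nearest point: a minimizing sequence is Cauchy by the parallelogram law, and minimality along
  all real and imaginary directions is orthogonality.
\<close>

lemma ex_orthogonal_projection:
  assumes M: "closed_csubspace M"
  shows "\<exists>g\<in>M. \<forall>h\<in>M. cinner (f - g) h = 0"
proof -
  define d where "d = (INF g\<in>M. (norm (f - g))\<^sup>2)"
  have ne: "M \<noteq> {}"
    using M by (auto simp: closed_csubspace_def)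
  have bdd: "bdd_below ((\<lambda>g. (norm (f - g))\<^sup>2) ` M)"
    by (rule bdd_belowI2[where m = 0]) auto
  have d_le: "d \<le> (norm (f - g))\<^sup>2" if "g \<in> M" for g
    unfolding d_def by (rule cINF_lower[OF bdd that])
  have "\<exists>g\<in>M. (norm (f - g))\<^sup>2 < d + inverse (real (Suc n))" for n
    using cInf_lessD[of "(\<lambda>g. (norm (f - g))\<^sup>2) ` M" "d + inverse (real (Suc n))"] ne
    by (auto simp: d_def)
  then obtain g where g: "\<And>n. g n \<in> M" "\<And>n. (norm (f - g n))\<^sup>2 < d + inverse (real (Suc n))"
    by metis
  have par: "(norm (g m - g n))\<^sup>2 \<le> 2 * inverse (real (Suc m)) + 2 * inverse (real (Suc n))" for m n
  proof -
    have mid: "(1/2) *\<^sub>R (g m + g n) \<in> M"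
      using M g(1) by (simp add: closed_csubspace_def flip: scaleC_of_real)
    have "(norm (g m - g n))\<^sup>2 = 2 * (norm (f - g m))\<^sup>2 + 2 * (norm (f - g n))\<^sup>2
        - 4 * (norm (f - (1/2) *\<^sub>R (g m + g n)))\<^sup>2"
      by (simp add: power2_norm_eq_inner inner_simps inner_commute algebra_simps)
    also have "\<dots> \<le> 2 * inverse (real (Suc m)) + 2 * inverse (real (Suc n))"
      using g(2)[of m] g(2)[of n] d_le[OF mid] by linarith
    finally show ?thesis .
  qed
  have "Cauchy g"
  proof (rule metric_CauchyI)
    fix e :: real assume "0 < e"
    then obtain N where N: "inverse (real (Suc N)) < e\<^sup>2 / 4"
      using reals_Archimedean[of "e\<^sup>2/4"] by auto
    have "dist (g m) (g n) < e" if "m \<ge> N" "n \<ge> N" for m n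
    proof -
      have "inverse (real (Suc m)) \<le> inverse (real (Suc N))" "inverse (real (Suc n)) \<le> inverse (real (Suc N))"
        using that by (auto intro!: le_imp_inverse_le)
      then have "(norm (g m - g n))\<^sup>2 < e\<^sup>2"
        using par[of m n] N by linarith
      then show ?thesis
        using \<open>0 < e\<close> by (simp add: dist_norm power_less_imp_less_base)
    qed
    then show "\<exists>N. \<forall>m\<ge>N. \<forall>n\<ge>N. dist (g m) (g n) < e"
      by blast
  qed
  then obtain l where l: "g \<longlonglongrightarrow> l"
    using Cauchy_convergent_iff convergent_def by metis
  have lM: "l \<in> M"
    using M g(1) l by (auto simp: closed_csubspace_def intro: closed_sequentially)
  have "(norm (f - l))\<^sup>2 \<le> d + 0"
  proof (rule LIMSEQ_le)
    show "(\<lambda>n. (norm (f - g n))\<^sup>2) \<longlonglongrightarrow> (norm (f - l))\<^sup>2"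
      by (intro tendsto_intros l)
    show "(\<lambda>n. d + inverse (real (Suc n))) \<longlonglongrightarrow> d + 0"
      by (intro tendsto_intros LIMSEQ_inverse_real_of_nat)
  qed (use g(2) in \<open>auto intro: less_imp_le\<close>)
  then have min: "(norm (f - l))\<^sup>2 \<le> (norm (f - l - t *\<^sub>R h))\<^sup>2" if "h \<in> M" for t h
  proof -
    have "l + t *\<^sub>R h \<in> M"
      using M lM that by (simp add: closed_csubspace_def flip: scaleC_of_real)
    from d_le[OF this] \<open>(norm (f - l))\<^sup>2 \<le> d + 0\<close>
    have "(norm (f - l))\<^sup>2 \<le> (norm (f - (l + t *\<^sub>R h)))\<^sup>2"
      by linarith
    then show ?thesis
      by (simp only: diff_diff_eq)
  qed
  have "cinner (f - l) h = 0" if h: "h \<in> M" for h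
  proof -
    have "Re (cinner (f - l) h) = 0"
      using inner_eq_0_of_minimal[OF min[OF h]] by (simp add: inner_eq_Re_cinner)
    moreover have "scaleC \<i> h \<in> M"
      using M h by (auto simp: closed_csubspace_def)
    then have "Re (cinner (f - l) (scaleC \<i> h)) = 0"
      using inner_eq_0_of_minimal[OF min] by (simp add: inner_eq_Re_cinner)
    then have "Im (cinner (f - l) h) = 0"
      by (simp add: cinner_simps)
    ultimately show ?thesis
      by (simp add: complex_eq_iff)
  qed
  with lM show ?thesis by blast
qed

lemma orth_proj_unique:
  assumes M: "closed_csubspace M" and g: "g \<in> M" "\<And>h. h \<in> M \<Longrightarrow> cinner (f - g) h = 0"
  shows "orth_proj M f = g"
  unfolding orth_proj_def
proof (rule the_equality)
  fix g' assume g': "g' \<in> M \<and> (\<forall>h\<in>M. cinner (f - g') h = 0)"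
  have "g' - g \<in> M"
    using closed_csubspace_diff[OF M] g g' by blast
  then have "cinner (f - g) (g' - g) = 0" "cinner (f - g') (g' - g) = 0"
    using g g' by auto
  moreover have "cinner (g' - g) (g' - g) = cinner (f - g) (g' - g) - cinner (f - g') (g' - g)"
    by (simp add: cinner_simps)
  ultimately have "cinner (g' - g) (g' - g) = 0"
    by simp
  then show "g' = g"
    by (simp add: cinner_self_eq_0)
qed (use g in auto)

lemma
  assumes M: "closed_csubspace M"
  shows orth_proj_in: "orth_proj M f \<in> M"
    and orth_proj_orth: "h \<in> M \<Longrightarrow> cinner (f - orth_proj M f) h = 0"
proof -
  obtain g where "g \<in> M" "\<And>h. h \<in> M \<Longrightarrow> cinner (f - g) h = 0"
    using ex_orthogonal_projection[OF M] by blast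
  moreover from this have "orth_proj M f = g"
    by (rule orth_proj_unique[OF M])
  ultimately show "orth_proj M f \<in> M" "h \<in> M \<Longrightarrow> cinner (f - orth_proj M f) h = 0"
    by auto
qed

lemma orth_proj_cinner_left: "closed_csubspace M \<Longrightarrow> h \<in> M \<Longrightarrow> cinner (orth_proj M f) h = cinner f h"
  using orth_proj_orth[of M h f] by (simp add: cinner_simps)

lemma orth_proj_cinner_right: "closed_csubspace M \<Longrightarrow> h \<in> M \<Longrightarrow> cinner h (orth_proj M f) = cinner h f"
  using orth_proj_cinner_left[of M h f] by (metis cinner_commute)

lemma orth_proj_eq: "closed_csubspace M \<Longrightarrow> f \<in> M \<Longrightarrow> orth_proj M f = f"
  by (rule orth_proj_unique) auto

lemma orth_proj_selfadjoint:
  assumes "closed_csubspace M"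
  shows "cinner (orth_proj M f) g = cinner f (orth_proj M g)"
  by (metis assms orth_proj_cinner_left orth_proj_cinner_right orth_proj_in)

lemma orth_proj_eq_0:
  assumes "closed_csubspace M" "\<And>h. h \<in> M \<Longrightarrow> cinner f h = 0"
  shows "orth_proj M f = 0"
  by (rule orth_proj_unique) (use assms in \<open>auto simp: closed_csubspace_def\<close>)

lemma norm_orth_proj_sq:
  assumes "closed_csubspace M"
  shows "(norm f)\<^sup>2 = (norm (orth_proj M f))\<^sup>2 + (norm (f - orth_proj M f))\<^sup>2"
  using norm_add_sq_orthogonal[of "f - orth_proj M f" "orth_proj M f"]
    orth_proj_orth[OF assms orth_proj_in[OF assms], of f] by simp

lemma norm_orth_proj_le:
  assumes "closed_csubspace M"
  shows "norm (orth_proj M f) \<le> norm f"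
  by (rule power2_le_imp_le) (use norm_orth_proj_sq[OF assms, of f] in auto)

text \<open>
  Identities between operators are below verified on total sets, either the monomials or the Szego
  kernels, and propagated by this principle.
\<close>

lemma total_subspace_UNIV:
  assumes S: "closed_csubspace S" and "X \<subseteq> S" and "\<And>f. (\<And>x. x \<in> X \<Longrightarrow> cinner f x = 0) \<Longrightarrow> f = 0"
  shows "S = UNIV"
proof -
  have "f - orth_proj S f = 0" for f
    by (rule assms(3)) (use assms(2) orth_proj_orth[OF S] in blast)
  then show ?thesis
    using orth_proj_in[OF S] by (metis UNIV_eq_I eq_iff_diff_eq_0)
qed

lemma szego_total: "(\<And>x. x \<in> szego ` bidisk \<Longrightarrow> cinner f x = 0) \<Longrightarrow> f = 0"
  by (metis cinner_szego hardy2_eq_iff imageI zero_hardy2.rep_eq)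

lemma monomial_total: "(\<And>x. x \<in> range monomial \<Longrightarrow> cinner f x = 0) \<Longrightarrow> f = 0"
  by (intro hardy2_eqI ext) (metis cinner_monomial_right hcoeff_zero rangeI)

subsection \<open>Orthonormal bases and Parseval's identity\<close>

lemma norm_diff_sum_orthonormal:
  assumes "finite F" "\<And>e. e \<in> F \<Longrightarrow> norm e = 1" "\<And>e e'. e \<in> F \<Longrightarrow> e' \<in> F \<Longrightarrow> e \<noteq> e' \<Longrightarrow> cinner e e' = 0"
  shows "(norm (f - (\<Sum>e\<in>F. scaleC (cinner f e) e)))\<^sup>2 = (norm f)\<^sup>2 - (\<Sum>e\<in>F. (cmod (cinner f e))\<^sup>2)"
  using assms
proof (induction F rule: finite_induct)
  case (insert e F)
  define s where "s = (\<Sum>e\<in>F. scaleC (cinner f e) e)"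
  have "cinner s e = (\<Sum>x\<in>F. 0)"
    unfolding s_def cinner_sum_left using insert by (intro sum.cong) (auto simp: cinner_simps)
  then have se: "cinner s e = 0" by simp
  have ee: "cinner e e = 1"
    using insert.prems(1)[of e] by (simp add: cinner_self)
  define x where "x = f - s - scaleC (cinner f e) e"
  have "cinner x (scaleC (cinner f e) e) = 0"
    by (simp add: x_def cinner_simps se ee)
  from norm_add_sq_orthogonal[OF this] have "(norm (f - s))\<^sup>2 = (norm x)\<^sup>2 + (cmod (cinner f e))\<^sup>2"
    using insert.prems(1)[of e] by (simp add: x_def)
  moreover have "(norm (f - s))\<^sup>2 = (norm f)\<^sup>2 - (\<Sum>e\<in>F. (cmod (cinner f e))\<^sup>2)"
    unfolding s_def using insert by auto
  moreover have "f - (\<Sum>e\<in>insert e F. scaleC (cinner f e) e) = x"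
    using insert.hyps by (simp add: x_def s_def)
  ultimately show ?case
    using insert.hyps by simp
qed auto

lemma bessel:
  assumes "finite F" "\<And>e. e \<in> F \<Longrightarrow> norm e = 1" "\<And>e e'. e \<in> F \<Longrightarrow> e' \<in> F \<Longrightarrow> e \<noteq> e' \<Longrightarrow> cinner e e' = 0"
  shows "(\<Sum>e\<in>F. (cmod (cinner f e))\<^sup>2) \<le> (norm f)\<^sup>2"
  using norm_diff_sum_orthonormal[OF assms, of f]
    zero_le_power2[of "norm (f - (\<Sum>e\<in>F. scaleC (cinner f e) e))"] by simp

text \<open>
  Zorn's lemma provides a maximal orthonormal set; a vector orthogonal to it could be normalized and
  added.
\<close>

lemma ex_orthonormal_basis:
  assumes M: "closed_csubspace M"
  shows "\<exists>B. orthonormal_basis M B"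
proof -
  define \<A> where "\<A> = {B. B \<subseteq> M \<and> (\<forall>e\<in>B. norm e = 1) \<and> (\<forall>e\<in>B. \<forall>e'\<in>B. e \<noteq> e' \<longrightarrow> cinner e e' = 0)}"
  have "\<exists>B\<in>\<A>. \<forall>X\<in>\<A>. B \<subseteq> X \<longrightarrow> X = B"
  proof (rule subset_Zorn')
    fix C assume "subset.chain \<A> C"
    then have C: "C \<subseteq> \<A>" "\<And>X Y. X \<in> C \<Longrightarrow> Y \<in> C \<Longrightarrow> X \<subseteq> Y \<or> Y \<subseteq> X"
      by (auto simp: subset_chain_def)
    have "cinner e e' = 0" if ee': "e \<in> \<Union>C" "e' \<in> \<Union>C" "e \<noteq> e'" for e e'
    proof -
      obtain X Y where "X \<in> C" "Y \<in> C" "e \<in> X" "e' \<in> Y"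
        using ee' by blast
      with C(2) obtain Z where "Z \<in> C" "e \<in> Z" "e' \<in> Z"
        by blast
      with C(1) ee' show ?thesis
        by (auto simp: \<A>_def)
    qed
    then show "\<Union>C \<in> \<A>"
      using C(1) by (auto simp: \<A>_def)
  qed
  then obtain B where B: "B \<in> \<A>" and max: "\<And>X. X \<in> \<A> \<Longrightarrow> B \<subseteq> X \<Longrightarrow> X = B"
    by blast
  have "f = 0" if f: "f \<in> M" "\<forall>e\<in>B. cinner f e = 0" for f
  proof (rule ccontr)
    assume "f \<noteq> 0"
    define u where "u = scaleC (of_real (inverse (norm f))) f"
    have "norm u = 1"
      using \<open>f \<noteq> 0\<close> by (simp add: u_def norm_inverse)
    moreover have "u \<in> M"
      using M f by (simp add: u_def closed_csubspace_def)
    moreover have ue: "cinner u e = 0" "cinner e u = 0" if "e \<in> B" for e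
      using f that cinner_commute[of e u] by (simp_all add: u_def cinner_simps)
    ultimately have "insert u B \<in> \<A>"
      using B by (auto simp: \<A>_def)
    from max[OF this] have "u \<in> B"
      by blast
    with ue(1)[of u] \<open>norm u = 1\<close> show False
      by (simp add: cinner_self)
  qed
  with B show ?thesis
    by (auto simp: orthonormal_basis_def \<A>_def)
qed

text \<open>
  The vectors that satisfy Parseval's identity form a closed subspace, because they are those that
  the partial sums of the expansion approximate. As this subspace contains the basis, no nonzero
  vector of \<open>M\<close> is orthogonal to its intersection with \<open>M\<close>.
\<close>

lemma parseval:
  assumes M: "closed_csubspace M" and B: "orthonormal_basis M B" and "f \<in> M"
  shows "(\<Sum>\<^sub>\<infinity>e\<in>B. ennreal ((cmod (cinner f e))\<^sup>2)) = ennreal ((norm f)\<^sup>2)"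
proof -
  have on: "\<And>e. e \<in> B \<Longrightarrow> norm e = 1" "\<And>e e'. e \<in> B \<Longrightarrow> e' \<in> B \<Longrightarrow> e \<noteq> e' \<Longrightarrow> cinner e e' = 0"
    and BM: "B \<subseteq> M" and total: "\<And>f. f \<in> M \<Longrightarrow> (\<And>e. e \<in> B \<Longrightarrow> cinner f e = 0) \<Longrightarrow> f = 0"
    using B by (auto simp: orthonormal_basis_def)
  define s where "s F f = (\<Sum>e\<in>F. scaleC (cinner f e) e)" for F f
  have s_add: "s F (f + g) = s F f + s F g" for F f g
    by (simp add: s_def cinner_simps scaleC_add_left sum.distrib)
  have s_diff: "s F (f - g) = s F f - s F g" for F f g
    using s_add[of F "f - g" g] by simp
  have s_scale: "s F (scaleC c f) = scaleC c (s F f)" for F c f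
    unfolding s_def by (induction F rule: infinite_finite_induct) (auto simp: cinner_simps scaleC_add_right)
  have rest: "(norm (f - s F f))\<^sup>2 = (norm f)\<^sup>2 - (\<Sum>e\<in>F. (cmod (cinner f e))\<^sup>2)"
    if "finite F" "F \<subseteq> B" for f F
    unfolding s_def by (intro norm_diff_sum_orthonormal) (use that on in blast)+
  have rest_mono: "norm (f - s G f) \<le> norm (f - s F f)" if "finite G" "G \<subseteq> B" "F \<subseteq> G" for f F G
  proof (rule power2_le_imp_le)
    have "finite F" "F \<subseteq> B" using that finite_subset by auto
    moreover have "(\<Sum>e\<in>F. (cmod (cinner f e))\<^sup>2) \<le> (\<Sum>e\<in>G. (cmod (cinner f e))\<^sup>2)"
      using that by (intro sum_mono2) auto
    ultimately show "(norm (f - s G f))\<^sup>2 \<le> (norm (f - s F f))\<^sup>2"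
      using that by (simp add: rest)
  qed auto
  define T where "T = {f. \<forall>\<epsilon>>0. \<exists>F. finite F \<and> F \<subseteq> B \<and> norm (f - s F f) < \<epsilon>}"
  have T: "closed_csubspace T"
    unfolding closed_csubspace_def
  proof (intro conjI ballI allI)
    show "0 \<in> T"
      by (auto simp: T_def s_def intro!: exI[of _ "{}"])
  next
    fix f g assume f: "f \<in> T" and g: "g \<in> T"
    show "f + g \<in> T"
      unfolding T_def
    proof (intro CollectI allI impI)
      fix \<epsilon> :: real assume "\<epsilon> > 0"
      then have "\<epsilon>/2 > 0" by simp
      with f g obtain F G where F: "finite F" "F \<subseteq> B" "norm (f - s F f) < \<epsilon>/2"
        and G: "finite G" "G \<subseteq> B" "norm (g - s G g) < \<epsilon>/2"
        unfolding T_def by blast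
      have "norm ((f + g) - s (F \<union> G) (f + g)) \<le> norm (f - s (F \<union> G) f) + norm (g - s (F \<union> G) g)"
        using norm_triangle_ineq[of "f - s (F \<union> G) f" "g - s (F \<union> G) g"] by (simp add: s_add algebra_simps)
      also have "\<dots> \<le> norm (f - s F f) + norm (g - s G g)"
        using F G by (intro add_mono rest_mono) auto
      finally show "\<exists>F. finite F \<and> F \<subseteq> B \<and> norm ((f + g) - s F (f + g)) < \<epsilon>"
        using F G by (intro exI[of _ "F \<union> G"]) auto
    qed
  next
    fix c f assume f: "f \<in> T"
    show "scaleC c f \<in> T"
      unfolding T_def
    proof (intro CollectI allI impI)
      fix \<epsilon> :: real assume "\<epsilon> > 0"
      then have "\<epsilon> / (cmod c + 1) > 0"
        by (intro divide_pos_pos) (auto simp: add_nonneg_pos)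
      with f obtain F where F: "finite F" "F \<subseteq> B" "norm (f - s F f) < \<epsilon> / (cmod c + 1)"
        unfolding T_def by blast
      have "norm (scaleC c f - s F (scaleC c f)) = cmod c * norm (f - s F f)"
        by (simp add: s_scale flip: scaleC_diff_right)
      also have "\<dots> \<le> (cmod c + 1) * norm (f - s F f)"
        by (simp add: mult_right_mono)
      also have "\<dots> < \<epsilon>"
        using F(3) by (simp add: pos_less_divide_eq add_nonneg_pos mult.commute)
      finally show "\<exists>F. finite F \<and> F \<subseteq> B \<and> norm (scaleC c f - s F (scaleC c f)) < \<epsilon>"
        using F by blast
    qed
  next
    show "closed T"
      unfolding closed_sequential_limits
    proof (intro allI impI)
      fix X l assume X: "(\<forall>n. X n \<in> T) \<and> X \<longlonglongrightarrow> l"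
      show "l \<in> T"
        unfolding T_def
      proof (intro CollectI allI impI)
        fix \<epsilon> :: real assume "\<epsilon> > 0"
        then have e: "\<epsilon>/2 > 0" by simp
        from X e obtain n where n: "norm (X n - l) < \<epsilon>/2"
          using LIMSEQ_D[of X l "\<epsilon>/2"] by blast
        from X e obtain F where F: "finite F" "F \<subseteq> B" "norm (X n - s F (X n)) < \<epsilon>/2"
          unfolding T_def by blast
        define u where "u = l - X n"
        have "norm (u - s F u) \<le> norm (u - s {} u)"
          using F by (intro rest_mono) auto
        then have "norm (u - s F u) < \<epsilon>/2"
          using n by (simp add: u_def s_def norm_minus_commute)
        moreover have "l - s F l = (X n - s F (X n)) + (u - s F u)"
          by (simp add: u_def s_diff)
        ultimately have "norm (l - s F l) < \<epsilon>"
          using F(3) norm_triangle_ineq[of "X n - s F (X n)" "u - s F u"] by simp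
        then show "\<exists>F. finite F \<and> F \<subseteq> B \<and> norm (l - s F l) < \<epsilon>"
          using F by blast
      qed
    qed
  qed
  have BT: "B \<subseteq> T"
  proof
    fix e assume "e \<in> B"
    then show "e \<in> T"
      unfolding T_def using on(1)[of e] by (auto intro!: exI[of _ "{e}"] simp: s_def cinner_self)
  qed
  have TM: "closed_csubspace (T \<inter> M)"
    using T M by (auto simp: closed_csubspace_def)
  have "f - orth_proj (T \<inter> M) f = 0"
  proof (rule total)
    show "f - orth_proj (T \<inter> M) f \<in> M"
      using orth_proj_in[OF TM] \<open>f \<in> M\<close> M by (auto intro: closed_csubspace_diff)
    show "cinner (f - orth_proj (T \<inter> M) f) e = 0" if "e \<in> B" for e
      using that BT BM by (intro orth_proj_orth[OF TM]) auto
  qed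
  then have "f \<in> T"
    using orth_proj_in[OF TM, of f] by simp
  have bes: "(\<Sum>e\<in>F. (cmod (cinner f e))\<^sup>2) \<le> (norm f)\<^sup>2" if "finite F" "F \<subseteq> B" for F
    by (intro bessel) (use that on in blast)+
  have summ: "(\<lambda>e. (cmod (cinner f e))\<^sup>2) summable_on B"
    using bes by (intro nonneg_bdd_above_summable_on bdd_aboveI2[where M = "(norm f)\<^sup>2"]) auto
  have "(norm f)\<^sup>2 \<le> (\<Sum>\<^sub>\<infinity>e\<in>B. (cmod (cinner f e))\<^sup>2)"
  proof (rule field_le_epsilon)
    fix \<epsilon> :: real assume "\<epsilon> > 0"
    then have "sqrt \<epsilon> > 0" by simp
    with \<open>f \<in> T\<close> obtain F where F: "finite F" "F \<subseteq> B" "norm (f - s F f) < sqrt \<epsilon>"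
      unfolding T_def by blast
    have "(norm (f - s F f))\<^sup>2 \<le> (sqrt \<epsilon>)\<^sup>2"
      using F(3) by (intro power_mono) auto
    then have "(norm f)\<^sup>2 \<le> (\<Sum>e\<in>F. (cmod (cinner f e))\<^sup>2) + \<epsilon>"
      using \<open>\<epsilon> > 0\<close> rest[OF F(1,2), of f] by simp
    also have "(\<Sum>e\<in>F. (cmod (cinner f e))\<^sup>2) \<le> (\<Sum>\<^sub>\<infinity>e\<in>B. (cmod (cinner f e))\<^sup>2)"
      using summ F by (intro finite_sum_le_infsum) auto
    finally show "(norm f)\<^sup>2 \<le> (\<Sum>\<^sub>\<infinity>e\<in>B. (cmod (cinner f e))\<^sup>2) + \<epsilon>"
      by simp
  qed
  moreover have "(\<Sum>\<^sub>\<infinity>e\<in>B. (cmod (cinner f e))\<^sup>2) \<le> (norm f)\<^sup>2"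
    using summ bes by (rule infsum_le_finite_sums)
  ultimately have "((\<lambda>e. (cmod (cinner f e))\<^sup>2) has_sum (norm f)\<^sup>2) B"
    using has_sum_infsum[OF summ] by simp
  then show ?thesis
    by (rule infsum_ennreal_has_sum) auto
qed

section \<open>Adjoints\<close>

lemma hcoeff_sum: "hcoeff (sum f A) k = (\<Sum>x\<in>A. hcoeff (f x) k)"
  by (induction A rule: infinite_finite_induct) auto

text \<open>
  An operator is always accompanied by its adjoint: the relation between the two implies linearity and
  is preserved by all the operations performed on operators.
\<close>

definition adjoint_pair :: "(hardy2 \<Rightarrow> hardy2) \<Rightarrow> (hardy2 \<Rightarrow> hardy2) \<Rightarrow> bool" where
  "adjoint_pair T T' \<longleftrightarrow> (\<forall>f g. cinner (T f) g = cinner f (T' g))"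

lemma adjoint_pairD: "adjoint_pair T T' \<Longrightarrow> cinner (T f) g = cinner f (T' g)"
  by (simp add: adjoint_pair_def)

lemma adjoint_pairD2: "adjoint_pair T T' \<Longrightarrow> cinner (T' f) g = cinner f (T g)"
  by (metis adjoint_pair_def cinner_commute)

lemma adjoint_pair_sym: "adjoint_pair T T' \<Longrightarrow> adjoint_pair T' T"
  by (subst adjoint_pair_def) (intro allI adjoint_pairD2)

lemma adjoint_pair_comp: "adjoint_pair S S' \<Longrightarrow> adjoint_pair T T' \<Longrightarrow> adjoint_pair (\<lambda>f. S (T f)) (\<lambda>f. T' (S' f))"
  by (simp add: adjoint_pair_def)

lemma adjoint_pair_id: "adjoint_pair (\<lambda>f. f) (\<lambda>f. f)"
  by (simp add: adjoint_pair_def)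

lemma adjoint_pair_orth_proj: "closed_csubspace M \<Longrightarrow> adjoint_pair (orth_proj M) (orth_proj M)"
  by (simp add: adjoint_pair_def orth_proj_selfadjoint)

lemma adjoint_pair_diff:
  "adjoint_pair S S' \<Longrightarrow> adjoint_pair T T' \<Longrightarrow> adjoint_pair (\<lambda>f. S f - T f) (\<lambda>f. S' f - T' f)"
  by (simp add: adjoint_pair_def cinner_simps)

lemma adjoint_pair_unique: "adjoint_pair T T' \<Longrightarrow> adjoint_pair T T'' \<Longrightarrow> T' = T''"
  by (intro ext cinner_eqI) (metis adjoint_pairD2)

lemma
  assumes "adjoint_pair T T'"
  shows adjoint_pair_map_add: "T (f + g) = T f + T g"
    and adjoint_pair_map_diff: "T (f - g) = T f - T g"
    and adjoint_pair_map_scale: "T (scaleC c f) = scaleC c (T f)"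
    and adjoint_pair_map_zero: "T 0 = 0"
  using adjoint_pairD[OF assms] by (auto intro!: cinner_eqI simp: cinner_simps)

lemma adjoint_pair_norm_le:
  assumes "adjoint_pair T T'" "\<And>f. norm (T f) \<le> norm f"
  shows "norm (T' g) \<le> norm g"
proof (cases "T' g = 0")
  case False
  have "(norm (T' g))\<^sup>2 = cmod (cinner (T' g) (T' g))"
    by (simp add: cinner_self norm_power)
  also have "\<dots> = cmod (cinner (T (T' g)) g)"
    by (simp add: adjoint_pairD[OF assms(1)])
  also have "\<dots> \<le> norm (T' g) * norm g"
    using cauchy_schwarz[of "T (T' g)" g] assms(2)[of "T' g"] by (meson mult_right_mono norm_ge_zero order_trans)
  finally show ?thesis
    using False by (simp add: power2_eq_square)
qed auto

lemma adjoint_pair_eqI: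
  assumes "adjoint_pair S S'" "adjoint_pair T T'"
    and "\<And>f. (\<And>x. x \<in> X \<Longrightarrow> cinner f x = 0) \<Longrightarrow> f = 0" "\<And>x. x \<in> X \<Longrightarrow> S x = T x"
  shows "S = T"
proof -
  have "S' g - T' g = 0" for g
    by (rule assms(3)) (simp add: cinner_simps adjoint_pairD2[OF assms(1)] adjoint_pairD2[OF assms(2)] assms(4))
  then have "S' = T'"
    by auto
  with assms(1,2) show ?thesis
    by (metis adjoint_pair_sym adjoint_pair_unique)
qed

text \<open>
  The coefficients of the value of the adjoint are forced. Their square summability follows by testing
  the bound for \<open>T\<close> on the finite sums formed with these same coefficients.
\<close>

lemma ex_adjoint:
  assumes "bounded_linear T" "\<And>c f. T (scaleC c f) = scaleC c (T f)"
  shows "\<exists>T'. adjoint_pair T T'"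
proof -
  have "\<exists>h. \<forall>f. cinner (T f) g = cinner f h" for g
  proof -
    interpret bounded_linear T by (rule assms(1))
    from bounded_linear.pos_bounded[OF assms(1)]
    obtain K where K: "K > 0" "\<And>f. norm (T f) \<le> norm f * K"
      by auto
    define c where "c k = cnj (cinner (T (monomial k)) g)" for k
    have "(\<Sum>k\<in>F. (cmod (c k))\<^sup>2) \<le> (K * norm g)\<^sup>2" if "finite F" for F
    proof -
      define x where "x = (\<Sum>k\<in>F. scaleC (c k) (monomial k))"
      define S where "S = (\<Sum>k\<in>F. (cmod (c k))\<^sup>2)"
      have coeff: "hcoeff x k = (if k \<in> F then c k else 0)" for k
      proof -
        have "hcoeff x k = (\<Sum>l\<in>F. c l * hcoeff (monomial l) k)"
          by (simp add: x_def hcoeff_sum)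
        also have "\<dots> = (\<Sum>l\<in>F. if k = l then c l else 0)"
          by (intro sum.cong) (auto simp: hcoeff_monomial)
        finally show ?thesis
          using that by simp
      qed
      have "(norm x)\<^sup>2 = (\<Sum>\<^sub>\<infinity>k\<in>F. (cmod (c k))\<^sup>2)"
        unfolding norm_hardy2_sq by (rule infsum_cong_neutral) (auto simp: coeff)
      then have nx: "(norm x)\<^sup>2 = S"
        using that by (simp add: S_def)
      have "cinner (T x) g = (\<Sum>k\<in>F. of_real ((cmod (c k))\<^sup>2))"
        unfolding x_def sum assms(2) cinner_sum_left cinner_scaleC_left complex_norm_square
        by (simp add: c_def)
      then have "S = cmod (cinner (T x) g)"
        by (simp add: S_def sum_nonneg flip: of_real_sum of_real_power)
      also have "\<dots> \<le> norm (T x) * norm g"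
        by (rule cauchy_schwarz)
      also have "\<dots> \<le> (norm x * K) * norm g"
        using K by (intro mult_right_mono) auto
      finally have "norm x * norm x \<le> norm x * (K * norm g)"
        by (simp add: nx[symmetric] power2_eq_square mult_ac)
      then have "norm x \<le> K * norm g"
        using K by (cases "norm x = 0") auto
      then show ?thesis
        unfolding S_def[symmetric] nx[symmetric] by (intro power_mono) auto
    qed
    then have "(\<lambda>k. (cmod (c k))\<^sup>2) summable_on UNIV"
      by (rule sq_summable_finite_bound(1))
    then have hc: "hcoeff (of_coeffs c) = c"
      by (rule hcoeff_of_coeffs)
    define S where "S = {f. cinner (T f) g = cinner f (of_coeffs c)}"
    have "S = UNIV"
    proof (rule total_subspace_UNIV[OF _ _ monomial_total])
      have cont: "continuous_on UNIV (\<lambda>f. cinner (T f) g)" "continuous_on UNIV (\<lambda>f. cinner f (of_coeffs c))"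
        using bounded_linear_compose[OF bounded_linear_cinner_left assms(1)] bounded_linear_cinner_left
        by (auto intro: linear_continuous_on)
      show "closed_csubspace S"
        unfolding closed_csubspace_def
      proof (intro conjI)
        show "closed S"
          unfolding S_def by (rule closed_Collect_eq[OF cont])
      qed (auto simp: S_def cinner_simps add assms(2) zero)
      show "range monomial \<subseteq> S"
        by (auto simp: S_def cinner_monomial_left hc c_def)
    qed auto
    then show ?thesis
      by (auto simp: S_def)
  qed
  then obtain T' where "\<And>g f. cinner (T f) g = cinner f (T' g)"
    by metis
  then show ?thesis
    by (auto simp: adjoint_pair_def)
qed

lemma adj_on_eq:
  assumes M: "closed_csubspace M" and T: "adjoint_pair T T'"
  shows "adj_on M T g = orth_proj M (T' g)"
  unfolding adj_on_def
proof (rule the_equality)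
  show "orth_proj M (T' g) \<in> M \<and> (\<forall>f\<in>M. cinner (T f) g = cinner f (orth_proj M (T' g)))"
    using M by (simp add: orth_proj_in orth_proj_cinner_right adjoint_pairD[OF T])
  fix h assume h: "h \<in> M \<and> (\<forall>f\<in>M. cinner (T f) g = cinner f h)"
  have "orth_proj M (T' g) = h"
  proof (rule orth_proj_unique[OF M])
    fix f assume "f \<in> M"
    with h have "cinner f (T' g - h) = 0"
      by (simp add: adjoint_pairD[OF T] cinner_simps)
    then show "cinner (T' g - h) f = 0"
      by (metis cinner_commute complex_cnj_zero)
  qed (use h in auto)
  then show "h = orth_proj M (T' g)" by simp
qed

text \<open>By equicontinuity, the vectors on which the sequence tends to 0 form a closed subspace.\<close>

lemma contractions_tendsto_zero:
  fixes T :: "nat \<Rightarrow> hardy2 \<Rightarrow> hardy2"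
  assumes T: "\<And>n. adjoint_pair (T n) (T' n)" and le: "\<And>n f. norm (T n f) \<le> norm f"
    and X: "\<And>f. (\<And>x. x \<in> X \<Longrightarrow> cinner f x = 0) \<Longrightarrow> f = 0"
    and lim: "\<And>x. x \<in> X \<Longrightarrow> (\<lambda>n. T n x) \<longlonglongrightarrow> 0"
  shows "(\<lambda>n. T n f) \<longlonglongrightarrow> 0"
proof -
  define S where "S = {f. (\<lambda>n. T n f) \<longlonglongrightarrow> 0}"
  have "S = UNIV"
  proof (rule total_subspace_UNIV[OF _ _ X])
    show "X \<subseteq> S"
      using lim by (auto simp: S_def)
    show "closed_csubspace S"
      unfolding closed_csubspace_def
    proof (intro conjI ballI allI)
      show "0 \<in> S"
        by (simp add: S_def adjoint_pair_map_zero[OF T])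
      show "f + g \<in> S" if "f \<in> S" "g \<in> S" for f g
        using that tendsto_add[of "\<lambda>n. T n f" 0 sequentially "\<lambda>n. T n g" 0]
        by (simp add: S_def adjoint_pair_map_add[OF T])
      show "scaleC c f \<in> S" if "f \<in> S" for c f
      proof -
        have "(\<lambda>n. cmod c * norm (T n f)) \<longlonglongrightarrow> 0"
          using that by (intro tendsto_mult_right_zero tendsto_norm_zero) (simp add: S_def)
        then have "(\<lambda>n. norm (T n (scaleC c f))) \<longlonglongrightarrow> 0"
          by (simp only: adjoint_pair_map_scale[OF T] norm_scaleC)
        then have "(\<lambda>n. T n (scaleC c f)) \<longlonglongrightarrow> 0"
          by (rule tendsto_norm_zero_cancel)
        then show ?thesis
          by (simp add: S_def)
      qed
      show "closed S"
        unfolding closed_sequential_limits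
      proof (intro allI impI)
        fix Y l assume Y: "(\<forall>n. Y n \<in> S) \<and> Y \<longlonglongrightarrow> l"
        have "(\<lambda>n. T n l) \<longlonglongrightarrow> 0"
        proof (rule LIMSEQ_I)
          fix r :: real assume "0 < r"
          then have r: "r/2 > 0" by simp
          with Y obtain m where m: "norm (Y m - l) < r/2"
            using LIMSEQ_D[of Y l "r/2"] by blast
          have "(\<lambda>n. T n (Y m)) \<longlonglongrightarrow> 0"
            using Y by (auto simp: S_def)
          from LIMSEQ_D[OF this r] obtain N where N: "\<And>n. n \<ge> N \<Longrightarrow> norm (T n (Y m)) < r/2"
            by auto
          have "norm (T n l - 0) < r" if "n \<ge> N" for n
          proof -
            have "norm (T n (Y m - l)) < r/2"
              using le[of n "Y m - l"] m by linarith
            then show ?thesis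
              using N[OF that] norm_triangle_ineq4[of "T n (Y m)" "T n (Y m - l)"]
              by (simp add: adjoint_pair_map_diff[OF T])
          qed
          then show "\<exists>N. \<forall>n\<ge>N. norm (T n l - 0) < r"
            by blast
        qed
        then show "l \<in> S"
          by (simp add: S_def)
      qed
    qed
  qed auto
  then show ?thesis
    by (auto simp: S_def)
qed

section \<open>Hilbert-Schmidt norms\<close>

lemma infsum_hcoeff_sq: "(\<Sum>\<^sub>\<infinity>k. ennreal ((cmod (hcoeff f k))\<^sup>2)) = ennreal ((norm f)\<^sup>2)"
  by (rule infsum_ennreal_has_sum[OF has_sum_norm_sq]) auto

lemma cmod_cinner_commute: "cmod (cinner f g) = cmod (cinner g f)"
  by (metis cinner_commute complex_mod_cnj)

text \<open>
  The Hilbert-Schmidt norm is invariant under passage to the adjoint. The adjoint may be tested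
  on the monomials, which removes the unspecified basis of \<open>M\<close> from all further computations.
\<close>

lemma hs_norm_sq_eq:
  assumes M: "closed_csubspace M"
    and T: "\<And>f g. f \<in> M \<Longrightarrow> cinner (T f) g = cinner f (T' g)" and T': "\<And>g. T' g \<in> M"
  shows "hs_norm_sq M T = (\<Sum>\<^sub>\<infinity>k. ennreal ((norm (T' (monomial k)))\<^sup>2))"
proof -
  define B where "B = (SOME B. orthonormal_basis M B)"
  have B: "orthonormal_basis M B"
    unfolding B_def by (rule someI_ex[OF ex_orthonormal_basis[OF M]])
  then have BM: "B \<subseteq> M"
    by (simp add: orthonormal_basis_def)
  have "hs_norm_sq M T = (\<Sum>\<^sub>\<infinity>e\<in>B. \<Sum>\<^sub>\<infinity>k. ennreal ((cmod (hcoeff (T e) k))\<^sup>2))"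
    by (simp add: hs_norm_sq_def B_def infsum_hcoeff_sq)
  also have "\<dots> = (\<Sum>\<^sub>\<infinity>e\<in>B. \<Sum>\<^sub>\<infinity>k. ennreal ((cmod (cinner (T' (monomial k)) e))\<^sup>2))"
  proof (intro infsum_cong)
    fix e k assume "e \<in> B"
    with BM have "cinner (T e) (monomial k) = cinner e (T' (monomial k))"
      by (intro T) auto
    then have "hcoeff (T e) k = cinner e (T' (monomial k))"
      by simp
    then show "ennreal ((cmod (hcoeff (T e) k))\<^sup>2) = ennreal ((cmod (cinner (T' (monomial k)) e))\<^sup>2)"
      by (simp only: cmod_cinner_commute)
  qed
  also have "\<dots> = (\<Sum>\<^sub>\<infinity>k. \<Sum>\<^sub>\<infinity>e\<in>B. ennreal ((cmod (cinner (T' (monomial k)) e))\<^sup>2))"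
    by (rule infsum_ennreal_swap)
  also have "\<dots> = (\<Sum>\<^sub>\<infinity>k. ennreal ((norm (T' (monomial k)))\<^sup>2))"
    by (intro infsum_cong parseval[OF M B] T')
  finally show ?thesis .
qed

lemma hs_norm_sq_mono:
  assumes M: "closed_csubspace M" and le: "\<And>f. f \<in> M \<Longrightarrow> norm (S f) \<le> norm (T f)"
  shows "hs_norm_sq M S \<le> hs_norm_sq M T"
proof -
  define B where "B = (SOME B. orthonormal_basis M B)"
  have "orthonormal_basis M B"
    unfolding B_def by (rule someI_ex[OF ex_orthonormal_basis[OF M]])
  then have "B \<subseteq> M"
    by (simp add: orthonormal_basis_def)
  then show ?thesis
    unfolding hs_norm_sq_def B_def[symmetric]
    by (intro infsum_ennreal_mono ennreal_leI power_mono le norm_ge_zero) blast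
qed

lemma hs_norm_sq_UNIV_adjoint:
  assumes "adjoint_pair T T'"
  shows "hs_norm_sq UNIV T = (\<Sum>\<^sub>\<infinity>k. ennreal ((norm (T' (monomial k)))\<^sup>2))"
    and "hs_norm_sq UNIV T = (\<Sum>\<^sub>\<infinity>k. ennreal ((norm (T (monomial k)))\<^sup>2))"
proof -
  show 1: "hs_norm_sq UNIV T = (\<Sum>\<^sub>\<infinity>k. ennreal ((norm (T' (monomial k)))\<^sup>2))"
    using assms by (intro hs_norm_sq_eq closed_csubspace_UNIV) (auto simp: adjoint_pairD)
  also have "\<dots> = (\<Sum>\<^sub>\<infinity>k. \<Sum>\<^sub>\<infinity>l. ennreal ((cmod (hcoeff (T' (monomial k)) l))\<^sup>2))"
    by (simp add: infsum_hcoeff_sq)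
  also have "\<dots> = (\<Sum>\<^sub>\<infinity>k. \<Sum>\<^sub>\<infinity>l. ennreal ((cmod (hcoeff (T (monomial l)) k))\<^sup>2))"
  proof (intro infsum_cong)
    fix k l
    have "hcoeff (T' (monomial k)) l = cnj (hcoeff (T (monomial l)) k)"
      using adjoint_pairD2[OF assms, of "monomial k" "monomial l"] by (simp add: cinner_monomial_left)
    then show "ennreal ((cmod (hcoeff (T' (monomial k)) l))\<^sup>2) = ennreal ((cmod (hcoeff (T (monomial l)) k))\<^sup>2)"
      by simp
  qed
  also have "\<dots> = (\<Sum>\<^sub>\<infinity>l. \<Sum>\<^sub>\<infinity>k. ennreal ((cmod (hcoeff (T (monomial l)) k))\<^sup>2))"
    by (rule infsum_ennreal_swap)
  also have "\<dots> = (\<Sum>\<^sub>\<infinity>k. ennreal ((norm (T (monomial k)))\<^sup>2))"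
    by (simp add: infsum_hcoeff_sq)
  finally show "hs_norm_sq UNIV T = (\<Sum>\<^sub>\<infinity>k. ennreal ((norm (T (monomial k)))\<^sup>2))" .
qed

section \<open>The core operator of an invariant subspace\<close>

text \<open>
  The last assumption makes the pair doubly commuting: \<open>A\<close> commutes with \<open>B\<close> and with the adjoint of
  \<open>B\<close>.
\<close>

locale isometry_pair =
  fixes A A' B B' :: "hardy2 \<Rightarrow> hardy2"
  assumes adjA: "adjoint_pair A A'" and adjB: "adjoint_pair B B'"
    and isoA: "A' (A f) = f" and isoB: "B' (B f) = f"
    and comm: "A (B f) = B (A f)" and dcomm: "A' (B f) = B (A' f)"
begin

lemma dcomm': "B' (A f) = A (B' f)"
  by (rule cinner_eqI) (simp add: adjoint_pairD[OF adjA] adjoint_pairD2[OF adjB] dcomm)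

lemma comm': "A' (B' f) = B' (A' f)"
  by (rule cinner_eqI) (simp add: adjoint_pairD2[OF adjA] adjoint_pairD2[OF adjB] comm)

lemma isometry_pair_swap: "isometry_pair B B' A A'"
  by unfold_locales (simp_all add: adjA adjB isoA isoB comm dcomm')

lemma norm_A [simp]: "norm (A f) = norm f"
proof -
  have "cinner (A f) (A f) = cinner f f"
    by (simp add: adjoint_pairD[OF adjA] isoA)
  then show ?thesis
    unfolding cinner_self of_real_eq_iff by (simp add: power2_eq_iff_nonneg)
qed

lemmas linA = adjoint_pair_map_add[OF adjA] adjoint_pair_map_diff[OF adjA]
  adjoint_pair_map_scale[OF adjA] adjoint_pair_map_zero[OF adjA]
lemmas linA' = adjoint_pair_map_add[OF adjoint_pair_sym[OF adjA]] adjoint_pair_map_diff[OF adjoint_pair_sym[OF adjA]]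
  adjoint_pair_map_scale[OF adjoint_pair_sym[OF adjA]] adjoint_pair_map_zero[OF adjoint_pair_sym[OF adjA]]
lemmas linB = adjoint_pair_map_add[OF adjB] adjoint_pair_map_diff[OF adjB]
  adjoint_pair_map_scale[OF adjB] adjoint_pair_map_zero[OF adjB]
lemmas linB' = adjoint_pair_map_add[OF adjoint_pair_sym[OF adjB]] adjoint_pair_map_diff[OF adjoint_pair_sym[OF adjB]]
  adjoint_pair_map_scale[OF adjoint_pair_sym[OF adjB]] adjoint_pair_map_zero[OF adjoint_pair_sym[OF adjB]]

lemma norm_A'_le: "norm (A' f) \<le> norm f"
  by (rule adjoint_pair_norm_le[OF adjA]) simp

lemma adj_pow_B: "adjoint_pair (B ^^ n) (B' ^^ n)"
proof (induction n)
  case (Suc n)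
  from adjoint_pair_comp[OF adjB Suc] show ?case
    by (simp add: o_def funpow_swap1)
qed (simp add: id_def adjoint_pair_id)

lemma pow_B_A': "(B ^^ n) (A' f) = A' ((B ^^ n) f)"
  by (induction n) (auto simp: dcomm)

lemma pow_B_A: "(B ^^ n) (A f) = A ((B ^^ n) f)"
  by (induction n) (auto simp: comm)

lemma pow_B'_A: "(B' ^^ n) (A f) = A ((B' ^^ n) f)"
  by (induction n) (auto simp: dcomm')

lemma pow_B'_A': "(B' ^^ n) (A' f) = A' ((B' ^^ n) f)"
  by (induction n) (auto simp: comm')

end

lemma (in isometry_pair) norm_B [simp]: "norm (B f) = norm f"
  using isometry_pair.norm_A[OF isometry_pair_swap] .

lemma (in isometry_pair) norm_pow_B [simp]: "norm ((B ^^ n) f) = norm f"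
  by (induction n) auto

locale invariant_subspace = isometry_pair +
  fixes M :: "hardy2 set"
  assumes M: "closed_csubspace M" and AM: "f \<in> M \<Longrightarrow> A f \<in> M" and BM: "f \<in> M \<Longrightarrow> B f \<in> M"
begin

lemma invariant_subspace_swap: "invariant_subspace B B' A A' M"
  unfolding invariant_subspace_def invariant_subspace_axioms_def
  using isometry_pair_swap M AM BM by blast

abbreviation P where "P \<equiv> orth_proj M"

lemmas adjP = adjoint_pair_orth_proj[OF M]
lemmas linP = adjoint_pair_map_add[OF adjP] adjoint_pair_map_diff[OF adjP]
  adjoint_pair_map_scale[OF adjP] adjoint_pair_map_zero[OF adjP]

lemma P_in [simp]: "P f \<in> M"
  by (rule orth_proj_in[OF M])

lemma P_eq: "f \<in> M \<Longrightarrow> P f = f"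
  by (rule orth_proj_eq[OF M])

lemma P_P [simp]: "P (P f) = P f"
  by (simp add: P_eq)

lemma in_M_diff: "f \<in> M \<Longrightarrow> g \<in> M \<Longrightarrow> f - g \<in> M"
  by (rule closed_csubspace_diff[OF M])

text \<open>The adjoints preserve the orthogonal complement of \<open>M\<close>.\<close>

lemma P_A'_P: "P (A' (P f)) = P (A' f)"
proof -
  have "P (A' (f - P f)) = 0"
  proof (rule orth_proj_eq_0[OF M])
    fix h assume "h \<in> M"
    then show "cinner (A' (f - P f)) h = 0"
      by (simp add: adjoint_pairD2[OF adjA] orth_proj_orth[OF M] AM)
  qed
  then show ?thesis
    by (simp add: linA' linP)
qed

text \<open>
  With \<open>R\<^sub>A\<close>, \<open>R\<^sub>B\<close> the restrictions to \<open>M\<close>: \<open>p\<close> is the projection onto \<open>M \<ominus> A M\<close>, which on \<open>M\<close> is the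
  self-commutator of \<open>R\<^sub>A\<close>; \<open>K\<close> is the cross commutator \<open>[R\<^sub>A*, R\<^sub>B]\<close>, and \<open>K'\<close> the adjoint of its restriction
  to \<open>M\<close>. \<open>C\<close> is the core operator if \<open>A\<close> and \<open>B\<close> are the multiplications by the coordinates.
\<close>

definition p where "p f = P f - A (P (A' f))"

definition K where "K f = P (A' (B f)) - B (P (A' f))"

definition K' where "K' g = P (B' (A (P g))) - P (A (P (B' g)))"

definition C where "C f = P f - A (P (A' f)) - B (P (B' f)) + A (B (P (A' (B' f))))"

lemma adjoint_p: "adjoint_pair p p"
  unfolding p_def
  by (intro adjoint_pair_diff adjP adjoint_pair_comp[OF adjA adjoint_pair_comp[OF adjP adjoint_pair_sym[OF adjA]], simplified])

lemma p_in: "p f \<in> M"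
  by (simp add: p_def in_M_diff AM)

lemma p_A: "g \<in> M \<Longrightarrow> p (A g) = 0"
  by (simp add: p_def isoA P_eq AM)

lemma P_zero_imp_p: "P f = 0 \<Longrightarrow> p f = 0"
  using P_A'_P[of f] by (simp add: p_def linA linA' linP)

text \<open>
  \<open>P = p + A P A'\<close> splits the projection onto \<open>M\<close> along \<open>M = (M \<ominus> A M) \<oplus> A M\<close>.
\<close>

lemma norm_p_sq: "(norm (p f))\<^sup>2 = (norm (P f))\<^sup>2 - (norm (P (A' f)))\<^sup>2"
proof -
  have "cinner (P f) (A (P (A' f))) = cinner (P (A' (P f))) (P (A' f))"
    by (simp add: adjoint_pairD2[OF adjA, symmetric] adjoint_pairD[OF adjP])
  also have "\<dots> = cinner (A (P (A' f))) (A (P (A' f)))"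
    by (simp add: P_A'_P adjoint_pairD[OF adjA] isoA)
  finally have "cinner (p f) (A (P (A' f))) = 0"
    by (simp add: p_def cinner_simps)
  from norm_add_sq_orthogonal[OF this] show ?thesis
    by (simp add: p_def)
qed

lemma C_eq: "C f = p f - B (p (B' f))"
  by (simp add: C_def p_def linB comm)

lemma adjoint_C: "adjoint_pair C C"
proof -
  have "adjoint_pair (\<lambda>f. B (p (B' f))) (\<lambda>f. B (p (B' f)))"
    by (rule adjoint_pair_comp[OF adjB adjoint_pair_comp[OF adjoint_p adjoint_pair_sym[OF adjB]], simplified])
  from adjoint_pair_diff[OF adjoint_p this] show ?thesis
    by (simp add: C_eq[abs_def])
qed

lemma C_in: "C f \<in> M"
  by (simp add: C_eq in_M_diff p_in BM)

text \<open>
  By \<open>C = p - B p B'\<close>, the operator \<open>C B\<close> is the commutator of \<open>p\<close> with \<open>B\<close>. On \<open>M\<close> the projection \<open>p\<close> is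
  \<open>1 - A P A'\<close>, and \<open>B\<close> commutes with \<open>A\<close>, so only the commutator of \<open>P A'\<close> with \<open>B\<close> is left.
\<close>

lemma C_B: "g \<in> M \<Longrightarrow> C (B g) = - A (K g)"
  by (simp add: C_eq p_def K_def isoB linB linA comm P_eq BM)

lemma adjoint_K_on_M: "f \<in> M \<Longrightarrow> cinner (K f) g = cinner f (K' g)"
proof -
  assume "f \<in> M"
  then have "P f = f" by (rule P_eq)
  have "cinner (K f) g = cinner (P f) (B' (A (P g)) - A (P (B' g)))"
    by (simp add: \<open>P f = f\<close> K_def cinner_simps adjoint_pairD[OF adjP] adjoint_pairD2[OF adjA] adjoint_pairD[OF adjB])
  then show ?thesis
    by (simp add: adjoint_pairD[OF adjP] linP K'_def)
qed

lemma commutator_self: "commutator (adj_on M A) A = p"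
  by (simp add: fun_eq_iff commutator_def adj_on_eq[OF M adjA] isoA p_def)

lemma commutator_cross: "commutator (adj_on M A) B = K"
  by (simp add: fun_eq_iff commutator_def adj_on_eq[OF M adjA] K_def)

lemma K'_in: "K' g \<in> M"
  by (simp add: K'_def in_M_diff)

lemma adjoint_KP: "adjoint_pair (\<lambda>f. K (P f)) K'"
  using adjoint_K_on_M[of "P f" g for f g]
  by (simp add: adjoint_pair_def adjoint_pairD[OF adjP] P_eq K'_in)

lemma hs_K: "hs_norm_sq M K = (\<Sum>\<^sub>\<infinity>k. ennreal ((norm (K' (monomial k)))\<^sup>2))"
  by (rule hs_norm_sq_eq[OF M]) (simp_all add: adjoint_K_on_M K'_in)

lemma hs_C: "hs_norm_sq UNIV C = (\<Sum>\<^sub>\<infinity>k. ennreal ((norm (C (monomial k)))\<^sup>2))"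
  by (rule hs_norm_sq_UNIV_adjoint[OF adjoint_C])

lemma hs_C_on_M: "hs_norm_sq M C = hs_norm_sq UNIV C"
  unfolding hs_C by (rule hs_norm_sq_eq[OF M]) (simp_all add: adjoint_pairD[OF adjoint_C] C_in)

lemma norm_p_le: "norm (p f) \<le> norm f"
  by (rule power2_le_imp_le)
    (use norm_p_sq[of f] norm_orth_proj_sq[OF M, of f] in \<open>auto intro: order_trans\<close>)

lemma hs_K_le: "hs_norm_sq M K \<le> hs_norm_sq UNIV C"
proof -
  have "norm (K f) = norm (C (B f))" if "f \<in> M" for f
    using that by (simp add: C_B)
  then have "hs_norm_sq M K \<le> hs_norm_sq M (\<lambda>f. C (B f))"
    by (intro hs_norm_sq_mono[OF M]) simp
  also have "\<dots> = (\<Sum>\<^sub>\<infinity>k. ennreal ((norm (P (B' (C (monomial k)))))\<^sup>2))"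
    by (rule hs_norm_sq_eq[OF M])
      (simp_all add: adjoint_pairD[OF adjoint_C] adjoint_pairD[OF adjB] orth_proj_cinner_right[OF M])
  also have "\<dots> \<le> hs_norm_sq UNIV C"
  proof -
    have "norm (P (B' f)) \<le> norm f" for f
      using norm_orth_proj_le[OF M, of "B' f"] isometry_pair.norm_A'_le[OF isometry_pair_swap, of f] by linarith
    then show ?thesis
      unfolding hs_C by (intro infsum_ennreal_mono ennreal_leI power_mono) auto
  qed
  finally show ?thesis .
qed

end

context invariant_subspace begin

interpretation swap: invariant_subspace B B' A A' M
  by (rule invariant_subspace_swap)

lemma C_swap: "swap.C = C"
  by (simp add: fun_eq_iff swap.C_def C_def comm comm')

text \<open>
  By symmetry \<open>C = q - A q A'\<close>, where \<open>q\<close> is the projection onto \<open>M \<ominus> B M\<close>. As \<open>p\<close> annihilates \<open>A M\<close>, it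
  follows that \<open>p C = p q\<close>.
\<close>

lemma hs_self_commutators_le: 
  "hs_norm_sq M (commutator (adj_on M A) A \<circ> commutator (adj_on M B) B) \<le> hs_norm_sq UNIV C"
proof -
  have "hs_norm_sq M (p \<circ> swap.p) \<le> hs_norm_sq M C"
  proof (rule hs_norm_sq_mono[OF M])
    fix f
    have "C f = swap.p f - A (swap.p (A' f))"
      using swap.C_eq[of f] by (simp add: C_swap)
    then have "p (C f) = p (swap.p f)"
      by (simp add: adjoint_pair_map_diff[OF adjoint_p] p_A swap.p_in)
    then show "norm ((p \<circ> swap.p) f) \<le> norm (C f)"
      using norm_p_le[of "C f"] by simp
  qed
  then show ?thesis
    by (simp add: commutator_self swap.commutator_self hs_C_on_M)
qed

text \<open>
  Wold decomposition of \<open>M\<close> into the spaces \<open>B\<^sup>n (M \<ominus> B M)\<close>. The squared norms of the components are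
  differences of consecutive values of \<open>\<parallel>P B'\<^sup>n f\<parallel>\<^sup>2\<close>, which tend to 0.
\<close>

lemma wold_parseval:
  assumes "\<And>f. (\<lambda>n. (B' ^^ n) f) \<longlonglongrightarrow> 0"
  shows "(\<Sum>\<^sub>\<infinity>n. ennreal ((norm (swap.p ((B' ^^ n) f)))\<^sup>2)) = ennreal ((norm (P f))\<^sup>2)"
proof -
  define u where "u n = (norm (P ((B' ^^ n) f)))\<^sup>2" for n
  have u: "(norm (swap.p ((B' ^^ n) f)))\<^sup>2 = u n - u (Suc n)" for n
    by (simp add: swap.norm_p_sq u_def)
  have "u (Suc n) \<le> u n" for n
    using u[of n] by (metis diff_ge_0_iff_ge zero_le_power2)
  moreover have "u \<longlonglongrightarrow> 0\<^sup>2"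
    unfolding u_def
  proof (intro tendsto_power)
    show "(\<lambda>n. norm (P ((B' ^^ n) f))) \<longlonglongrightarrow> 0"
      by (rule tendsto_sandwich[OF _ _ tendsto_const tendsto_norm_zero[OF assms[of f]]])
        (auto simp: norm_orth_proj_le[OF M])
  qed
  ultimately show ?thesis
    using infsum_ennreal_telescope[of u 0] by (simp add: u, simp add: u_def)
qed

text \<open>
  The vector \<open>B p g\<close> lies in \<open>M\<close>. Its component in \<open>M \<ominus> A M\<close> is \<open>p B g\<close>, because \<open>p B\<close> vanishes on \<open>A M\<close>; its
  component in \<open>A M\<close> is \<open>A K g\<close>.
\<close>

lemma norm_p_diff:
  assumes g: "g \<in> M"
  shows "(norm (p g))\<^sup>2 - (norm (p (B g)))\<^sup>2 = (norm (K g))\<^sup>2"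
proof -
  define x where "x = B (p g)"
  have "x \<in> M"
    by (simp add: x_def BM p_in)
  have "B g = x + A (B (P (A' g)))"
    using g by (simp add: x_def p_def P_eq linB comm)
  then have 1: "p (B g) = p x"
    by (simp add: adjoint_pair_map_add[OF adjoint_p] p_A BM)
  have 2: "P (A' x) = K g"
    using g by (simp add: x_def p_def K_def P_eq linB linA' linP BM isoA flip: comm)
  have "(norm (p x))\<^sup>2 = (norm (p g))\<^sup>2 - (norm (K g))\<^sup>2"
    using norm_p_sq[of x] unfolding P_eq[OF \<open>x \<in> M\<close>] 2 by (simp add: x_def)
  then show ?thesis
    by (simp add: 1)
qed


lemma pow_B_in: "g \<in> M \<Longrightarrow> (B ^^ n) g \<in> M"
  by (induction n) (auto simp: BM)

text \<open>
  Telescoping of the previous identity along the powers of \<open>B\<close>. The limit is found from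
  \<open>p B\<^sup>n f = B\<^sup>n (1 - A A') f + A (1 - P) B\<^sup>n A' f\<close>, where the last term tends to 0.
\<close>

lemma infsum_norm_K_sq:
  assumes compl: "\<And>f. (\<lambda>n. (B ^^ n) f - P ((B ^^ n) f)) \<longlonglongrightarrow> 0" and f: "f \<in> M"
  shows "ennreal ((norm (p f))\<^sup>2) =
    (\<Sum>\<^sub>\<infinity>n. ennreal ((norm (K ((B ^^ n) f)))\<^sup>2)) + ennreal ((norm (f - A (A' f)))\<^sup>2)"
proof -
  define u where "u n = (norm (p ((B ^^ n) f)))\<^sup>2" for n
  define d where "d n = A ((B ^^ n) (A' f) - P ((B ^^ n) (A' f)))" for n
  have diff: "u n - u (Suc n) = (norm (K ((B ^^ n) f)))\<^sup>2" for n
    using norm_p_diff[OF pow_B_in[OF f]] by (simp add: u_def)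
  have dec: "u (Suc n) \<le> u n" for n
    using diff[of n] by (metis diff_ge_0_iff_ge zero_le_power2)
  \<comment> \<open>\<open>d n\<close> collects what the compression to the complement of \<open>M\<close> leaves over.\<close>
  have pB: "p ((B ^^ n) f) = (B ^^ n) (f - A (A' f)) + d n" for n
    using f by (simp add: p_def d_def P_eq pow_B_in pow_B_A' pow_B_A linA
      adjoint_pair_map_diff[OF adj_pow_B])
  have "u \<longlonglongrightarrow> (norm (f - A (A' f)))\<^sup>2"
    unfolding u_def
  proof (intro tendsto_power)
    have "d \<longlonglongrightarrow> 0"
      using compl[of "A' f"] by (intro tendsto_norm_zero_cancel[of d]) (simp add: d_def tendsto_norm_zero)
    then have "(\<lambda>n. norm (p ((B ^^ n) f)) - norm (f - A (A' f))) \<longlonglongrightarrow> 0"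
    proof (rule tendsto_norm_zero[THEN Lim_null_comparison[rotated]], intro always_eventually allI)
      fix n
      show "norm (norm (p ((B ^^ n) f)) - norm (f - A (A' f))) \<le> norm (d n)"
        using norm_triangle_ineq3[of "p ((B ^^ n) f)" "(B ^^ n) (f - A (A' f))"] by (simp add: pB)
    qed
    then show "(\<lambda>n. norm (p ((B ^^ n) f))) \<longlonglongrightarrow> norm (f - A (A' f))"
      by (simp add: LIM_zero_iff)
  qed
  moreover have "decseq u"
    by (rule decseq_SucI) (rule dec)
  ultimately have lim: "u \<longlonglongrightarrow> (norm (f - A (A' f)))\<^sup>2" and "(norm (f - A (A' f)))\<^sup>2 \<le> u 0"
    by (auto intro: decseq_ge)
  then show ?thesis
    using infsum_ennreal_telescope[OF lim dec]
    by (simp add: diff) (simp add: u_def flip: ennreal_plus)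
qed

text \<open>
  The Wold decomposition of \<open>B\<close> on the kernel of \<open>A'\<close>: the hypothesis says that its wandering subspace
  there is spanned by \<open>\<kappa>\<close>, so that the vectors \<open>B\<^sup>n \<kappa>\<close> form an orthonormal basis of this kernel.
\<close>

lemma defect_parseval:
  assumes pure: "\<And>f. (\<lambda>n. (B' ^^ n) f) \<longlonglongrightarrow> 0"
    and defect: "\<And>f. f - A (A' f) - B (B' (f - A (A' f))) = scaleC (cinner f \<kappa>) \<kappa>" and "norm \<kappa> = 1"
  shows "(\<Sum>\<^sub>\<infinity>n. ennreal ((cmod (cinner f ((B ^^ n) \<kappa>)))\<^sup>2)) = ennreal ((norm (f - A (A' f)))\<^sup>2)"
proof -
  define g where "g = f - A (A' f)"
  define u where "u n = (norm ((B' ^^ n) g))\<^sup>2" for n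
  have "(cmod (cinner f ((B ^^ n) \<kappa>)))\<^sup>2 = u n - u (Suc n)" for n
  proof -
    define x where "x = (B' ^^ n) g"
    have x: "x = (B' ^^ n) f - A (A' ((B' ^^ n) f))"
      by (simp add: x_def g_def adjoint_pair_map_diff[OF adjoint_pair_sym[OF adj_pow_B]] pow_B'_A pow_B'_A')
    have xB: "x - B (B' x) = scaleC (cinner f ((B ^^ n) \<kappa>)) \<kappa>"
      unfolding x defect by (simp add: adjoint_pairD2[OF adj_pow_B])
    have "cinner (x - B (B' x)) (B (B' x)) = 0"
      by (simp add: adjoint_pairD2[OF adjB, symmetric] linB' isoB)
    from norm_add_sq_orthogonal[OF this] have "(norm x)\<^sup>2 = (norm (x - B (B' x)))\<^sup>2 + (norm (B' x))\<^sup>2"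
      by simp
    then show ?thesis
      using xB \<open>norm \<kappa> = 1\<close> by (simp add: u_def x_def)
  qed
  moreover from this have "u (Suc n) \<le> u n" for n
    by (metis diff_ge_0_iff_ge zero_le_power2)
  moreover have "u \<longlonglongrightarrow> 0\<^sup>2"
    unfolding u_def by (intro tendsto_power tendsto_norm_zero pure)
  ultimately show ?thesis
    using infsum_ennreal_telescope[of u 0] by (simp, simp add: u_def g_def)
qed

text \<open>
  This is the trace of the projection onto \<open>M \<ominus> B M\<close> on the kernel of \<open>A'\<close>, in the basis \<open>B\<^sup>n \<kappa>\<close>. The
  terms telescope because \<open>B'\<close> shifts that basis down, and the limit is the limit of \<open>\<parallel>P B\<^sup>n \<kappa>\<parallel>\<^sup>2\<close>.
\<close>

lemma defect_trace:
  assumes compl: "\<And>f. (\<lambda>n. (B ^^ n) f - P ((B ^^ n) f)) \<longlonglongrightarrow> 0"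
    and \<kappa>: "norm \<kappa> = 1" "B' \<kappa> = 0"
  shows "(\<Sum>\<^sub>\<infinity>n. ennreal ((norm (swap.p ((B ^^ n) \<kappa>)))\<^sup>2)) = 1"
proof -
  define v where "v n = (norm (P ((B ^^ n) \<kappa>)))\<^sup>2" for n
  have v0: "(norm (swap.p ((B ^^ 0) \<kappa>)))\<^sup>2 = v 0"
    by (simp add: swap.norm_p_sq v_def \<kappa> linP)
  have vS: "(norm (swap.p ((B ^^ Suc n) \<kappa>)))\<^sup>2 = v (Suc n) - v n" for n
    by (simp add: swap.norm_p_sq v_def isoB)
  have inc: "- v (Suc n) \<le> - v n" for n
    using vS[of n] zero_le_power2[of "norm (swap.p ((B ^^ Suc n) \<kappa>))"] by linarith
  have "v n = 1 - (norm ((B ^^ n) \<kappa> - P ((B ^^ n) \<kappa>)))\<^sup>2" for n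
    using norm_orth_proj_sq[OF M, of "(B ^^ n) \<kappa>"] \<kappa> by (simp add: v_def)
  then have "v = (\<lambda>n. 1 - (norm ((B ^^ n) \<kappa> - P ((B ^^ n) \<kappa>)))\<^sup>2)"
    by (rule ext)
  moreover have "(\<lambda>n. 1 - (norm ((B ^^ n) \<kappa> - P ((B ^^ n) \<kappa>)))\<^sup>2) \<longlonglongrightarrow> 1 - 0\<^sup>2"
    by (intro tendsto_intros tendsto_norm_zero compl)
  ultimately have lim: "v \<longlonglongrightarrow> 1"
    by simp
  have "v 0 \<le> 1"
    using norm_orth_proj_le[OF M, of \<kappa>] \<kappa> by (simp add: v_def power_le_one)
  have "(\<Sum>\<^sub>\<infinity>n. ennreal ((norm (swap.p ((B ^^ n) \<kappa>)))\<^sup>2)) =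
      ennreal (v 0) + (\<Sum>\<^sub>\<infinity>n. ennreal (- v n - - v (Suc n)))"
    by (subst infsum_ennreal_Suc) (simp only: v0 vS, simp)
  also have "(\<Sum>\<^sub>\<infinity>n. ennreal (- v n - - v (Suc n))) = ennreal (- v 0 - - 1)"
    by (rule infsum_ennreal_telescope[OF tendsto_minus[OF lim] inc])
  also have "ennreal (v 0) + ennreal (- v 0 - - 1) = 1"
    using \<open>v 0 \<le> 1\<close> by (simp add: v_def flip: ennreal_plus)
  finally show ?thesis .
qed

text \<open>
  All sums are taken over the vectors \<open>B\<^sup>n q e\<close>, with \<open>e\<close> running through the monomials: by the Wold
  decomposition they form a Parseval frame of \<open>M\<close>, which computes Hilbert-Schmidt norms just as an
  orthonormal basis does. The terms of \<open>\<parallel>C\<parallel>\<^sup>2\<close> with \<open>n > 0\<close> sum to \<open>\<parallel>K\<parallel>\<^sup>2\<close>. Those with \<open>n = 0\<close> are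
  \<open>\<parallel>p q e\<parallel>\<^sup>2\<close>, which contribute \<open>\<parallel>K\<parallel>\<^sup>2\<close> once more, and the trace of \<open>q\<close> on the kernel of \<open>A'\<close>.
\<close>

theorem hs_core_eq:
  assumes pure: "\<And>f. (\<lambda>n. (B' ^^ n) f) \<longlonglongrightarrow> 0"
    and compl: "\<And>f. (\<lambda>n. (B ^^ n) f - P ((B ^^ n) f)) \<longlonglongrightarrow> 0"
    and defect: "\<And>f. f - A (A' f) - B (B' (f - A (A' f))) = scaleC (cinner f \<kappa>) \<kappa>"
    and \<kappa>: "norm \<kappa> = 1" "B' \<kappa> = 0"
  shows "hs_norm_sq UNIV C = 2 * hs_norm_sq M K + 1"
proof -
  define q where "q = swap.p"
  define e where "e = monomial"
  have q_in: "q f \<in> M" for f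
    by (simp add: q_def swap.p_in)
  have adj_q: "adjoint_pair q q"
    by (simp add: q_def swap.adjoint_p)
  have frame: "(\<Sum>\<^sub>\<infinity>k. ennreal ((norm (T' (e k)))\<^sup>2)) =
      (\<Sum>\<^sub>\<infinity>n. \<Sum>\<^sub>\<infinity>k. ennreal ((norm (T ((B ^^ n) (q (e k)))))\<^sup>2))"
    if T: "adjoint_pair T T'" "\<And>g. T' g \<in> M" for T T'
  proof -
    have "(\<Sum>\<^sub>\<infinity>k. ennreal ((norm (T' (e k)))\<^sup>2)) =
        (\<Sum>\<^sub>\<infinity>k. \<Sum>\<^sub>\<infinity>n. ennreal ((norm (q ((B' ^^ n) (T' (e k)))))\<^sup>2))"
      by (simp add: q_def wold_parseval[OF pure] P_eq T(2))
    also have "\<dots> = (\<Sum>\<^sub>\<infinity>n. \<Sum>\<^sub>\<infinity>k. ennreal ((norm (q ((B' ^^ n) (T' (e k)))))\<^sup>2))"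
      by (rule infsum_ennreal_swap)
    also have "\<dots> = (\<Sum>\<^sub>\<infinity>n. \<Sum>\<^sub>\<infinity>k. ennreal ((norm (T ((B ^^ n) (q (e k)))))\<^sup>2))"
    proof (rule infsum_cong)
      fix n
      have "adjoint_pair (\<lambda>f. T ((B ^^ n) (q f))) (\<lambda>f. q ((B' ^^ n) (T' f)))"
        by (rule adjoint_pair_comp[OF T(1) adjoint_pair_comp[OF adj_pow_B adj_q]])
      from hs_norm_sq_UNIV_adjoint[OF this]
      show "(\<Sum>\<^sub>\<infinity>k. ennreal ((norm (q ((B' ^^ n) (T' (e k)))))\<^sup>2)) =
          (\<Sum>\<^sub>\<infinity>k. ennreal ((norm (T ((B ^^ n) (q (e k)))))\<^sup>2))"
        by (simp add: e_def)
    qed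
    finally show ?thesis .
  qed
  have hsK: "hs_norm_sq M K = (\<Sum>\<^sub>\<infinity>n. \<Sum>\<^sub>\<infinity>k. ennreal ((norm (K ((B ^^ n) (q (e k)))))\<^sup>2))"
    using frame[OF adjoint_KP K'_in] by (simp add: hs_K e_def P_eq pow_B_in q_in)
  have C0: "C (q f) = p (q f)" for f
  proof -
    have "P (B' (q f)) = 0"
      using swap.P_A'_P[of f] by (simp add: q_def swap.p_def linB' linP isoB)
    then show ?thesis
      by (simp add: C_eq P_zero_imp_p linB)
  qed
  have CS: "norm (C (B ((B ^^ n) (q f)))) = norm (K ((B ^^ n) (q f)))" for n f
    by (simp add: C_B pow_B_in q_in)
  have "hs_norm_sq UNIV C = (\<Sum>\<^sub>\<infinity>n. \<Sum>\<^sub>\<infinity>k. ennreal ((norm (C ((B ^^ n) (q (e k)))))\<^sup>2))"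
    using frame[OF adjoint_C C_in] by (simp add: hs_C e_def)
  also have "\<dots> = (\<Sum>\<^sub>\<infinity>k. ennreal ((norm (p (q (e k))))\<^sup>2)) + hs_norm_sq M K"
    by (subst infsum_ennreal_Suc) (simp add: C0 CS hsK)
  also have "(\<Sum>\<^sub>\<infinity>k. ennreal ((norm (p (q (e k))))\<^sup>2)) =
      (\<Sum>\<^sub>\<infinity>k. (\<Sum>\<^sub>\<infinity>n. ennreal ((norm (K ((B ^^ n) (q (e k)))))\<^sup>2)) + ennreal ((norm (q (e k) - A (A' (q (e k)))))\<^sup>2))"
    by (intro infsum_cong infsum_norm_K_sq[OF compl] q_in)
  also have "\<dots> = (\<Sum>\<^sub>\<infinity>k. \<Sum>\<^sub>\<infinity>n. ennreal ((norm (K ((B ^^ n) (q (e k)))))\<^sup>2)) +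
      (\<Sum>\<^sub>\<infinity>k. ennreal ((norm (q (e k) - A (A' (q (e k)))))\<^sup>2))"
    by (intro infsum_add nonneg_summable_on_complete) auto
  also have "(\<Sum>\<^sub>\<infinity>k. \<Sum>\<^sub>\<infinity>n. ennreal ((norm (K ((B ^^ n) (q (e k)))))\<^sup>2)) = hs_norm_sq M K"
    unfolding hsK by (rule infsum_ennreal_swap)
  also have "(\<Sum>\<^sub>\<infinity>k. ennreal ((norm (q (e k) - A (A' (q (e k)))))\<^sup>2)) =
      (\<Sum>\<^sub>\<infinity>k. \<Sum>\<^sub>\<infinity>n. ennreal ((cmod (cinner (q (e k)) ((B ^^ n) \<kappa>)))\<^sup>2))"
    by (simp add: defect_parseval[OF pure defect \<kappa>(1)])
  also have "\<dots> = (\<Sum>\<^sub>\<infinity>n. \<Sum>\<^sub>\<infinity>k. ennreal ((cmod (cinner (q (e k)) ((B ^^ n) \<kappa>)))\<^sup>2))"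
    by (rule infsum_ennreal_swap)
  also have "\<dots> = (\<Sum>\<^sub>\<infinity>n. ennreal ((norm (q ((B ^^ n) \<kappa>)))\<^sup>2))"
    by (simp add: adjoint_pairD[OF adj_q] e_def cinner_monomial_left infsum_hcoeff_sq)
  also have "\<dots> = 1"
    unfolding q_def by (rule defect_trace[OF compl \<kappa>])
  finally show ?thesis
    by (simp add: mult_2 ac_simps)
qed

end

section \<open>Multiplication by inner functions\<close>

subsection \<open>Square sums of Taylor coefficients\<close>

lemma set_integral_cis:
  "(LINT t:{0..2*pi}|lborel. cis (of_int k * t)) = (if k = 0 then 2 * pi else 0)"
proof (cases "k = 0")
  case False
  define F where "F t = cis (of_int k * t) / (\<i> * of_int k)" for t :: real
  have "(LINT t|lborel. indicator {0..2*pi} t *\<^sub>R cis (of_int k * t)) = F (2*pi) - F 0"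
  proof (rule integral_FTC_Icc)
    fix t :: real
    have "((\<lambda>t. exp (\<i> * of_int k * of_real t) / (\<i> * of_int k)) has_vector_derivative exp (\<i> * of_int k * of_real t)) (at t within {0..2*pi})"
      using False by (auto intro!: derivative_eq_intros has_vector_derivative_real_field simp: field_simps)
    moreover have "F = (\<lambda>t. exp (\<i> * of_int k * of_real t) / (\<i> * of_int k))"
      by (simp add: fun_eq_iff F_def cis_conv_exp mult_ac)
    ultimately show "(F has_vector_derivative cis (of_int k * t)) (at t within {0..2*pi})"
      by (simp add: cis_conv_exp mult_ac)
  qed (auto intro!: continuous_intros)
  moreover have "cis (of_int k * (2*pi)) = 1"
    using cis_multiple_2pi[of "of_int k"] by (simp add: mult_ac)
  ultimately show ?thesis
    using False by (simp add: set_lebesgue_integral_def F_def)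
qed (simp add: set_lebesgue_integral_def scaleR_conv_of_real)

lemma set_integral_sum:
  fixes f :: "'i \<Rightarrow> 'a \<Rightarrow> 'b :: {banach, second_countable_topology}"
  assumes "\<And>i. i \<in> I \<Longrightarrow> set_integrable M A (f i)"
  shows "(LINT x:A|M. (\<Sum>i\<in>I. f i x)) = (\<Sum>i\<in>I. LINT x:A|M. f i x)"
    and "set_integrable M A (\<lambda>x. \<Sum>i\<in>I. f i x)"
  using assms unfolding set_lebesgue_integral_def set_integrable_def scaleR_sum_right
  by (auto intro!: Bochner_Integration.integral_sum Bochner_Integration.integrable_sum)

lemma circle_parseval_finite:
  fixes a :: "nat \<Rightarrow> complex"
  shows "(LINT t:{0..2*pi}|lborel. (cmod (\<Sum>n<N. a n * cis (n * t)))\<^sup>2) = 2 * pi * (\<Sum>n<N. (cmod (a n))\<^sup>2)"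
proof -
  have int: "set_integrable lborel {0..2*pi} (\<lambda>t. c * cis (of_int k * t))" for c k
    by (intro borel_integrable_atLeastAtMost' continuous_intros)
  have sq: "complex_of_real ((cmod (\<Sum>n<N. a n * cis (n * t)))\<^sup>2) =
      (\<Sum>n<N. \<Sum>m<N. a n * cnj (a m) * cis (of_int (int n - int m) * t))" for t :: real
    unfolding complex_norm_square cnj_sum sum_product
    by (intro sum.cong refl) (simp add: cis_cnj cis_mult algebra_simps)
  have "complex_of_real (LINT t:{0..2*pi}|lborel. (cmod (\<Sum>n<N. a n * cis (n * t)))\<^sup>2) =
      (LINT t:{0..2*pi}|lborel. (\<Sum>n<N. \<Sum>m<N. a n * cnj (a m) * cis (of_int (int n - int m) * t)))"
    unfolding set_integral_complex_of_real[symmetric] sq by (rule refl)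
  also have "\<dots> = (\<Sum>n<N. LINT t:{0..2*pi}|lborel. (\<Sum>m<N. a n * cnj (a m) * cis (of_int (int n - int m) * t)))"
    by (intro set_integral_sum int)
  also have "\<dots> = (\<Sum>n<N. \<Sum>m<N. LINT t:{0..2*pi}|lborel. a n * cnj (a m) * cis (of_int (int n - int m) * t))"
    by (intro sum.cong refl set_integral_sum int)
  also have "\<dots> = (\<Sum>n<N. \<Sum>m<N. if n = m then complex_of_real (2 * pi * (cmod (a n))\<^sup>2) else 0)"
    unfolding set_integral_mult_right set_integral_cis of_real_mult
    by (intro sum.cong refl) (auto simp: complex_norm_square simp del: of_real_power)
  also have "\<dots> = complex_of_real (2 * pi * (\<Sum>n<N. (cmod (a n))\<^sup>2))"
    by (simp add: sum_distrib_left)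
  finally show ?thesis
    unfolding of_real_eq_iff .
qed

text \<open>
  Only the moduli are required to converge: the boundary values of an inner function are known in
  modulus alone.
\<close>

lemma circle_bounded_convergence:
  fixes s :: "nat \<Rightarrow> real \<Rightarrow> complex" and f :: "real \<Rightarrow> complex"
  assumes "\<And>n. continuous_on UNIV (s n)" "continuous_on UNIV f"
    and lim: "AE t in lborel. (\<lambda>n. cmod (s n t)) \<longlonglongrightarrow> cmod (f t)"
    and le: "\<And>n t. cmod (s n t) \<le> K"
  shows "(\<lambda>n. LINT t:{0..2*pi}|lborel. (cmod (s n t))\<^sup>2) \<longlonglongrightarrow> (LINT t:{0..2*pi}|lborel. (cmod (f t))\<^sup>2)"
  unfolding set_lebesgue_integral_def
proof (rule integral_dominated_convergence)
  have m: "s n \<in> borel_measurable lborel" "f \<in> borel_measurable lborel" for n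
    using assms(1,2) by (auto intro: borel_measurable_continuous_onI)
  show "(\<lambda>t. indicator {0..2*pi} t *\<^sub>R (cmod (f t))\<^sup>2) \<in> borel_measurable lborel"
    "(\<lambda>t. indicator {0..2*pi} t *\<^sub>R (cmod (s n t))\<^sup>2) \<in> borel_measurable lborel" for n
    using m by measurable
  show "integrable lborel (\<lambda>t. indicator {0..2*pi} t * K\<^sup>2)"
    by (intro integrable_mult_left integrable_real_indicator) auto
  show "AE t in lborel. (\<lambda>n. indicator {0..2*pi} t *\<^sub>R (cmod (s n t))\<^sup>2) \<longlonglongrightarrow> indicator {0..2*pi} t *\<^sub>R (cmod (f t))\<^sup>2"
    using lim by eventually_elim (intro tendsto_scaleR tendsto_const tendsto_power)
  show "AE t in lborel. norm (indicator {0..2*pi} t *\<^sub>R (cmod (s n t))\<^sup>2) \<le> indicator {0..2*pi} t * K\<^sup>2" for n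
    using le by (auto simp: indicator_def intro!: power_mono)
qed

lemma circle_parseval:
  fixes a :: "nat \<Rightarrow> complex"
  assumes a: "summable (\<lambda>n. cmod (a n))" and h: "\<And>t::real. (\<lambda>n. a n * cis (n * t)) sums h t"
  shows "(\<lambda>n. 2 * pi * (cmod (a n))\<^sup>2) sums (LINT t:{0..2*pi}|lborel. (cmod (h t))\<^sup>2)"
proof -
  define s where "s N t = (\<Sum>n<N. a n * cis (n * t))" for N and t :: real
  have s_cont: "continuous_on UNIV (s N)" for N
    unfolding s_def by (intro continuous_intros)
  have "uniform_limit UNIV (\<lambda>N t::real. \<Sum>n<N. a n * cis (n * t)) (\<lambda>t::real. suminf (\<lambda>n. a n * cis (n * t))) sequentially"
    by (rule Weierstrass_m_test[where M = "\<lambda>n. cmod (a n)"]) (use a in \<open>auto simp: norm_mult\<close>)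
  then have "uniform_limit UNIV s h sequentially"
    using h by (simp add: s_def[abs_def] sums_iff)
  then have h_cont: "continuous_on UNIV h"
    by (rule uniform_limit_theorem[rotated]) (auto simp: s_cont)
  have "cmod (s N t) \<le> (\<Sum>n. cmod (a n))" for N t
  proof -
    have "cmod (s N t) \<le> (\<Sum>n<N. cmod (a n))"
      unfolding s_def by (rule sum_norm_le) (auto simp: norm_mult)
    also have "\<dots> \<le> (\<Sum>n. cmod (a n))"
      by (rule sum_le_suminf[OF a]) auto
    finally show ?thesis .
  qed
  moreover have "(\<lambda>N. s N t) \<longlonglongrightarrow> h t" for t
    using h[of t] by (simp add: sums_def s_def)
  ultimately have "(\<lambda>N. LINT t:{0..2*pi}|lborel. (cmod (s N t))\<^sup>2) \<longlonglongrightarrow> (LINT t:{0..2*pi}|lborel. (cmod (h t))\<^sup>2)"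
    by (intro circle_bounded_convergence s_cont h_cont AE_I2 tendsto_norm)
  then show ?thesis
    by (simp add: s_def circle_parseval_finite sums_def sum_distrib_left)
qed

text \<open>
  The mean square of \<open>g\<close> over the circle of radius \<open>r\<close> is the sum of \<open>|b\<^sub>n|\<^sup>2 r\<^bsup>2n\<^esup>\<close>. As \<open>r\<close> increases to 1 the
  former converges by boundedness of \<open>g\<close>, the latter monotonically.
\<close>

lemma square_sum_of_radial_limits:
  fixes b :: "nat \<Rightarrow> complex" and L :: "real \<Rightarrow> complex"
  assumes g: "\<And>z. cmod z < 1 \<Longrightarrow> (\<lambda>n. b n * z ^ n) sums g z"
    and bound: "\<And>z. cmod z < 1 \<Longrightarrow> cmod (g z) \<le> K"
    and L: "continuous_on UNIV L"
    and lim: "AE t in lborel. ((\<lambda>r. cmod (g (of_real r * cis t))) \<longlongrightarrow> cmod (L t)) (at_left 1)"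
  shows "(\<lambda>n. 2 * pi * (cmod (b n))\<^sup>2) sums (LINT t:{0..2*pi}|lborel. (cmod (L t))\<^sup>2)"
proof -
  define I where "I = (LINT t:{0..2*pi}|lborel. (cmod (L t))\<^sup>2)"
  define r where "r n = 1 - inverse (real (Suc n) + 1)" for n
  have r: "0 \<le> r n" "r n < 1" for n
    by (auto simp: r_def field_simps)
  have r_lim: "r \<longlonglongrightarrow> 1"
    unfolding r_def by real_asymp
  have r_left: "filterlim r (at_left 1) sequentially"
    using r_lim r(2) by (auto simp: filterlim_at intro!: always_eventually, metis less_irrefl)
  define J where "J N = (LINT t:{0..2*pi}|lborel. (cmod (g (of_real (r N) * cis t)))\<^sup>2)" for N
  have sum_norm: "summable (\<lambda>n. cmod (b n * of_real (r N) ^ n))" for N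
  proof (rule powser_insidea)
    show "summable (\<lambda>n. b n * of_real ((r N + 1) / 2) ^ n)"
      using g[of "of_real ((r N + 1) / 2)"] r[of N] by (auto simp: sums_iff simp del: of_real_divide of_real_add)
    show "norm (complex_of_real (r N)) < norm (complex_of_real ((r N + 1) / 2))"
      using r[of N] by (simp del: of_real_divide of_real_add)
  qed
  have g_sums: "(\<lambda>n. b n * of_real (r N) ^ n * cis (n * t)) sums g (of_real (r N) * cis t)" for N and t :: real
  proof -
    have eq: "b n * (of_real (r N) * cis t) ^ n = b n * of_real (r N) ^ n * cis (n * t)" for n
      by (simp only: power_mult_distrib Complex.DeMoivre mult.assoc)
    have "cmod (of_real (r N) * cis t) < 1"
      using r[of N] by (simp add: norm_mult)
    from g[OF this] show ?thesis
      unfolding eq .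
  qed
  have J: "(\<lambda>n. 2 * pi * (cmod (b n))\<^sup>2 * (r N)\<^sup>2 ^ n) sums J N" for N
    using circle_parseval[OF sum_norm g_sums, of N] r[of N]
    by (simp add: J_def norm_mult norm_power power_mult_distrib mult_ac flip: power_mult)
  have "J \<longlonglongrightarrow> I"
    unfolding J_def I_def
  proof (rule circle_bounded_convergence[OF _ L])
    show "continuous_on UNIV (\<lambda>t. g (of_real (r N) * cis t))" for N
    proof -
      have "uniform_limit UNIV (\<lambda>m t::real. \<Sum>n<m. b n * of_real (r N) ^ n * cis (n * t))
          (\<lambda>t::real. suminf (\<lambda>n. b n * of_real (r N) ^ n * cis (n * t))) sequentially"
        by (rule Weierstrass_m_test[where M = "\<lambda>n. cmod (b n * of_real (r N) ^ n)"])
          (use sum_norm in \<open>auto simp: norm_mult\<close>)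
      moreover have "(\<lambda>t::real. suminf (\<lambda>n. b n * of_real (r N) ^ n * cis (n * t))) = (\<lambda>t. g (of_real (r N) * cis t))"
        using g_sums by (simp add: sums_iff)
      ultimately show ?thesis
        by (intro uniform_limit_theorem[where F = sequentially]) (auto intro!: always_eventually continuous_intros)
    qed
    show "AE t in lborel. (\<lambda>n. cmod (g (of_real (r n) * cis t))) \<longlonglongrightarrow> cmod (L t)"
      using lim by eventually_elim (rule filterlim_compose[OF _ r_left])
    show "cmod (g (of_real (r n) * cis t)) \<le> K" for n t
      using r[of n] by (intro bound) (simp add: norm_mult)
  qed
  define u where "u n = 2 * pi * (cmod (b n))\<^sup>2" for n
  have part: "(\<Sum>n<m. u n) \<le> I" for m
  proof (rule tendsto_le[OF _ \<open>J \<longlonglongrightarrow> I\<close>])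
    show "(\<lambda>N. \<Sum>n<m. u n * (r N)\<^sup>2 ^ n) \<longlonglongrightarrow> (\<Sum>n<m. u n)"
      using r_lim by (auto intro!: tendsto_eq_intros)
    show "\<forall>\<^sub>F N in sequentially. (\<Sum>n<m. u n * (r N)\<^sup>2 ^ n) \<le> J N"
    proof (intro always_eventually allI)
      fix N
      have J': "summable (\<lambda>n. u n * (r N)\<^sup>2 ^ n)" "J N = (\<Sum>n. u n * (r N)\<^sup>2 ^ n)"
        using J[of N] by (simp_all add: u_def sums_iff)
      show "(\<Sum>n<m. u n * (r N)\<^sup>2 ^ n) \<le> J N"
        unfolding J'(2) by (rule sum_le_suminf[OF J'(1)]) (auto simp: u_def)
    qed
  qed auto
  have u0: "0 \<le> u n" for n
    by (simp add: u_def)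
  have summ: "summable u"
    by (rule summableI_nonneg_bounded[OF u0 part])
  have "suminf u \<le> I"
    by (rule suminf_le_const[OF summ part])
  moreover have "I \<le> suminf u"
  proof (rule tendsto_upperbound[OF \<open>J \<longlonglongrightarrow> I\<close>])
    have "J N \<le> suminf u" for N
    proof -
      have "u n * (r N)\<^sup>2 ^ n \<le> u n" for n
        using r[of N] u0[of n] by (intro mult_right_le_one_le) (auto intro!: power_le_one)
      then show ?thesis
        using J[of N] suminf_le[of "\<lambda>n. u n * (r N)\<^sup>2 ^ n" u] summ
        by (simp add: sums_iff u_def[symmetric])
    qed
    then show "\<forall>\<^sub>F N in sequentially. J N \<le> suminf u"
      by simp
  qed auto
  ultimately show ?thesis
    using summ unfolding I_def[symmetric] u_def[symmetric] by (simp add: sums_iff)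
qed

definition taylor :: "(complex \<Rightarrow> complex) \<Rightarrow> nat \<Rightarrow> complex" where
  "taylor \<theta> n = (deriv ^^ n) \<theta> 0 / fact n"

lemma taylor_sums:
  assumes "\<theta> holomorphic_on ball 0 1" "cmod z < 1"
  shows "(\<lambda>n. taylor \<theta> n * z ^ n) sums \<theta> z"
  using holomorphic_power_series[OF assms(1), of z] assms(2) by (simp add: taylor_def)

lemma taylor_abs_summable:
  assumes "\<theta> holomorphic_on ball 0 1" "cmod z < 1"
  shows "summable (\<lambda>n. cmod (taylor \<theta> n * z ^ n))"
proof (rule powser_insidea)
  define r where "r = (cmod z + 1) / 2"
  have "cmod (of_real r) < 1" "cmod z < cmod (of_real r)"
    using assms(2) norm_ge_zero[of z] by (simp_all add: r_def del: of_real_divide of_real_add norm_ge_zero)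
  with taylor_sums[OF assms(1), of "of_real r"]
  show "summable (\<lambda>n. taylor \<theta> n * of_real r ^ n)" "cmod z < cmod (of_real r)"
    by (auto simp: sums_iff)
qed

text \<open>
  Multiplication by an inner function preserves the square sum of the coefficients of a
  polynomial, since on almost every radius it does not change the limit of the modulus.
\<close>

lemma inner_convolution_sums:
  assumes \<theta>: "inner_function \<theta>" and F: "\<And>n. N \<le> n \<Longrightarrow> F n = 0"
  shows "(\<lambda>n. (cmod (\<Sum>l\<le>n. taylor \<theta> l * F (n - l)))\<^sup>2) sums (\<Sum>n<N. (cmod (F n))\<^sup>2)"
proof -
  define h where "h z = (\<Sum>n<N. F n * z ^ n)" for z
  have hol: "\<theta> holomorphic_on ball 0 1"
    using \<theta> by (simp add: inner_function_def)
  obtain K where "\<forall>x\<in>\<theta> ` ball 0 1. cmod x \<le> K"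
    using \<theta> unfolding inner_function_def bounded_iff by blast
  then have K: "cmod (\<theta> z) \<le> K" if "cmod z < 1" for z
    using that by simp
  have "K \<ge> 0"
    using order_trans[OF norm_ge_zero K[of 0]] by simp
  define S where "S = (\<Sum>n<N. cmod (F n))"
  have h_le: "cmod (h z) \<le> S" if "cmod z < 1" for z
    unfolding h_def S_def
    by (rule sum_norm_le) (use that in \<open>auto simp: norm_mult norm_power intro!: mult_right_le_one_le power_le_one\<close>)
  have conv: "(\<lambda>n. (\<Sum>l\<le>n. taylor \<theta> l * F (n - l)) * z ^ n) sums (\<theta> z * h z)" if z: "cmod z < 1" for z
  proof -
    have hs: "(\<lambda>n. F n * z ^ n) sums h z"
      unfolding h_def by (rule sums_finite) (auto simp: F not_less)
    have "summable (\<lambda>n. norm (F n * z ^ n))"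
      by (rule summable_finite[of "{..<N}"]) (auto simp: F not_less)
    from Cauchy_product_sums[OF taylor_abs_summable[OF hol z] this]
    have "(\<lambda>k. \<Sum>i\<le>k. taylor \<theta> i * z ^ i * (F (k - i) * z ^ (k - i))) sums (\<theta> z * h z)"
      using taylor_sums[OF hol z] hs by (simp add: sums_iff)
    moreover have "(\<Sum>i\<le>k. taylor \<theta> i * z ^ i * (F (k - i) * z ^ (k - i))) = (\<Sum>l\<le>k. taylor \<theta> l * F (k - l)) * z ^ k" for k
      unfolding sum_distrib_right by (intro sum.cong) (auto simp flip: power_add)
    ultimately show ?thesis by simp
  qed
  have "(\<lambda>n. 2 * pi * (cmod (\<Sum>l\<le>n. taylor \<theta> l * F (n - l)))\<^sup>2) sums (LINT t:{0..2*pi}|lborel. (cmod (h (cis t)))\<^sup>2)"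
  proof (rule square_sum_of_radial_limits[where g = "\<lambda>z. \<theta> z * h z" and K = "K * S"])
    show "cmod (\<theta> z * h z) \<le> K * S" if "cmod z < 1" for z
      using K[OF that] h_le[OF that] \<open>K \<ge> 0\<close> by (simp add: norm_mult mult_mono)
    show "continuous_on UNIV (\<lambda>t. h (cis t))"
      unfolding h_def by (intro continuous_intros)
    have "AE t in lborel. \<exists>l. ((\<lambda>r. \<theta> (of_real r * cis t)) \<longlongrightarrow> l) (at_left 1) \<and> cmod l = 1"
      using \<theta> by (simp add: inner_function_def)
    then show "AE t in lborel. ((\<lambda>r. cmod (\<theta> (of_real r * cis t) * h (of_real r * cis t))) \<longlongrightarrow> cmod (h (cis t))) (at_left 1)"
    proof eventually_elim
      fix t assume "\<exists>l. ((\<lambda>r. \<theta> (of_real r * cis t)) \<longlongrightarrow> l) (at_left 1) \<and> cmod l = 1"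
      then obtain l where l: "((\<lambda>r. \<theta> (of_real r * cis t)) \<longlongrightarrow> l) (at_left 1)" "cmod l = 1"
        by blast
      have "((\<lambda>r. h (of_real r * cis t)) \<longlongrightarrow> h (of_real 1 * cis t)) (at_left 1)"
        unfolding h_def by (intro tendsto_intros)
      from tendsto_norm[OF tendsto_mult[OF l(1) this]] l(2)
      show "((\<lambda>r. cmod (\<theta> (of_real r * cis t) * h (of_real r * cis t))) \<longlongrightarrow> cmod (h (cis t))) (at_left 1)"
        by (simp add: norm_mult)
    qed
  qed (rule conv)
  also have "(LINT t:{0..2*pi}|lborel. (cmod (h (cis t)))\<^sup>2) = 2 * pi * (\<Sum>n<N. (cmod (F n))\<^sup>2)"
    using circle_parseval_finite[of F N] by (simp only: h_def Complex.DeMoivre)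
  finally show ?thesis
    by (rule sums_mult_iff[THEN iffD1, rotated]) simp
qed

subsection \<open>The multiplication operators\<close>

text \<open>
  The coefficient array of the product \<open>\<theta>(z) f(z, w)\<close>.
\<close>

definition zconv :: "(complex \<Rightarrow> complex) \<Rightarrow> hardy2 \<Rightarrow> nat \<times> nat \<Rightarrow> complex" where
  "zconv \<theta> f = (\<lambda>(i, j). \<Sum>l\<le>i. taylor \<theta> l * hcoeff f (i - l, j))"

text \<open>
  A finite block of coefficients of the product involves finitely many coefficients of \<open>f\<close>. For each
  power of \<open>w\<close> it is therefore dominated by the product of \<open>\<theta>\<close> with a polynomial.
\<close>

lemma
  assumes \<theta>: "inner_function \<theta>"
  shows zconv_summable: "(\<lambda>k. (cmod (zconv \<theta> f k))\<^sup>2) summable_on UNIV"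
    and zconv_le: "norm (of_coeffs (zconv \<theta> f)) \<le> norm f"
proof -
  have le: "(\<Sum>k\<in>S. (cmod (zconv \<theta> f k))\<^sup>2) \<le> (norm f)\<^sup>2" if "finite S" for S
  proof -
    have "\<exists>N. fst ` S \<union> snd ` S \<subseteq> {..<N}"
      using that by (intro finite_nat_bounded) auto
    then obtain N where "fst ` S \<union> snd ` S \<subseteq> {..<N}"
      by blast
    then have N: "S \<subseteq> {..<N} \<times> {..<N}"
      by force
    define F where "F j n = (if n < N then hcoeff f (n, j) else 0)" for j n
    have "(\<Sum>k\<in>S. (cmod (zconv \<theta> f k))\<^sup>2) \<le> (\<Sum>k\<in>{..<N} \<times> {..<N}. (cmod (zconv \<theta> f k))\<^sup>2)"
      using N by (intro sum_mono2) auto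
    also have "\<dots> = (\<Sum>j<N. \<Sum>i<N. (cmod (zconv \<theta> f (i, j)))\<^sup>2)"
      by (subst sum.swap) (simp add: sum.cartesian_product)
    also have "\<dots> = (\<Sum>j<N. \<Sum>i<N. (cmod (\<Sum>l\<le>i. taylor \<theta> l * F j (i - l)))\<^sup>2)"
      by (intro sum.cong refl arg_cong[where f = "\<lambda>x. (cmod x)\<^sup>2"]) (auto simp: zconv_def F_def intro!: sum.cong)
    also have "\<dots> \<le> (\<Sum>j<N. \<Sum>n<N. (cmod (F j n))\<^sup>2)"
    proof (rule sum_mono)
      fix j
      have "(\<lambda>i. (cmod (\<Sum>l\<le>i. taylor \<theta> l * F j (i - l)))\<^sup>2) sums (\<Sum>n<N. (cmod (F j n))\<^sup>2)"
        by (rule inner_convolution_sums[OF \<theta>]) (simp add: F_def)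
      then show "(\<Sum>i<N. (cmod (\<Sum>l\<le>i. taylor \<theta> l * F j (i - l)))\<^sup>2) \<le> (\<Sum>n<N. (cmod (F j n))\<^sup>2)"
        using sum_le_suminf[of "\<lambda>i. (cmod (\<Sum>l\<le>i. taylor \<theta> l * F j (i - l)))\<^sup>2" "{..<N}"]
        by (simp add: sums_iff)
    qed
    also have "\<dots> = (\<Sum>k\<in>{..<N} \<times> {..<N}. (cmod (hcoeff f k))\<^sup>2)"
      by (subst sum.swap) (simp add: F_def sum.cartesian_product case_prod_unfold)
    also have "\<dots> \<le> (norm f)\<^sup>2"
      by (rule sum_hcoeff_le) auto
    finally show ?thesis .
  qed
  show 1: "(\<lambda>k. (cmod (zconv \<theta> f k))\<^sup>2) summable_on UNIV"
    by (rule sq_summable_finite_bound(1)[OF le])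
  show "norm (of_coeffs (zconv \<theta> f)) \<le> norm f"
    by (rule norm_le_of_coeff_sums) (simp_all add: hcoeff_of_coeffs[OF 1] le)
qed

lemma hcoeff_zconv: "inner_function \<theta> \<Longrightarrow> hcoeff (of_coeffs (zconv \<theta> f)) = zconv \<theta> f"
  by (rule hcoeff_of_coeffs[OF zconv_summable])

lemma hcoeff_zconv_sum:
  "inner_function \<theta> \<Longrightarrow> hcoeff (of_coeffs (zconv \<theta> f)) (i, j) = (\<Sum>l\<le>i. taylor \<theta> l * hcoeff f (i - l, j))"
  by (simp add: hcoeff_zconv) (simp add: zconv_def)

lemma zconv_linear:
  assumes "inner_function \<theta>"
  shows "of_coeffs (zconv \<theta> (f + g)) = of_coeffs (zconv \<theta> f) + of_coeffs (zconv \<theta> g)"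
    and "of_coeffs (zconv \<theta> (scaleC c f)) = scaleC c (of_coeffs (zconv \<theta> f))"
  by (auto intro!: hardy2_eqI sum.cong simp: fun_eq_iff hcoeff_zconv_sum[OF assms]
      sum_distrib_left algebra_simps simp flip: sum.distrib)

lemma ex_adjoint_zconv:
  assumes "inner_function \<theta>"
  shows "\<exists>T'. adjoint_pair (\<lambda>f. of_coeffs (zconv \<theta> f)) T'"
proof (rule ex_adjoint)
  show "bounded_linear (\<lambda>f. of_coeffs (zconv \<theta> f))"
    by (rule bounded_linear_intro[where K = 1])
      (simp_all add: zconv_linear[OF assms] zconv_le[OF assms] flip: scaleC_of_real)
qed (rule zconv_linear(2)[OF assms])

lemma hcoeff_zconv_monomial:
  assumes "inner_function \<theta>"
  shows "hcoeff (of_coeffs (zconv \<theta> (monomial (a, b)))) (i, j) = (if j = b \<and> a \<le> i then taylor \<theta> (i - a) else 0)"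
proof -
  have "(\<Sum>l\<le>i. taylor \<theta> l * hcoeff (monomial (a, b)) (i - l, j)) =
      (\<Sum>l\<le>i. if l = i - a then (if j = b \<and> a \<le> i then taylor \<theta> l else 0) else 0)"
    by (intro sum.cong) (auto simp: hcoeff_monomial)
  then show ?thesis
    by (simp add: hcoeff_zconv_sum[OF assms])
qed

lemma hfun_monomial:
  assumes "p \<in> bidisk"
  shows "hfun (monomial (a, b)) p = fst p ^ a * snd p ^ b"
proof -
  have "hfun (monomial (a, b)) p = cnj (cinner (szego p) (monomial (a, b)))"
    using cinner_szego[OF assms] cinner_commute by metis
  then show ?thesis
    using assms by (simp add: hcoeff_szego)
qed

lemma hfun_zconv_monomial:
  assumes \<theta>: "inner_function \<theta>" and p: "p \<in> bidisk"
  shows "hfun (of_coeffs (zconv \<theta> (monomial (a, b)))) p = \<theta> (fst p) * (fst p ^ a * snd p ^ b)"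
proof -
  define z w where "z = fst p" and "w = snd p"
  have z: "cmod z < 1"
    using p by (auto simp: bidisk_def z_def)
  have hol: "\<theta> holomorphic_on ball 0 1"
    using \<theta> by (simp add: inner_function_def)
  define G where "G k = hcoeff (of_coeffs (zconv \<theta> (monomial (a, b)))) k * z ^ fst k * w ^ snd k" for k
  have "((\<lambda>n. taylor \<theta> n * z ^ n) has_sum \<theta> z) UNIV"
    using taylor_abs_summable[OF hol z] taylor_sums[OF hol z] by (rule norm_summable_imp_has_sum)
  from has_sum_cmult_left[OF this, of "z ^ a * w ^ b"]
  have "(G \<circ> (\<lambda>n. (a + n, b)) has_sum \<theta> z * (z ^ a * w ^ b)) UNIV"
    by (simp add: G_def o_def hcoeff_zconv_monomial[OF \<theta>] power_add mult_ac)
  then have "(G has_sum \<theta> z * (z ^ a * w ^ b)) (range (\<lambda>n. (a + n, b)))"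
    by (subst has_sum_reindex) (auto simp: inj_on_def)
  moreover have "G k = 0" if "k \<notin> range (\<lambda>n. (a + n, b))" for k
  proof -
    obtain i j where k: "k = (i, j)" by force
    have "\<not> (j = b \<and> a \<le> i)"
      using that unfolding k by (metis le_Suc_ex rangeI)
    then show ?thesis
      by (auto simp: G_def k hcoeff_zconv_monomial[OF \<theta>])
  qed
  ultimately have "(G has_sum \<theta> z * (z ^ a * w ^ b)) UNIV"
    by (subst has_sum_cong_neutral[where T = "range (\<lambda>n. (a + n, b))" and g = G]) auto
  moreover have "(G has_sum hfun (of_coeffs (zconv \<theta> (monomial (a, b)))) p) UNIV"
    using hfun_has_sum[OF p] by (simp add: G_def[abs_def] z_def w_def)
  ultimately show ?thesis
    by (metis has_sum_unique z_def w_def)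
qed

text \<open>
  The formula for monomials says that the adjoint multiplies the Szego kernel at \<open>p\<close> by the conjugate of
  \<open>\<theta>\<close>, and this in turn is the formula for arbitrary \<open>f\<close>.
\<close>

lemma hfun_zconv:
  assumes \<theta>: "inner_function \<theta>" and p: "p \<in> bidisk"
  shows "hfun (of_coeffs (zconv \<theta> f)) p = \<theta> (fst p) * hfun f p"
proof -
  obtain T' where T': "adjoint_pair (\<lambda>f. of_coeffs (zconv \<theta> f)) T'"
    using ex_adjoint_zconv[OF \<theta>] by blast
  have "T' (szego p) = scaleC (cnj (\<theta> (fst p))) (szego p)"
  proof (intro hardy2_eqI ext)
    fix k :: "nat \<times> nat"
    obtain i j where k: "k = (i, j)" by force
    have "cnj (hcoeff (T' (szego p)) k) = cinner (monomial k) (T' (szego p))"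
      by (simp add: cinner_monomial_left)
    also have "\<dots> = hfun (of_coeffs (zconv \<theta> (monomial k))) p"
      using p by (simp add: adjoint_pairD[OF T', symmetric] cinner_szego)
    also have "\<dots> = cnj (hcoeff (scaleC (cnj (\<theta> (fst p))) (szego p)) k)"
      using p by (simp add: k hfun_zconv_monomial[OF \<theta>] hcoeff_szego)
    finally show "hcoeff (T' (szego p)) k = hcoeff (scaleC (cnj (\<theta> (fst p))) (szego p)) k"
      by (metis complex_cnj_cancel_iff)
  qed
  then have "cinner (of_coeffs (zconv \<theta> f)) (szego p) = \<theta> (fst p) * cinner f (szego p)"
    by (simp add: adjoint_pairD[OF T'] cinner_simps)
  then show ?thesis
    using p by (simp add: cinner_szego)
qed

lemma mult_op_eqI:
  assumes "\<And>p. p \<in> bidisk \<Longrightarrow> hfun g p = \<psi> p * hfun f p"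
  shows "mult_op \<psi> f = g"
proof -
  have "(\<lambda>p. if p \<in> bidisk then \<psi> p * hfun f p else 0) = hfun g"
    using assms by (auto simp: fun_eq_iff hfun_outside)
  then show ?thesis
    unfolding mult_op_def to_hardy_def by (simp add: hfun_inverse)
qed

abbreviation zmult :: "(complex \<Rightarrow> complex) \<Rightarrow> hardy2 \<Rightarrow> hardy2" where
  "zmult \<theta> \<equiv> mult_op (\<lambda>(z, w). \<theta> z)"

abbreviation wmult :: "(complex \<Rightarrow> complex) \<Rightarrow> hardy2 \<Rightarrow> hardy2" where
  "wmult \<phi> \<equiv> mult_op (\<lambda>(z, w). \<phi> w)"

lemma zmult_eq_zconv: "inner_function \<theta> \<Longrightarrow> zmult \<theta> f = of_coeffs (zconv \<theta> f)"
  by (rule mult_op_eqI) (simp add: hfun_zconv case_prod_unfold)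

lemma hfun_zmult: "inner_function \<theta> \<Longrightarrow> p \<in> bidisk \<Longrightarrow> hfun (zmult \<theta> f) p = \<theta> (fst p) * hfun f p"
  by (simp add: zmult_eq_zconv hfun_zconv)

lemma norm_zmult_finite:
  assumes \<theta>: "inner_function \<theta>" and f: "\<And>i j. \<not> (i < N \<and> j < N) \<Longrightarrow> hcoeff f (i, j) = 0"
  shows "norm (zmult \<theta> f) = norm f"
proof (rule antisym)
  show "norm (zmult \<theta> f) \<le> norm f"
    by (simp add: zmult_eq_zconv[OF \<theta>] zconv_le[OF \<theta>])
  have "(norm f)\<^sup>2 = (\<Sum>\<^sub>\<infinity>k\<in>{..<N} \<times> {..<N}. (cmod (hcoeff f k))\<^sup>2)"
    unfolding norm_hardy2_sq using f by (intro infsum_cong_neutral) auto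
  also have "\<dots> = (\<Sum>j<N. \<Sum>i<N. (cmod (hcoeff f (i, j)))\<^sup>2)"
    by (subst sum.swap) (simp add: sum.cartesian_product case_prod_unfold)
  finally have nf: "(norm f)\<^sup>2 = (\<Sum>j<N. \<Sum>i<N. (cmod (hcoeff f (i, j)))\<^sup>2)" .
  have "(\<lambda>m. \<Sum>j<N. \<Sum>i<m. (cmod (zconv \<theta> f (i, j)))\<^sup>2) \<longlonglongrightarrow> (norm f)\<^sup>2"
    unfolding nf
  proof (rule tendsto_sum)
    fix j
    have "(\<lambda>i. (cmod (\<Sum>l\<le>i. taylor \<theta> l * hcoeff f (i - l, j)))\<^sup>2) sums (\<Sum>i<N. (cmod (hcoeff f (i, j)))\<^sup>2)"
      by (rule inner_convolution_sums[OF \<theta>]) (simp add: f)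
    then show "(\<lambda>m. \<Sum>i<m. (cmod (zconv \<theta> f (i, j)))\<^sup>2) \<longlonglongrightarrow> (\<Sum>i<N. (cmod (hcoeff f (i, j)))\<^sup>2)"
      by (simp add: sums_def zconv_def)
  qed
  moreover have "(\<Sum>j<N. \<Sum>i<m. (cmod (zconv \<theta> f (i, j)))\<^sup>2) \<le> (norm (zmult \<theta> f))\<^sup>2" for m
  proof -
    have "(\<Sum>j<N. \<Sum>i<m. (cmod (zconv \<theta> f (i, j)))\<^sup>2) = (\<Sum>k\<in>{..<m} \<times> {..<N}. (cmod (hcoeff (zmult \<theta> f) k))\<^sup>2)"
      unfolding zmult_eq_zconv[OF \<theta>] hcoeff_zconv[OF \<theta>]
      by (subst sum.swap) (simp add: sum.cartesian_product)
    also have "\<dots> \<le> (norm (zmult \<theta> f))\<^sup>2"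
      by (rule sum_hcoeff_le) auto
    finally show ?thesis .
  qed
  ultimately have "(norm f)\<^sup>2 \<le> (norm (zmult \<theta> f))\<^sup>2"
    by (intro LIMSEQ_le_const2) auto
  then show "norm f \<le> norm (zmult \<theta> f)"
    by (rule power2_le_imp_le) auto
qed

lemma adjoint_pair_eq_monomial:
  assumes "adjoint_pair S S'" "adjoint_pair T T'" "\<And>k. S (monomial k) = T (monomial k)"
  shows "S = T"
proof (rule adjoint_pair_eqI[where X = "range monomial", OF assms(1,2)])
  show "S x = T x" if "x \<in> range monomial" for x
    using that assms(3) by blast
qed (rule monomial_total)

lemma adjoint_pair_eq_szego:
  assumes "adjoint_pair S S'" "adjoint_pair T T'" "\<And>p. p \<in> bidisk \<Longrightarrow> S (szego p) = T (szego p)"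
  shows "S = T"
proof (rule adjoint_pair_eqI[where X = "szego ` bidisk", OF assms(1,2)])
  show "S x = T x" if "x \<in> szego ` bidisk" for x
    using that assms(3) by blast
qed (rule szego_total)

lemma adjoint_pair_adj_on:
  assumes "adjoint_pair T T'"
  shows "adjoint_pair T (adj_on UNIV T)"
proof -
  have "adj_on UNIV T = T'"
    by (rule ext) (simp add: adj_on_eq[OF closed_csubspace_UNIV assms] orth_proj_eq[OF closed_csubspace_UNIV])
  then show ?thesis
    using assms by simp
qed

lemma adj_zmult: 
  assumes "inner_function \<theta>"
  shows "adjoint_pair (zmult \<theta>) (adj_on UNIV (zmult \<theta>))"
proof -
  have "zmult \<theta> = (\<lambda>f. of_coeffs (zconv \<theta> f))"
    by (rule ext) (rule zmult_eq_zconv[OF assms])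
  then show ?thesis
    using ex_adjoint_zconv[OF assms] adjoint_pair_adj_on by metis
qed

text \<open>Polarization, in the form of the four norms that determine one inner product.\<close>

lemma cinner_eq_by_norms:
  assumes "norm x' = norm x" "norm y' = norm y" "norm (x' + y') = norm (x + y)"
    "norm (x' + scaleC \<i> y') = norm (x + scaleC \<i> y)"
  shows "cinner x' y' = cinner x y"
proof -
  have "inner x' y' = inner x y"
    using assms by (simp add: dot_norm)
  moreover have "inner x' (scaleC \<i> y') = inner x (scaleC \<i> y)"
    using assms by (simp add: dot_norm)
  ultimately show ?thesis
    by (simp add: inner_eq_Re_cinner cinner_simps complex_eq_iff)
qed

text \<open>
  Combinations of two monomials have finitely many coefficients, so their norms are preserved; by
  polarization so are the inner products of monomials.
\<close>

lemma zmult_isometry: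
  assumes \<theta>: "inner_function \<theta>"
  shows "adj_on UNIV (zmult \<theta>) (zmult \<theta> f) = f"
proof -
  define T where "T = zmult \<theta>"
  define T' where "T' = adj_on UNIV T"
  have adj: "adjoint_pair T T'"
    unfolding T_def T'_def by (rule adj_zmult[OF \<theta>])
  have "cinner (T (monomial k)) (T (monomial l)) = cinner (monomial k) (monomial l)" for k l
  proof -
    define N where "N = Suc (fst k + snd k + fst l + snd l)"
    have fin: "hcoeff (scaleC c (monomial k) + scaleC d (monomial l)) (i, j) = 0" if "\<not> (i < N \<and> j < N)" for c d i j
      using that by (cases k; cases l) (auto simp: hcoeff_monomial N_def)
    have n: "norm (T (scaleC c (monomial k) + scaleC d (monomial l))) = norm (scaleC c (monomial k) + scaleC d (monomial l))" for c d
      unfolding T_def by (rule norm_zmult_finite[OF \<theta> fin])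
    show ?thesis
      by (rule cinner_eq_by_norms)
        (use n[of 1 0] n[of 0 1] n[of 1 1] n[of 1 \<i>] in
          \<open>simp_all add: adjoint_pair_map_add[OF adj] adjoint_pair_map_scale[OF adj]\<close>)
  qed
  then have "T' (T (monomial k)) = monomial k" for k
    by (intro hardy2_eqI ext)
      (metis adjoint_pairD2[OF adj] cinner_monomial_right)
  then have "(\<lambda>f. T' (T f)) = (\<lambda>f. f)"
    by (intro adjoint_pair_eq_monomial[OF adjoint_pair_comp[OF adjoint_pair_sym[OF adj] adj] adjoint_pair_id])
  then show ?thesis
    by (simp add: fun_eq_iff T_def T'_def)
qed

subsection \<open>Exchange of the variables\<close>

definition swap_vars :: "hardy2 \<Rightarrow> hardy2" where
  "swap_vars f = of_coeffs (\<lambda>k. hcoeff f (prod.swap k))"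

lemma hcoeff_swap_vars: "hcoeff (swap_vars f) k = hcoeff f (prod.swap k)"
proof -
  have "((\<lambda>k. (cmod (hcoeff f k))\<^sup>2) \<circ> prod.swap) summable_on UNIV"
    by (subst summable_on_reindex[symmetric]) (auto simp: hcoeff_sq_summable)
  then show ?thesis
    unfolding swap_vars_def by (subst hcoeff_of_coeffs) (auto simp: o_def)
qed

lemma swap_vars_swap_vars [simp]: "swap_vars (swap_vars f) = f"
  by (intro hardy2_eqI ext) (simp add: hcoeff_swap_vars)

lemma adjoint_swap_vars: "adjoint_pair swap_vars swap_vars"
proof -
  have "cinner (swap_vars f) g = cinner f (swap_vars g)" for f g
  proof -
    have "cinner f (swap_vars g) = infsum (\<lambda>k. hcoeff f k * cnj (hcoeff g (prod.swap k))) (range prod.swap)"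
      by (simp add: cinner_def hcoeff_swap_vars)
    also have "\<dots> = cinner (swap_vars f) g"
      by (subst infsum_reindex) (auto simp: cinner_def hcoeff_swap_vars o_def)
    finally show ?thesis by simp
  qed
  then show ?thesis
    by (simp add: adjoint_pair_def)
qed

lemma swap_in_bidisk: "prod.swap p \<in> bidisk \<longleftrightarrow> p \<in> bidisk"
  by (cases p) (auto simp: bidisk_def)

lemma hfun_swap_vars:
  assumes "p \<in> bidisk"
  shows "hfun (swap_vars f) p = hfun f (prod.swap p)"
proof -
  have sw: "prod.swap p \<in> bidisk"
    using assms by (simp add: swap_in_bidisk)
  have "swap_vars (szego p) = szego (prod.swap p)"
  proof (intro hardy2_eqI ext)
    fix k :: "nat \<times> nat"
    show "hcoeff (swap_vars (szego p)) k = hcoeff (szego (prod.swap p)) k"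
      by (cases k) (simp add: hcoeff_swap_vars hcoeff_szego[OF assms] hcoeff_szego[OF sw] mult.commute)
  qed
  then show ?thesis
    by (metis adjoint_pairD[OF adjoint_swap_vars] assms cinner_szego sw)
qed

lemma wmult_eq_swap:
  assumes "inner_function \<phi>"
  shows "wmult \<phi> f = swap_vars (zmult \<phi> (swap_vars f))"
proof (rule mult_op_eqI)
  fix p assume "p \<in> bidisk"
  then have "hfun (swap_vars (zmult \<phi> (swap_vars f))) p = \<phi> (snd p) * hfun f p"
    by (simp add: hfun_swap_vars hfun_zmult[OF assms] swap_in_bidisk)
  then show "hfun (swap_vars (zmult \<phi> (swap_vars f))) p = (case p of (z, w) \<Rightarrow> \<phi> w) * hfun f p"
    by (cases p) simp
qed

lemma adj_wmult:
  assumes "inner_function \<phi>"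
  shows "adjoint_pair (wmult \<phi>) (adj_on UNIV (wmult \<phi>))"
proof (rule adjoint_pair_adj_on)
  show "adjoint_pair (wmult \<phi>) (\<lambda>f. swap_vars (adj_on UNIV (zmult \<phi>) (swap_vars f)))"
    unfolding wmult_eq_swap[OF assms, abs_def]
    by (intro adjoint_pair_comp[OF adjoint_pair_comp[OF adjoint_swap_vars adj_zmult[OF assms]] adjoint_swap_vars])
qed

lemma wmult_isometry:
  assumes "inner_function \<phi>"
  shows "adj_on UNIV (wmult \<phi>) (wmult \<phi> f) = f"
proof (rule cinner_eqI)
  fix h
  have "cinner (adj_on UNIV (wmult \<phi>) (wmult \<phi> f)) h = cinner (wmult \<phi> f) (wmult \<phi> h)"
    by (simp add: adjoint_pairD2[OF adj_wmult[OF assms]])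
  also have "\<dots> = cinner f h"
    unfolding wmult_eq_swap[OF assms]
    by (simp add: adjoint_pairD[OF adjoint_swap_vars] adjoint_pairD[OF adj_zmult[OF assms]] zmult_isometry[OF assms])
  finally show "cinner (adj_on UNIV (wmult \<phi>) (wmult \<phi> f)) h = cinner f h" .
qed

lemma hfun_wmult:
  assumes "inner_function \<phi>" "p \<in> bidisk"
  shows "hfun (wmult \<phi> f) p = \<phi> (snd p) * hfun f p"
  using assms by (simp add: wmult_eq_swap hfun_swap_vars hfun_zmult swap_in_bidisk)

lemma hfun_add: "hfun (f + g) p = hfun f p + hfun g p"
  and hfun_diff: "hfun (f - g) p = hfun f p - hfun g p"
  and hfun_scaleC: "hfun (scaleC c f) p = c * hfun f p"
  by (simp_all add: plus_hardy2.rep_eq minus_hardy2.rep_eq scaleC.rep_eq)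

lemma cinner_single:
  assumes "\<And>k. k \<noteq> k0 \<Longrightarrow> hcoeff f k = 0 \<or> hcoeff g k = 0"
  shows "cinner f g = hcoeff f k0 * cnj (hcoeff g k0)"
proof -
  have "cinner f g = (\<Sum>\<^sub>\<infinity>k\<in>{k0}. hcoeff f k * cnj (hcoeff g k))"
    unfolding cinner_def using assms by (intro infsum_cong_neutral) auto
  then show ?thesis by simp
qed

text \<open>
  The two multiplications act on different indices of the coefficient array. Tested on monomials, both
  sides of the double commutation relation reduce to the same product of one Taylor coefficient of \<open>\<phi>\<close>
  with the conjugate of one of \<open>\<theta>\<close>.
\<close>

theorem isometry_pair_inner:
  assumes \<theta>: "inner_function \<theta>" and \<phi>: "inner_function \<phi>"
  shows "isometry_pair (zmult \<theta>) (adj_on UNIV (zmult \<theta>)) (wmult \<phi>) (adj_on UNIV (wmult \<phi>))"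
proof
  define Z Z' W W' where "Z = zmult \<theta>" and "Z' = adj_on UNIV Z" and "W = wmult \<phi>" and "W' = adj_on UNIV W"
  have Z: "adjoint_pair Z Z'" and W: "adjoint_pair W W'"
    unfolding Z_def Z'_def W_def W'_def by (rule adj_zmult[OF \<theta>] adj_wmult[OF \<phi>])+
  have Zm: "hcoeff (Z (monomial (a, b))) (i, j) = (if j = b \<and> a \<le> i then taylor \<theta> (i - a) else 0)" for a b i j
    by (simp add: Z_def zmult_eq_zconv[OF \<theta>] hcoeff_zconv_monomial[OF \<theta>])
  have "swap_vars (monomial (a, b)) = monomial (b, a)" for a b
    by (intro hardy2_eqI ext) (auto simp: hcoeff_swap_vars hcoeff_monomial prod.swap_def)
  then have Wm: "hcoeff (W (monomial (a, b))) (i, j) = (if i = a \<and> b \<le> j then taylor \<phi> (j - b) else 0)" for a b i j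
    by (simp add: W_def wmult_eq_swap[OF \<phi>] zmult_eq_zconv[OF \<phi>] hcoeff_zconv_monomial[OF \<phi>] hcoeff_swap_vars)
  have Z'm: "hcoeff (Z' (monomial (a, b))) (i, j) = (if b = j \<and> i \<le> a then cnj (taylor \<theta> (a - i)) else 0)" for a b i j
    using adjoint_pairD2[OF Z, of "monomial (a, b)" "monomial (i, j)"] by (simp add: cinner_monomial_left Zm)
  have W'm: "hcoeff (W' (monomial (a, b))) (i, j) = (if a = i \<and> j \<le> b then cnj (taylor \<phi> (b - j)) else 0)" for a b i j
    using adjoint_pairD2[OF W, of "monomial (a, b)" "monomial (i, j)"] by (simp add: cinner_monomial_left Wm)
  have "Z' (W (monomial k)) = W (Z' (monomial k))" for k
  proof (intro hardy2_eqI ext)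
    fix l :: "nat \<times> nat"
    obtain a b e h where kl: "k = (a, b)" "l = (e, h)" by force
    have "hcoeff (Z' (W (monomial k))) l = cinner (W (monomial k)) (Z (monomial l))"
      using adjoint_pairD2[OF Z, of "W (monomial k)" "monomial l"] by simp
    also have "\<dots> = hcoeff (W (monomial k)) (a, h) * cnj (hcoeff (Z (monomial l)) (a, h))"
      by (rule cinner_single) (auto simp: kl Wm Zm split: if_splits)
    also have "\<dots> = hcoeff (Z' (monomial k)) (e, b) * cnj (hcoeff (W' (monomial l)) (e, b))"
      by (simp add: kl Wm Zm Z'm W'm)
    also have "\<dots> = cinner (Z' (monomial k)) (W' (monomial l))"
      by (rule cinner_single[symmetric]) (auto simp: kl Z'm W'm split: if_splits)
    also have "\<dots> = hcoeff (W (Z' (monomial k))) l"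
      using adjoint_pairD[OF W, of "Z' (monomial k)" "monomial l"] by simp
    finally show "hcoeff (Z' (W (monomial k))) l = hcoeff (W (Z' (monomial k))) l" .
  qed
  then have "(\<lambda>f. Z' (W f)) = (\<lambda>f. W (Z' f))"
    by (intro adjoint_pair_eq_monomial[OF adjoint_pair_comp[OF adjoint_pair_sym[OF Z] W]
          adjoint_pair_comp[OF W adjoint_pair_sym[OF Z]]])
  then show "adj_on UNIV (zmult \<theta>) (wmult \<phi> f) = wmult \<phi> (adj_on UNIV (zmult \<theta>) f)" for f
    by (simp add: fun_eq_iff Z_def Z'_def W_def)
  show "zmult \<theta> (wmult \<phi> f) = wmult \<phi> (zmult \<theta> f)" for f
    by (subst hardy2_eq_iff) (intro ballI, simp only: hfun_zmult[OF \<theta>] hfun_wmult[OF \<phi>] mult.left_commute)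
qed (rule adj_zmult[OF \<theta>] adj_wmult[OF \<phi>] zmult_isometry[OF \<theta>] wmult_isometry[OF \<phi>])+

subsection \<open>Action on the reproducing kernels\<close>

lemma adj_zmult_szego:
  assumes "inner_function \<theta>" "p \<in> bidisk"
  shows "adj_on UNIV (zmult \<theta>) (szego p) = scaleC (cnj (\<theta> (fst p))) (szego p)"
  by (rule cinner_eqI, subst (1 2) cinner_commute)
    (simp add: adjoint_pairD[OF adj_zmult, symmetric] cinner_szego hfun_zmult cinner_simps assms)

lemma adj_wmult_szego:
  assumes "inner_function \<phi>" "p \<in> bidisk"
  shows "adj_on UNIV (wmult \<phi>) (szego p) = scaleC (cnj (\<phi> (snd p))) (szego p)"
  by (rule cinner_eqI, subst (1 2) cinner_commute)
    (simp add: adjoint_pairD[OF adj_wmult, symmetric] cinner_szego hfun_wmult cinner_simps assms)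

lemma geometric_has_sum: "norm x < 1 \<Longrightarrow> ((\<lambda>n. x ^ n) has_sum 1 / (1 - x)) UNIV" for x :: complex
  by (rule norm_summable_imp_has_sum) (auto simp: norm_power intro!: geometric_sums)

lemma hfun_szego:
  assumes p: "p \<in> bidisk" and q: "q \<in> bidisk"
  shows "hfun (szego p) q = 1 / ((1 - fst q * cnj (fst p)) * (1 - snd q * cnj (snd p)))"
proof -
  define x y where "x = fst q * cnj (fst p)" and "y = snd q * cnj (snd p)"
  have lt: "norm (a * cnj b) < 1" if "norm a < 1" "norm b < 1" for a b :: complex
    using mult_strict_mono[of "norm a" 1 "norm b" 1] that by (simp add: norm_mult)
  have xy: "norm x < 1" "norm y < 1"
    using p q by (auto simp: x_def y_def bidisk_def intro!: lt)
  have "((\<lambda>k. x ^ fst k * y ^ snd k) has_sum hfun (szego p) q) (UNIV \<times> UNIV)"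
  proof -
    have "hcoeff (szego p) k = cnj (fst p) ^ fst k * cnj (snd p) ^ snd k" for k
      using hcoeff_szego[OF p, of "fst k" "snd k"] by simp
    then show ?thesis
      using hfun_has_sum[OF q, of "szego p"] by (simp add: x_def y_def power_mult_distrib mult_ac)
  qed
  then have "((\<lambda>i. x ^ i * (1 / (1 - y))) has_sum hfun (szego p) q) UNIV"
    by (rule has_sum_SigmaD) (use has_sum_cmult_right[OF geometric_has_sum[OF xy(2)]] in auto)
  moreover have "((\<lambda>i. x ^ i * (1 / (1 - y))) has_sum 1 / (1 - x) * (1 / (1 - y))) UNIV"
    by (rule has_sum_cmult_left[OF geometric_has_sum[OF xy(1)]])
  ultimately have "hfun (szego p) q = 1 / (1 - x) * (1 / (1 - y))"
    by (rule has_sum_unique)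
  then show ?thesis
    by (simp add: x_def y_def)
qed

lemma one_minus_mult_cnj_nonzero: "norm a < 1 \<Longrightarrow> norm b < 1 \<Longrightarrow> 1 - a * cnj b \<noteq> 0" for a b :: complex
  using mult_strict_mono[of "norm a" 1 "norm b" 1] by (metis complex_mod_cnj eq_iff_diff_eq_0 less_irrefl mult_1 norm_ge_zero norm_mult norm_one zero_less_one)

lemma hfun_szego_nonzero: "p \<in> bidisk \<Longrightarrow> q \<in> bidisk \<Longrightarrow> hfun (szego p) q \<noteq> 0"
  using one_minus_mult_cnj_nonzero[of "fst q" "fst p"] one_minus_mult_cnj_nonzero[of "snd q" "snd p"]
  by (auto simp: hfun_szego) (auto simp: bidisk_def)

text \<open>
  The adjoint of \<open>\<theta>(z)\<close> multiplies the kernel at a point by the conjugate of the value of \<open>\<theta>\<close>, so this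
  value has modulus at most 1. In case of equality the adjoint preserves the norm of the kernel, which
  then lies in the range of the isometry; comparison of values makes \<open>\<theta>\<close> constant.
\<close>

lemma inner_function_lt_1:
  assumes \<theta>: "inner_function \<theta>" "\<not> \<theta> constant_on ball 0 1" and z: "norm z < 1"
  shows "norm (\<theta> z) < 1"
proof (rule ccontr)
  assume "\<not> norm (\<theta> z) < 1"
  interpret isometry_pair "zmult \<theta>" "adj_on UNIV (zmult \<theta>)" "wmult \<theta>" "adj_on UNIV (wmult \<theta>)"
    by (rule isometry_pair_inner[OF \<theta>(1) \<theta>(1)])
  define p where "p = (z, 0 :: complex)"
  have p: "p \<in> bidisk"
    using z by (simp add: p_def bidisk_def)
  define k where "k = szego p"
  define c where "c = cnj (\<theta> z)"
  have k: "adj_on UNIV (zmult \<theta>) k = scaleC c k"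
    using adj_zmult_szego[OF \<theta>(1) p] by (simp add: k_def c_def p_def)
  have k0: "k \<noteq> 0"
    using hfun_szego_nonzero[OF p p] by (auto simp: k_def zero_hardy2.rep_eq)
  have "norm (scaleC c k) \<le> norm k"
    unfolding k[symmetric] by (rule norm_A'_le)
  with \<open>\<not> norm (\<theta> z) < 1\<close> k0 have c1: "norm c = 1"
    by (simp add: c_def)
  define x where "x = k - zmult \<theta> (scaleC c k)"
  have "adj_on UNIV (zmult \<theta>) x = 0"
    by (simp add: x_def linA' isoA k)
  then have "cinner x (zmult \<theta> (scaleC c k)) = 0"
    by (simp add: adjoint_pairD2[OF adjA, symmetric])
  from norm_add_sq_orthogonal[OF this] have "(norm k)\<^sup>2 = (norm x)\<^sup>2 + (norm (zmult \<theta> (scaleC c k)))\<^sup>2"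
    by (simp add: x_def)
  then have "x = 0"
    by (simp add: c1)
  have "\<theta> u = 1 / c" if "norm u < 1" for u
  proof -
    have u: "(u, 0) \<in> bidisk"
      using that by (simp add: bidisk_def)
    have "hfun k (u, 0) = hfun (zmult \<theta> (scaleC c k)) (u, 0)"
      using \<open>x = 0\<close> by (simp add: x_def)
    then have "hfun k (u, 0) = \<theta> u * (c * hfun k (u, 0))"
      by (simp only: hfun_zmult[OF \<theta>(1) u] hfun_scaleC fst_conv)
    then have "\<theta> u * c = 1"
      using hfun_szego_nonzero[OF p u] by (simp add: k_def)
    moreover have "c \<noteq> 0"
      using c1 by auto
    ultimately show ?thesis
      by (simp add: eq_divide_eq)
  qed
  then have "\<theta> constant_on ball 0 1"
    by (auto simp: constant_on_def)
  with \<theta>(2) show False by simp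
qed

text \<open>
  The Szego kernels are eigenvectors of the adjoint, with eigenvalues of modulus less than 1.
\<close>

lemma wmult_pure:
  assumes \<phi>: "inner_function \<phi>" "\<not> \<phi> constant_on ball 0 1"
  shows "(\<lambda>n. (adj_on UNIV (wmult \<phi>) ^^ n) f) \<longlonglongrightarrow> 0"
proof -
  interpret isometry_pair "zmult \<phi>" "adj_on UNIV (zmult \<phi>)" "wmult \<phi>" "adj_on UNIV (wmult \<phi>)"
    by (rule isometry_pair_inner[OF \<phi>(1) \<phi>(1)])
  let ?W' = "adj_on UNIV (wmult \<phi>)"
  show ?thesis
  proof (rule contractions_tendsto_zero[OF adjoint_pair_sym[OF adj_pow_B] _ szego_total])
    show "norm ((?W' ^^ n) f) \<le> norm f" for n f
      by (rule adjoint_pair_norm_le[OF adj_pow_B]) simp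
    fix x assume "x \<in> szego ` bidisk"
    then obtain p where p: "p \<in> bidisk" "x = szego p" by blast
    define c where "c = cnj (\<phi> (snd p))"
    have "(?W' ^^ n) x = scaleC (c ^ n) x" for n
      by (induction n) (auto simp: p adj_wmult_szego[OF \<phi>(1)] linB' c_def mult_ac)
    moreover have "(\<lambda>n. norm (c ^ n) * norm x) \<longlonglongrightarrow> 0 * norm x"
      using inner_function_lt_1[OF \<phi>, of "snd p"] p
      by (intro tendsto_intros) (auto simp: c_def bidisk_def norm_power intro!: LIMSEQ_power_zero)
    ultimately show "(\<lambda>n. (?W' ^^ n) x) \<longlonglongrightarrow> 0"
      by (intro tendsto_norm_zero_cancel[where f = "\<lambda>n. (?W' ^^ n) x"]) simp
  qed auto
qed

subsection \<open>Disk automorphisms\<close>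

lemma inner_function_id: "inner_function (\<lambda>z. z)"
proof -
  have "((\<lambda>r. of_real r * cis t) \<longlongrightarrow> of_real 1 * cis t) (at_left 1)" for t
    by (intro tendsto_intros)
  then have "\<exists>l. ((\<lambda>r. of_real r * cis t) \<longlongrightarrow> l) (at_left 1) \<and> cmod l = 1" for t
    by (intro exI[of _ "cis t"]) simp
  then show ?thesis
    by (auto simp: inner_function_def)
qed

lemma
  assumes a: "norm a < 1"
  shows inner_disk_automorphism: "inner_function (disk_automorphism a)"
    and disk_automorphism_nonconstant: "\<not> disk_automorphism a constant_on ball 0 1"
proof -
  have nz: "1 - cnj a * z \<noteq> 0" if "norm z \<le> 1" for z
  proof
    assume "1 - cnj a * z = 0"
    then have "norm a * norm z = 1"
      by (metis complex_mod_cnj eq_iff_diff_eq_0 norm_mult norm_one)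
    moreover have "norm a * norm z \<le> norm a * 1"
      using that by (intro mult_left_mono) auto
    ultimately show False
      using a by simp
  qed
  have "norm (disk_automorphism a z) \<le> 2 / (1 - norm a)" if "norm z < 1" for z
  proof -
    have "norm (a - z) \<le> 2"
      using norm_triangle_ineq4[of a z] a that by simp
    moreover have "norm (cnj a * z) \<le> norm a"
      using that by (simp add: norm_mult mult_left_le)
    then have "1 - norm a \<le> norm (1 - cnj a * z)"
      using norm_triangle_ineq2[of 1 "cnj a * z"] by simp
    ultimately show ?thesis
      unfolding disk_automorphism_def norm_divide using a by (intro frac_le) auto
  qed
  then have bd: "bounded (disk_automorphism a ` ball 0 1)"
    unfolding bounded_iff by (intro exI[of _ "2 / (1 - norm a)"]) auto
  have hol: "disk_automorphism a holomorphic_on ball 0 1"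
    unfolding disk_automorphism_def[abs_def] using nz by (intro holomorphic_intros) auto
  have rad: "\<exists>l. ((\<lambda>r. disk_automorphism a (of_real r * cis t)) \<longlongrightarrow> l) (at_left 1) \<and> cmod l = 1" for t
  proof (intro exI conjI)
    have "1 - cnj a * (of_real 1 * cis t) \<noteq> 0"
      by (rule nz) simp
    then show "((\<lambda>r. disk_automorphism a (of_real r * cis t)) \<longlongrightarrow> disk_automorphism a (of_real 1 * cis t)) (at_left 1)"
      unfolding disk_automorphism_def by (intro tendsto_intros)
    have "a - cis t = - cis t * cnj (1 - cnj a * cis t)"
      by (simp add: algebra_simps cis_cnj cis_mult flip: mult.assoc)
    then have "norm (a - cis t) = norm (1 - cnj a * cis t)"
      by (metis complex_mod_cnj mult_1 norm_cis norm_minus_cancel norm_mult)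
    then show "cmod (disk_automorphism a (of_real 1 * cis t)) = 1"
      using nz[of "cis t"] by (simp add: disk_automorphism_def norm_divide)
  qed
  show "inner_function (disk_automorphism a)"
    using hol bd rad by (auto simp: inner_function_def)
  show "\<not> disk_automorphism a constant_on ball 0 1"
  proof
    assume "disk_automorphism a constant_on ball 0 1"
    then obtain c where c: "\<And>z. norm z < 1 \<Longrightarrow> disk_automorphism a z = c"
      by (auto simp: constant_on_def)
    have "disk_automorphism a 0 = disk_automorphism a a"
      using c[of 0] c[of a] a by simp
    then have "a = 0"
      by (simp add: disk_automorphism_def)
    then show False
      using c[of 0] c[of "1/2"] by (auto simp: disk_automorphism_def)
  qed
qed

lemma disk_automorphism_zero [simp]: "disk_automorphism a 0 = a"
  by (simp add: disk_automorphism_def)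

lemma disk_automorphism_kernel:
  assumes "norm a < 1" "norm x < 1" "norm y < 1"
  shows "1 - disk_automorphism a x * cnj (disk_automorphism a y) =
    (1 - a * cnj a) * (1 - x * cnj y) / ((1 - cnj a * x) * (1 - a * cnj y))"
proof -
  define D N where "D = (1 - cnj a * x) * (1 - a * cnj y)" and "N = (a - x) * (cnj a - cnj y)"
  have "D \<noteq> 0"
    using one_minus_mult_cnj_nonzero[of x a] one_minus_mult_cnj_nonzero[of a y] assms
    by (auto simp: D_def mult.commute)
  have "1 - disk_automorphism a x * cnj (disk_automorphism a y) = 1 - N / D"
    by (simp add: disk_automorphism_def D_def N_def)
  also have "\<dots> = (D - N) / D"
    using \<open>D \<noteq> 0\<close> by (simp add: diff_divide_distrib)
  also have "D - N = (1 - a * cnj a) * (1 - x * cnj y)"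
    by (simp add: D_def N_def algebra_simps)
  finally show ?thesis
    by (simp add: D_def)
qed

section \<open>The submodule generated by a difference\<close>

lemma hfun_sum: "hfun (sum f A) p = (\<Sum>x\<in>A. hfun (f x) p)"
  by (induction A rule: infinite_finite_induct) (auto simp: hfun_add zero_hardy2.rep_eq)

lemma tendsto_norm_diff_zero: "(\<lambda>n. norm (x n - l)) \<longlonglongrightarrow> 0 \<Longrightarrow> x \<longlonglongrightarrow> l" for l :: hardy2
  by (rule LIM_zero_cancel, rule tendsto_norm_zero_cancel)

lemma in_closureI: "(\<And>n. x n \<in> S) \<Longrightarrow> x \<longlonglongrightarrow> l \<Longrightarrow> l \<in> closure S" for l :: hardy2
  unfolding closure_sequential by blast

lemma closed_csubspace_closure_range:
  assumes "adjoint_pair T T'"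
  shows "closed_csubspace (closure (range T))"
  unfolding closed_csubspace_def
proof (intro conjI ballI allI)
  show "0 \<in> closure (range T)"
    using adjoint_pair_map_zero[OF assms] rangeI[of T 0] closure_subset[of "range T"] by auto
next
  fix f g assume f: "f \<in> closure (range T)" and g: "g \<in> closure (range T)"
  obtain x where x: "\<And>n. x n \<in> range T" "x \<longlonglongrightarrow> f"
    using f unfolding closure_sequential by blast
  obtain y where y: "\<And>n. y n \<in> range T" "y \<longlonglongrightarrow> g"
    using g unfolding closure_sequential by blast
  have "x n + y n \<in> range T" for n
  proof -
    obtain u v where "x n = T u" "y n = T v"
      using x(1)[of n] y(1)[of n] by auto
    then have "x n + y n = T (u + v)"
      by (simp add: adjoint_pair_map_add[OF assms])
    then show ?thesis by simp
  qed
  then show "f + g \<in> closure (range T)"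
    by (rule in_closureI[OF _ tendsto_add[OF x(2) y(2)]])
next
  fix c f assume "f \<in> closure (range T)"
  then obtain x where x: "\<And>n. x n \<in> range T" "x \<longlonglongrightarrow> f"
    unfolding closure_sequential by blast
  have 1: "scaleC c (x n) \<in> range T" for n
  proof -
    obtain u where "x n = T u"
      using x(1)[of n] by auto
    then have "scaleC c (x n) = T (scaleC c u)"
      by (simp add: adjoint_pair_map_scale[OF assms])
    then show ?thesis by simp
  qed
  have "(\<lambda>n. norm (scaleC c (x n) - scaleC c f)) \<longlonglongrightarrow> cmod c * 0"
    unfolding scaleC_diff_right[symmetric] norm_scaleC
    by (intro tendsto_intros tendsto_norm_zero) (simp add: LIM_zero_iff x(2))
  then have "(\<lambda>n. scaleC c (x n)) \<longlonglongrightarrow> scaleC c f"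
    by (intro tendsto_norm_diff_zero) simp
  with 1 show "scaleC c f \<in> closure (range T)"
    by (rule in_closureI)
qed auto

lemma cinner_closure_eq_0:
  assumes "\<And>x. x \<in> S \<Longrightarrow> cinner x g = 0" "f \<in> closure S"
  shows "cinner f g = 0"
proof -
  obtain x where x: "\<And>n. x n \<in> S" "x \<longlonglongrightarrow> f"
    using assms(2) unfolding closure_sequential by blast
  have "(\<lambda>n. cinner (x n) g) \<longlonglongrightarrow> cinner f g"
    by (intro tendsto_intros x)
  then show ?thesis
    using assms(1) x(1) by (simp add: LIMSEQ_const_iff)
qed

lemma closure_invariant:
  assumes T: "adjoint_pair T T'" "\<And>f. norm (T f) = norm f" and S: "\<And>x. x \<in> S \<Longrightarrow> T x \<in> closure R"
    and f: "f \<in> closure S"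
  shows "T f \<in> closure R"
proof -
  obtain x where x: "\<And>n. x n \<in> S" "x \<longlonglongrightarrow> f"
    using f unfolding closure_sequential by blast
  have "(\<lambda>n. norm (T (x n) - T f)) \<longlonglongrightarrow> 0"
    unfolding adjoint_pair_map_diff[OF T(1), symmetric] T(2)
    by (intro tendsto_norm_zero) (simp add: LIM_zero_iff x(2))
  then have "(\<lambda>n. T (x n)) \<longlonglongrightarrow> T f"
    by (rule tendsto_norm_diff_zero)
  then show ?thesis
    by (rule closed_sequentially[OF closed_closure _, rotated]) (use S x in auto)
qed

lemma polynomial_approximation:
  "(\<lambda>n. \<Sum>i\<le>n. \<Sum>j\<le>n. scaleC (hcoeff f (i, j)) (monomial (i, j))) \<longlonglongrightarrow> f"
proof -
  define g where "g n = (\<Sum>i\<le>n. \<Sum>j\<le>n. scaleC (hcoeff f (i, j)) (monomial (i, j)))" for n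
  have coeff: "hcoeff (g n) k = (if k \<in> {..n} \<times> {..n} then hcoeff f k else 0)" for n k
  proof -
    have "hcoeff (g n) k = (\<Sum>l\<in>{..n} \<times> {..n}. hcoeff f l * hcoeff (monomial l) k)"
      by (simp add: g_def hcoeff_sum sum.cartesian_product case_prod_unfold)
    also have "\<dots> = (\<Sum>l\<in>{..n} \<times> {..n}. if k = l then hcoeff f l else 0)"
      by (intro sum.cong refl) (simp add: hcoeff_monomial)
    finally have "hcoeff (g n) k = (\<Sum>l\<in>{..n} \<times> {..n}. if k = l then hcoeff f l else 0)" .
    then show ?thesis
      by (simp only: sum.delta' finite_cartesian_product finite_atMost)
  qed
  have "cinner (f - g n) (g n) = 0" for n
  proof -
    have "hcoeff (f - g n) k * cnj (hcoeff (g n) k) = 0" for k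
      by (simp only: hcoeff_diff coeff) simp
    then show ?thesis
      by (simp only: cinner_def) simp
  qed
  from norm_add_sq_orthogonal[OF this]
  have pyth: "(norm (f - g n))\<^sup>2 = (norm f)\<^sup>2 - (norm (g n))\<^sup>2" for n
    by (simp add: algebra_simps)
  have ng: "(norm (g n))\<^sup>2 = (\<Sum>k\<in>{..n} \<times> {..n}. (cmod (hcoeff f k))\<^sup>2)" for n
  proof -
    have "(norm (g n))\<^sup>2 = (\<Sum>\<^sub>\<infinity>k\<in>{..n} \<times> {..n}. (cmod (hcoeff f k))\<^sup>2)"
      unfolding norm_hardy2_sq by (rule infsum_cong_neutral) (auto simp: coeff)
    then show ?thesis by simp
  qed
  have "filterlim (\<lambda>n. {..n} \<times> {..n}) (finite_subsets_at_top (UNIV :: (nat \<times> nat) set)) sequentially"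
    unfolding filterlim_finite_subsets_at_top
  proof (intro allI impI)
    fix X :: "(nat \<times> nat) set" assume "finite X \<and> X \<subseteq> UNIV"
    then have "finite (fst ` X \<union> snd ` X)" by simp
    then obtain N where "fst ` X \<union> snd ` X \<subseteq> {..<N}"
      using finite_nat_bounded by blast
    then have "X \<subseteq> {..n} \<times> {..n}" if "N \<le> n" for n
      using that by force
    then show "\<forall>\<^sub>F n in sequentially. finite ({..n} \<times> {..n}) \<and> X \<subseteq> {..n} \<times> {..n} \<and> {..n} \<times> {..n} \<subseteq> UNIV"
      by (auto simp: eventually_at_top_linorder)
  qed
  from filterlim_compose[OF has_sum_norm_sq[of f, unfolded has_sum_def] this]
  have "(\<lambda>n. (norm (g n))\<^sup>2) \<longlonglongrightarrow> (norm f)\<^sup>2"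
    by (simp add: ng)
  then have "(\<lambda>n. (norm (f - g n))\<^sup>2) \<longlonglongrightarrow> (norm f)\<^sup>2 - (norm f)\<^sup>2"
    unfolding pyth by (rule tendsto_diff[OF tendsto_const])
  then have "(\<lambda>n. sqrt ((norm (f - g n))\<^sup>2)) \<longlonglongrightarrow> sqrt 0"
    by (intro tendsto_real_sqrt) simp
  then have "(\<lambda>n. norm (g n - f)) \<longlonglongrightarrow> 0"
    by (simp add: norm_minus_commute)
  then have "g \<longlonglongrightarrow> f"
    by (rule tendsto_norm_diff_zero)
  then show ?thesis
    by (simp add: g_def[abs_def])
qed

locale inner_pair =
  fixes \<theta> \<phi> :: "complex \<Rightarrow> complex"
  assumes \<theta>: "inner_function \<theta>" and \<phi>: "inner_function \<phi>"
begin

abbreviation Z where "Z \<equiv> zmult \<theta>"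
abbreviation W where "W \<equiv> wmult \<phi>"
abbreviation Z' where "Z' \<equiv> adj_on UNIV Z"
abbreviation W' where "W' \<equiv> adj_on UNIV W"
abbreviation N where "N \<equiv> generated_submodule (\<lambda>(z, w). \<theta> z - \<phi> w)"

sublocale isometry_pair Z Z' W W'
  by (rule isometry_pair_inner[OF \<theta> \<phi>])

definition D where "D f = Z f - W f"

lemma adjoint_D: "adjoint_pair D (\<lambda>f. Z' f - W' f)"
  using adjoint_pair_diff[OF adjA adjB] by (simp add: D_def[abs_def])

lemma hfun_D: "p \<in> bidisk \<Longrightarrow> hfun (D f) p = (\<theta> (fst p) - \<phi> (snd p)) * hfun f p"
  by (simp add: D_def hfun_diff hfun_zmult[OF \<theta>] hfun_wmult[OF \<phi>] algebra_simps)

lemma to_hardy_D: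
  assumes "\<And>p. p \<in> bidisk \<Longrightarrow> hfun f p = q p"
  shows "to_hardy (\<lambda>p. q p * (case p of (z, w) \<Rightarrow> \<theta> z - \<phi> w)) = D f"
proof -
  have "(\<lambda>p. if p \<in> bidisk then q p * (case p of (z, w) \<Rightarrow> \<theta> z - \<phi> w) else 0) = hfun (D f)"
    using assms by (auto simp: fun_eq_iff hfun_D hfun_outside)
  then show ?thesis
    unfolding to_hardy_def by (simp add: hfun_inverse)
qed

lemma hfun_polynomial:
  "p \<in> bidisk \<Longrightarrow> hfun (\<Sum>i\<le>n. \<Sum>j\<le>n. scaleC (c i j) (monomial (i, j))) p = (\<Sum>i\<le>n. \<Sum>j\<le>n. c i j * fst p ^ i * snd p ^ j)"
  by (simp add: hfun_sum hfun_scaleC hfun_monomial mult.assoc)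

lemma generated_submodule_eq: "N = closure (range D)"
proof -
  define S where "S = {to_hardy (\<lambda>p. q p * (case p of (z, w) \<Rightarrow> \<theta> z - \<phi> w)) |q. q \<in> bivariate_polynomials}"
  have "S \<subseteq> range D"
  proof
    fix x assume "x \<in> S"
    then obtain q n c where x: "x = to_hardy (\<lambda>p. q p * (case p of (z, w) \<Rightarrow> \<theta> z - \<phi> w))"
      and q: "\<And>z w. q (z, w) = (\<Sum>i\<le>n. \<Sum>j\<le>n. c i j * z ^ i * w ^ j)"
      by (auto simp: S_def bivariate_polynomials_def)
    have "x = D (\<Sum>i\<le>n. \<Sum>j\<le>n. scaleC (c i j) (monomial (i, j)))"
      unfolding x by (rule to_hardy_D) (use q in \<open>auto simp: hfun_polynomial split: prod.splits\<close>)
    then show "x \<in> range D" by blast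
  qed
  moreover have "range D \<subseteq> closure S"
  proof clarify
    fix f
    define g where "g n = (\<Sum>i\<le>n. \<Sum>j\<le>n. scaleC (hcoeff f (i, j)) (monomial (i, j)))" for n
    have "D (g n) \<in> S" for n
    proof -
      define q where "q p = (\<Sum>i\<le>n. \<Sum>j\<le>n. hcoeff f (i, j) * fst p ^ i * snd p ^ j)" for p
      have "to_hardy (\<lambda>p. q p * (case p of (z, w) \<Rightarrow> \<theta> z - \<phi> w)) = D (g n)"
        by (rule to_hardy_D) (simp add: g_def q_def hfun_polynomial)
      moreover have "q \<in> bivariate_polynomials"
        unfolding bivariate_polynomials_def q_def by (auto intro!: exI[of _ n] exI[of _ "\<lambda>i j. hcoeff f (i, j)"])
      ultimately show ?thesis
        unfolding S_def mem_Collect_eq by (intro exI[of _ q] conjI) simp_all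
    qed
    moreover have "(\<lambda>n. D (g n)) \<longlonglongrightarrow> D f"
    proof (rule tendsto_norm_diff_zero)
      have le: "norm (D (g n) - D f) \<le> 2 * norm (g n - f)" for n
        unfolding adjoint_pair_map_diff[OF adjoint_D, symmetric]
        using norm_triangle_ineq4[of "Z (g n - f)" "W (g n - f)"] by (simp add: D_def)
      have "(\<lambda>n. norm (g n - f)) \<longlonglongrightarrow> 0"
        using polynomial_approximation[of f] by (intro tendsto_norm_zero) (simp add: g_def LIM_zero_iff)
      then have lim: "(\<lambda>n. 2 * norm (g n - f)) \<longlonglongrightarrow> 0"
        by (rule tendsto_mult_right_zero)
      show "(\<lambda>n. norm (D (g n) - D f)) \<longlonglongrightarrow> 0"
        by (rule tendsto_sandwich[OF _ _ tendsto_const lim]) (simp_all add: le)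
    qed
    ultimately show "D f \<in> closure S"
      by (rule in_closureI)
  qed
  ultimately have "closure S = closure (range D)"
    by (metis antisym closure_closure closure_mono)
  then show ?thesis
    by (simp add: generated_submodule_def S_def)
qed

lemma closed_csubspace_N: "closed_csubspace N"
  unfolding generated_submodule_eq by (rule closed_csubspace_closure_range[OF adjoint_D])

lemma D_in_N: "D f \<in> N"
  unfolding generated_submodule_eq by (rule subsetD[OF closure_subset rangeI])

text \<open>
  The complement of the closed range of \<open>\<theta>(z) - \<phi>(w)\<close> is the kernel of the adjoint.
\<close>

lemma orth_N_iff: "(\<forall>h\<in>N. cinner h g = 0) \<longleftrightarrow> Z' g = W' g"
proof
  assume "\<forall>h\<in>N. cinner h g = 0"
  then have "cinner f (Z' g - W' g) = 0" for f
    using D_in_N[of f] by (simp add: adjoint_pairD[OF adjoint_D, symmetric])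
  from this[of "Z' g - W' g"] show "Z' g = W' g"
    by (simp add: cinner_self_eq_0)
next
  assume "Z' g = W' g"
  then have "cinner (D f) g = 0" for f
    by (simp add: adjoint_pairD[OF adjoint_D])
  then show "\<forall>h\<in>N. cinner h g = 0"
    unfolding generated_submodule_eq by (intro ballI, elim cinner_closure_eq_0[rotated]) blast
qed

lemma N_invariant:
  assumes "adjoint_pair T T'" "\<And>f. norm (T f) = norm f" "\<And>f. T (D f) = D (T f)" "f \<in> N"
  shows "T f \<in> N"
  unfolding generated_submodule_eq
proof (rule closure_invariant[OF assms(1,2)])
  show "f \<in> closure (range D)"
    using assms(4) by (simp only: generated_submodule_eq)
  fix x assume "x \<in> range D"
  then obtain u where "x = D u" by blast
  then have "T x = D (T u)"
    by (simp only: assms(3))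
  then have "T x \<in> range D" by blast
  then show "T x \<in> closure (range D)"
    by (rule subsetD[OF closure_subset])
qed

text \<open>Multiplications commute with the operator \<open>\<theta>(z) - \<phi>(w)\<close>, of which \<open>N\<close> is the closed range.\<close>

lemma invariant_subspace_N:
  assumes "inner_function \<alpha>" "inner_function \<beta>"
  shows "invariant_subspace (zmult \<alpha>) (adj_on UNIV (zmult \<alpha>)) (wmult \<beta>) (adj_on UNIV (wmult \<beta>)) N"
proof -
  interpret ab: isometry_pair "zmult \<alpha>" "adj_on UNIV (zmult \<alpha>)" "wmult \<beta>" "adj_on UNIV (wmult \<beta>)"
    by (rule isometry_pair_inner[OF assms])
  have 1: "zmult \<alpha> (D f) = D (zmult \<alpha> f)" for f
    by (subst hardy2_eq_iff) (intro ballI, simp only: hfun_D hfun_zmult[OF assms(1)] mult.left_commute)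
  have 2: "wmult \<beta> (D f) = D (wmult \<beta> f)" for f
    by (subst hardy2_eq_iff) (intro ballI, simp only: hfun_D hfun_wmult[OF assms(2)] mult.left_commute)
  show ?thesis
  proof
    show "closed_csubspace N"
      by (rule closed_csubspace_N)
    show "zmult \<alpha> f \<in> N" if "f \<in> N" for f
      by (rule N_invariant[OF ab.adjA ab.norm_A 1 that])
    show "wmult \<beta> f \<in> N" if "f \<in> N" for f
      by (rule N_invariant[OF ab.adjB ab.norm_B 2 that])
  qed
qed

lemma mult_op_fst: "mult_op fst = zmult (\<lambda>z. z)" and mult_op_snd: "mult_op snd = wmult (\<lambda>w. w)"
  by (simp_all add: case_prod_unfold[abs_def])

lemma submodule_N: "submodule N"
proof -
  interpret zw: invariant_subspace "zmult (\<lambda>z. z)" "adj_on UNIV (zmult (\<lambda>z. z))"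
    "wmult (\<lambda>w. w)" "adj_on UNIV (wmult (\<lambda>w. w))" N
    by (rule invariant_subspace_N[OF inner_function_id inner_function_id])
  show ?thesis
    using zw.AM zw.BM closed_csubspace_N unfolding submodule_def closed_csubspace_def mult_op_fst mult_op_snd
    by blast
qed

end

section \<open>Transfer from the diagonal submodule\<close>

lemma cinner_powers_of_isometry:
  assumes T: "adjoint_pair T T'" and iso: "\<And>f. T' (T f) = f" and "T' x = 0" "T' y = 0"
  shows "cinner ((T ^^ i) x) ((T ^^ j) y) = (if i = j then cinner x y else 0)"
proof (induction i arbitrary: j)
  case 0
  show ?case
    by (cases j) (simp_all add: adjoint_pairD2[OF T, symmetric] assms)
next
  case (Suc i)
  show ?case
  proof (cases j)
    case 0
    then show ?thesis
      by (simp add: adjoint_pairD[OF T] assms)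
  next
    case (Suc j')
    then show ?thesis
      by (simp add: adjoint_pairD[OF T] iso Suc.IH)
  qed
qed

interpretation diag: inner_pair "\<lambda>z. z" "\<lambda>w. w"
  by unfold_locales (rule inner_function_id)+

lemma shift_monomial:
  "diag.Z (monomial (i, j)) = monomial (Suc i, j)"
  "diag.W (monomial (i, j)) = monomial (i, Suc j)"
  unfolding hardy2_eq_iff
  by (auto simp: hfun_zmult[OF inner_function_id] hfun_wmult[OF inner_function_id] hfun_monomial)

lemma hcoeff_shift:
  "hcoeff (diag.Z f) (Suc i, j) = hcoeff f (i, j)" "hcoeff (diag.Z f) (0, j) = 0"
  "hcoeff (diag.W f) (i, Suc j) = hcoeff f (i, j)" "hcoeff (diag.W f) (i, 0) = 0"
proof -
  show "hcoeff (diag.Z f) (Suc i, j) = hcoeff f (i, j)"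
    using adjoint_pairD[OF diag.adjA, of f "diag.Z (monomial (i, j))"] diag.isoA[of "monomial (i, j)"]
    by (simp add: shift_monomial)
  show "hcoeff (diag.W f) (i, Suc j) = hcoeff f (i, j)"
    using adjoint_pairD[OF diag.adjB, of f "diag.W (monomial (i, j))"] diag.isoB[of "monomial (i, j)"]
    by (simp add: shift_monomial)
  have "diag.Z' (monomial (0, j)) = 0"
  proof (intro hardy2_eqI ext)
    fix k :: "nat \<times> nat"
    show "hcoeff (diag.Z' (monomial (0, j))) k = hcoeff 0 k"
      using adjoint_pairD2[OF diag.adjA, of "monomial (0, j)" "monomial k"]
      by (cases k) (simp add: shift_monomial hcoeff_monomial)
  qed
  then show "hcoeff (diag.Z f) (0, j) = 0"
    using adjoint_pairD[OF diag.adjA, of f "monomial (0, j)"] by simp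
  have "diag.W' (monomial (i, 0)) = 0"
  proof (intro hardy2_eqI ext)
    fix k :: "nat \<times> nat"
    show "hcoeff (diag.W' (monomial (i, 0))) k = hcoeff 0 k"
      using adjoint_pairD2[OF diag.adjB, of "monomial (i, 0)" "monomial k"]
      by (cases k) (simp add: shift_monomial hcoeff_monomial)
  qed
  then show "hcoeff (diag.W f) (i, 0) = 0"
    using adjoint_pairD[OF diag.adjB, of f "monomial (i, 0)"] by simp
qed

locale nonconstant_inner_pair = inner_pair +
  assumes \<theta>_nc: "\<not> \<theta> constant_on ball 0 1" and \<phi>_nc: "\<not> \<phi> constant_on ball 0 1"
begin

definition \<Theta> where "\<Theta> p = (\<theta> (fst p), \<phi> (snd p))"

lemma \<Theta>_bidisk: "p \<in> bidisk \<Longrightarrow> \<Theta> p \<in> bidisk"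
  using inner_function_lt_1[OF \<theta> \<theta>_nc, of "fst p"] inner_function_lt_1[OF \<phi> \<phi>_nc, of "snd p"]
  by (auto simp: \<Theta>_def bidisk_def)

text \<open>
  \<open>V l f = l \<cdot> f(\<theta>(z), \<phi>(w))\<close>. The vectors \<open>u l k\<close> are the intended images of the monomials. If they are
  orthonormal, Bessel's inequality defines the adjoint of \<open>V\<close> on the whole space, and \<open>V\<close> is obtained
  as the adjoint of this contraction.
\<close>

definition u where "u l k = (Z ^^ fst k) ((W ^^ snd k) l)"

definition Vadj where "Vadj l f = of_coeffs (\<lambda>k. cinner f (u l k))"

definition V where "V l = adj_on UNIV (Vadj l)"

lemma hfun_u: "p \<in> bidisk \<Longrightarrow> hfun (u l k) p = fst (\<Theta> p) ^ fst k * snd (\<Theta> p) ^ snd k * hfun l p"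
proof -
  assume p: "p \<in> bidisk"
  have "hfun ((Z ^^ i) f) p = \<theta> (fst p) ^ i * hfun f p" for i f
    by (induction i) (simp_all add: hfun_zmult[OF \<theta> p])
  moreover have "hfun ((W ^^ i) f) p = \<phi> (snd p) ^ i * hfun f p" for i f
    by (induction i) (simp_all add: hfun_wmult[OF \<phi> p])
  ultimately show ?thesis
    by (simp add: u_def \<Theta>_def)
qed

context
  fixes l :: hardy2
  assumes l: "Z' l = 0" "W' l = 0" "norm l = 1"
begin

lemma u_orthonormal: "cinner (u l k) (u l k') = (if k = k' then 1 else 0)"
proof -
  have "Z' ((W ^^ j) l) = 0" for j
    using pow_B_A'[of j l] adjoint_pair_map_zero[OF adj_pow_B] by (simp add: l)
  then show ?thesis
    unfolding u_def
    by (simp add: cinner_powers_of_isometry[OF adjA isoA] cinner_powers_of_isometry[OF adjB isoB] l cinner_self prod_eq_iff)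
qed

lemma Vadj_bessel: "finite F \<Longrightarrow> (\<Sum>k\<in>F. (cmod (cinner f (u l k)))\<^sup>2) \<le> (norm f)\<^sup>2"
proof -
  assume F: "finite F"
  have inj: "inj (u l)"
    by (rule injI) (metis u_orthonormal zero_neq_one)
  have "norm (u l k) = 1" for k
    using u_orthonormal[of k k] unfolding cinner_self by (simp add: abs_square_eq_1 del: of_real_power)
  then have "(\<Sum>e\<in>u l ` F. (cmod (cinner f e))\<^sup>2) \<le> (norm f)\<^sup>2"
    using F by (intro bessel) (auto simp: u_orthonormal)
  then show ?thesis
    by (subst (asm) sum.reindex) (use inj in \<open>auto simp: inj_on_def o_def\<close>)
qed

lemma hcoeff_Vadj: "hcoeff (Vadj l f) k = cinner f (u l k)"
  unfolding Vadj_def by (subst hcoeff_of_coeffs[OF sq_summable_finite_bound(1)[OF Vadj_bessel]]) simp_all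

lemma adjoint_V: "adjoint_pair (V l) (Vadj l)"
proof -
  have "bounded_linear (Vadj l)"
  proof (rule bounded_linear_intro[where K = 1])
    show "norm (Vadj l f) \<le> norm f * 1" for f
      by (simp, rule norm_le_of_coeff_sums) (simp_all add: hcoeff_Vadj Vadj_bessel)
  qed (auto intro!: hardy2_eqI simp: fun_eq_iff hcoeff_Vadj cinner_simps simp flip: scaleC_of_real)
  then have "\<exists>T'. adjoint_pair (Vadj l) T'"
    by (rule ex_adjoint) (auto intro!: hardy2_eqI simp: fun_eq_iff hcoeff_Vadj cinner_simps)
  then show ?thesis
    unfolding V_def using adjoint_pair_adj_on adjoint_pair_sym by blast
qed

lemma V_monomial: "V l (monomial k) = u l k"
proof (rule cinner_eqI)
  fix h
  show "cinner (V l (monomial k)) h = cinner (u l k) h"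
    using cinner_commute[of h "u l k"] by (simp add: adjoint_pairD[OF adjoint_V] cinner_monomial_left hcoeff_Vadj)
qed

lemma Vadj_V: "Vadj l (V l f) = f"
proof -
  have "(\<lambda>f. Vadj l (V l f)) = (\<lambda>f. f)"
    by (rule adjoint_pair_eq_monomial[OF adjoint_pair_comp[OF adjoint_pair_sym[OF adjoint_V] adjoint_V] adjoint_pair_id])
      (auto intro!: hardy2_eqI simp: fun_eq_iff hcoeff_Vadj V_monomial u_orthonormal hcoeff_monomial)
  then show ?thesis by (simp add: fun_eq_iff)
qed

lemma norm_V [simp]: "norm (V l f) = norm f"
proof -
  have "cinner (V l f) (V l f) = cinner f f"
    by (simp add: adjoint_pairD[OF adjoint_V] Vadj_V)
  then show ?thesis
    unfolding cinner_self of_real_eq_iff by (simp add: power2_eq_iff_nonneg)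
qed

lemma Vadj_szego:
  assumes "p \<in> bidisk"
  shows "Vadj l (szego p) = scaleC (cnj (hfun l p)) (szego (\<Theta> p))"
proof (intro hardy2_eqI ext)
  fix k :: "nat \<times> nat"
  have "hcoeff (Vadj l (szego p)) k = cnj (hfun (u l k) p)"
    unfolding hcoeff_Vadj cinner_szego[OF assms, symmetric] by (rule cinner_commute)
  then show "hcoeff (Vadj l (szego p)) k = hcoeff (scaleC (cnj (hfun l p)) (szego (\<Theta> p))) k"
    using hcoeff_szego[OF \<Theta>_bidisk[OF assms], of "fst k" "snd k"] by (simp add: hfun_u[OF assms])
qed

lemma hfun_V:
  assumes "p \<in> bidisk"
  shows "hfun (V l f) p = hfun l p * hfun f (\<Theta> p)"
proof -
  have "hfun (V l f) p = cinner f (Vadj l (szego p))"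
    by (simp add: cinner_szego[OF assms, symmetric] adjoint_pairD[OF adjoint_V])
  then show ?thesis
    by (simp add: Vadj_szego[OF assms] cinner_simps cinner_szego \<Theta>_bidisk[OF assms])
qed

lemma V_Z: "V l (diag.Z f) = Z (V l f)" and V_W: "V l (diag.W f) = W (V l f)"
  unfolding hardy2_eq_iff
  by (auto simp: hfun_V hfun_zmult[OF inner_function_id] hfun_wmult[OF inner_function_id]
      hfun_zmult[OF \<theta>] hfun_wmult[OF \<phi>] \<Theta>_bidisk) (simp_all add: \<Theta>_def)

text \<open>
  These relations hold because the wandering vector \<open>l\<close> is annihilated by both adjoints: it makes
  \<open>Z'\<close> and \<open>W'\<close> shift the vectors \<open>u l k\<close> down in the way the coordinate adjoints shift the monomials.
\<close>

lemma Z'_V: "Z' (V l f) = V l (diag.Z' f)" and W'_V: "W' (V l f) = V l (diag.W' f)"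
proof -
  have Z0: "Z' ((W ^^ j) l) = 0" for j
    using pow_B_A'[of j l] adjoint_pair_map_zero[OF adj_pow_B] by (simp add: l)
  have W0: "W' ((Z ^^ i) l) = 0" for i
    using isometry_pair.pow_B_A'[OF isometry_pair_swap, of i l]
      adjoint_pair_map_zero[OF isometry_pair.adj_pow_B[OF isometry_pair_swap]] by (simp add: l)
  have comm_pow: "(Z ^^ i) ((W ^^ j) x) = (W ^^ j) ((Z ^^ i) x)" for i j x
    by (induction i) (simp_all add: pow_B_A)
  have "Vadj l (Z g) = diag.Z (Vadj l g)" for g
  proof (intro hardy2_eqI ext)
    fix k :: "nat \<times> nat"
    obtain i j where k: "k = (i, j)" by force
    show "hcoeff (Vadj l (Z g)) k = hcoeff (diag.Z (Vadj l g)) k"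
      by (cases i) (simp_all add: k hcoeff_Vadj hcoeff_shift u_def adjoint_pairD[OF adjA] isoA Z0)
  qed
  then show "Z' (V l f) = V l (diag.Z' f)"
    by (intro cinner_eqI) (simp add: adjoint_pairD[OF adjoint_V] adjoint_pairD2[OF adjA] adjoint_pairD2[OF diag.adjA])
  have "Vadj l (W g) = diag.W (Vadj l g)" for g
  proof (intro hardy2_eqI ext)
    fix k :: "nat \<times> nat"
    obtain i j where k: "k = (i, j)" by force
    have u: "u l (i, j) = (W ^^ j) ((Z ^^ i) l)" for i j
      by (simp add: u_def comm_pow del: funpow.simps)
    show "hcoeff (Vadj l (W g)) k = hcoeff (diag.W (Vadj l g)) k"
      by (cases j) (simp_all add: k hcoeff_Vadj hcoeff_shift u adjoint_pairD[OF adjB] isoB W0)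
  qed
  then show "W' (V l f) = V l (diag.W' f)"
    by (intro cinner_eqI) (simp add: adjoint_pairD[OF adjoint_V] adjoint_pairD2[OF adjB] adjoint_pairD2[OF diag.adjB])
qed

text \<open>
  \<open>V\<close> maps the diagonal submodule into \<open>N\<close> by the intertwining relations, and the complement into the
  complement by those for the adjoints.
\<close>

lemma V_orth_proj: "orth_proj N (V l f) = V l (orth_proj diag.N f)"
proof (rule orth_proj_unique[OF closed_csubspace_N])
  have "V l g \<in> N" if "g \<in> diag.N" for g
    unfolding generated_submodule_eq
  proof (rule closure_invariant[OF adjoint_V norm_V])
    show "g \<in> closure (range diag.D)"
      using that by (simp only: diag.generated_submodule_eq)
    fix x assume "x \<in> range diag.D"
    then obtain y where "x = diag.D y" by blast
    then have "V l x = D (V l y)"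
      by (simp add: D_def diag.D_def adjoint_pair_map_diff[OF adjoint_V] V_Z V_W)
    then show "V l x \<in> closure (range D)"
      by (simp add: subsetD[OF closure_subset])
  qed
  then show "V l (orth_proj diag.N f) \<in> N"
    by (simp add: orth_proj_in[OF diag.closed_csubspace_N])
  define g where "g = f - orth_proj diag.N f"
  have "cinner h g = 0" if "h \<in> diag.N" for h
    using orth_proj_orth[OF diag.closed_csubspace_N that, of f] cinner_commute[of h g] by (simp add: g_def)
  then have "diag.Z' g = diag.W' g"
    using diag.orth_N_iff[of g] by blast
  then have "Z' (V l g) = W' (V l g)"
    by (simp add: Z'_V W'_V)
  then have "\<forall>h\<in>N. cinner h (V l g) = 0"
    using orth_N_iff[of "V l g"] by blast
  then show "cinner (V l f - V l (orth_proj diag.N f)) h = 0" if "h \<in> N" for h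
    using that cinner_commute[of "V l g" h] by (simp add: g_def adjoint_pair_map_diff[OF adjoint_V])
qed

end

text \<open>
  The reproducing kernel of the wandering subspace \<open>ker Z' \<inter> ker W'\<close>, which is the tensor product of
  the model spaces of \<open>\<theta>\<close> and \<open>\<phi>\<close>.
\<close>

definition L where
  "L p = (let x = szego p - scaleC (cnj (\<phi> (snd p))) (W (szego p)) in x - scaleC (cnj (\<theta> (fst p))) (Z x))"

lemma L_eq_defect:
  assumes "p \<in> bidisk"
  shows "L p = szego p - Z (Z' (szego p)) - W (W' (szego p - Z (Z' (szego p))))"
  by (simp add: L_def Let_def adj_zmult_szego[OF \<theta> assms] adj_wmult_szego[OF \<phi> assms] linA linB linB' linA' dcomm' comm
      scaleC_diff_right mult_ac)

lemma L_wandering: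
  assumes "p \<in> bidisk"
  shows "Z' (L p) = 0" "W' (L p) = 0"
  by (simp_all add: L_def Let_def linA linB linA' linB' isoA isoB dcomm dcomm'
      adj_zmult_szego[OF \<theta> assms] adj_wmult_szego[OF \<phi> assms] scaleC_diff_right mult_ac)

lemma hfun_L:
  assumes "p \<in> bidisk" "q \<in> bidisk"
  shows "hfun (L p) q = (1 - \<theta> (fst q) * cnj (\<theta> (fst p))) * (1 - \<phi> (snd q) * cnj (\<phi> (snd p))) * hfun (szego p) q"
  using assms by (simp add: L_def Let_def hfun_diff hfun_scaleC hfun_zmult[OF \<theta>] hfun_wmult[OF \<phi>]) (simp add: algebra_simps)

lemma L_nonzero: 
  assumes p: "p \<in> bidisk"
  shows "L p \<noteq> 0"
proof
  assume "L p = 0"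
  then have "hfun (L p) p = 0"
    by (simp add: zero_hardy2.rep_eq)
  moreover have "1 - \<theta> (fst p) * cnj (\<theta> (fst p)) \<noteq> 0" "1 - \<phi> (snd p) * cnj (\<phi> (snd p)) \<noteq> 0"
    using \<Theta>_bidisk[OF p] one_minus_mult_cnj_nonzero[of "\<theta> (fst p)" "\<theta> (fst p)"]
      one_minus_mult_cnj_nonzero[of "\<phi> (snd p)" "\<phi> (snd p)"] by (simp_all add: \<Theta>_def bidisk_def)
  ultimately show False
    using hfun_szego_nonzero[OF p p] by (simp add: hfun_L[OF p p])
qed

definition l where "l p = scaleC (of_real (inverse (norm (L p)))) (L p)"

lemma l_wandering:
  assumes "p \<in> bidisk"
  shows "Z' (l p) = 0" "W' (l p) = 0" "norm (l p) = 1"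
  using L_nonzero[OF assms] L_wandering[OF assms] by (simp_all add: l_def linA' linB' norm_inverse)

lemma norm_L_sq:
  assumes p: "p \<in> bidisk"
  shows "of_real ((norm (L p))\<^sup>2) = hfun (L p) p"
proof -
  define x where "x = szego p - scaleC (cnj (\<phi> (snd p))) (W (szego p))"
  have "cinner (L p) (L p) = cinner (L p) (x - scaleC (cnj (\<theta> (fst p))) (Z x))"
    by (simp add: L_def Let_def x_def)
  also have "\<dots> = cinner (L p) (szego p)"
    by (simp add: x_def cinner_simps linA linA' linB' adjoint_pairD2[OF adjA, symmetric] adjoint_pairD2[OF adjB, symmetric] L_wandering[OF p])
  finally show ?thesis
    by (simp only: cinner_self cinner_szego[OF p])
qed

text \<open>
  The reproducing kernel of the submodule. The Szego kernel at \<open>p\<close> is, up to the norm of \<open>L p\<close>, the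
  image under \<open>V (l p)\<close> of the Szego kernel at \<open>\<Theta> p\<close>, and \<open>V\<close> intertwines the projections.
\<close>

lemma orth_proj_szego:
  assumes p: "p \<in> bidisk" and q: "q \<in> bidisk"
  shows "hfun (orth_proj N (szego p)) q = hfun (L p) q * hfun (orth_proj diag.N (szego (\<Theta> p))) (\<Theta> q)"
proof -
  note lw = l_wandering[OF p]
  define t where "t = complex_of_real (norm (L p))"
  have t: "t \<noteq> 0"
    using L_nonzero[OF p] by (simp add: t_def)
  have L: "L p = scaleC t (l p)"
    using t by (simp add: l_def t_def)
  \<comment> \<open>The factors of \<open>L p\<close> cancel the denominators of the Szego kernel at \<open>\<Theta> p\<close>.\<close>
  have "szego p = scaleC t (V (l p) (szego (\<Theta> p)))"
    unfolding hardy2_eq_iff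
  proof
    fix q assume q: "q \<in> bidisk"
    have nz: "1 - \<theta> (fst q) * cnj (\<theta> (fst p)) \<noteq> 0" "1 - \<phi> (snd q) * cnj (\<phi> (snd p)) \<noteq> 0"
      using \<Theta>_bidisk[OF p] \<Theta>_bidisk[OF q] one_minus_mult_cnj_nonzero[of "\<theta> (fst q)" "\<theta> (fst p)"]
        one_minus_mult_cnj_nonzero[of "\<phi> (snd q)" "\<phi> (snd p)"] by (simp_all add: \<Theta>_def bidisk_def)
    have "hfun (scaleC t (V (l p) (szego (\<Theta> p)))) q = hfun (L p) q * hfun (szego (\<Theta> p)) (\<Theta> q)"
      by (simp add: L hfun_scaleC hfun_V[OF lw q])
    also have "\<dots> = hfun (szego p) q"
      using nz by (simp add: hfun_L[OF p q] hfun_szego[OF \<Theta>_bidisk[OF p] \<Theta>_bidisk[OF q]]) (simp add: \<Theta>_def)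
    finally show "hfun (szego p) q = hfun (scaleC t (V (l p) (szego (\<Theta> p)))) q" by simp
  qed
  then have "orth_proj N (szego p) = scaleC t (V (l p) (orth_proj diag.N (szego (\<Theta> p))))"
    by (simp add: adjoint_pair_map_scale[OF adjoint_pair_orth_proj[OF closed_csubspace_N]] V_orth_proj[OF lw])
  then show ?thesis
    by (simp add: hfun_scaleC hfun_V[OF lw q] L)
qed

end

text \<open>The Szego kernels are eigenvectors of the adjoints of \<open>\<alpha>(z)\<close> and \<open>\<beta>(w)\<close>.\<close>

lemma (in inner_pair) hfun_core_szego:
  assumes \<alpha>: "inner_function \<alpha>" and \<beta>: "inner_function \<beta>" and p: "p \<in> bidisk" and q: "q \<in> bidisk"
  shows "hfun (invariant_subspace.C (zmult \<alpha>) (adj_on UNIV (zmult \<alpha>)) (wmult \<beta>) (adj_on UNIV (wmult \<beta>)) N (szego p)) q =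
    (1 - \<alpha> (fst q) * cnj (\<alpha> (fst p))) * (1 - \<beta> (snd q) * cnj (\<beta> (snd p))) * hfun (orth_proj N (szego p)) q"
proof -
  interpret ab: invariant_subspace "zmult \<alpha>" "adj_on UNIV (zmult \<alpha>)" "wmult \<beta>" "adj_on UNIV (wmult \<beta>)" N
    by (rule invariant_subspace_N[OF \<alpha> \<beta>])
  show ?thesis
    using q by (simp add: ab.C_def adj_zmult_szego[OF \<alpha> p] adj_wmult_szego[OF \<beta> p] ab.linA' ab.linP ab.linA ab.linB
      hfun_add hfun_diff hfun_scaleC hfun_zmult[OF \<alpha>] hfun_wmult[OF \<beta>] algebra_simps)
qed

section \<open>The orthogonal complement of the diagonal submodule\<close>

lemma infsum_ennreal_diagonals:
  fixes f :: "nat \<times> nat \<Rightarrow> ennreal"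
  shows "infsum f UNIV = (\<Sum>\<^sub>\<infinity>n. \<Sum>i\<le>n. f (i, n - i))"
proof -
  have "infsum f UNIV = (\<Sum>\<^sub>\<infinity>k. \<Sum>\<^sub>\<infinity>n. if n = fst k + snd k then f k else 0)"
  proof (rule infsum_cong)
    fix k :: "nat \<times> nat"
    have "(\<Sum>\<^sub>\<infinity>n. if n = fst k + snd k then f k else 0) = (\<Sum>\<^sub>\<infinity>n\<in>{fst k + snd k}. f k)"
      by (rule infsum_cong_neutral) auto
    then show "f k = (\<Sum>\<^sub>\<infinity>n. if n = fst k + snd k then f k else 0)" by simp
  qed
  also have "\<dots> = (\<Sum>\<^sub>\<infinity>n. \<Sum>\<^sub>\<infinity>k. if n = fst k + snd k then f k else 0)"
    by (rule infsum_ennreal_swap)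
  also have "\<dots> = (\<Sum>\<^sub>\<infinity>n. \<Sum>i\<le>n. f (i, n - i))"
  proof (rule infsum_cong)
    fix n :: nat
    have "(\<Sum>\<^sub>\<infinity>k. if n = fst k + snd k then f k else 0) = (\<Sum>\<^sub>\<infinity>k\<in>(\<lambda>i. (i, n - i)) ` {..n}. f k)"
      by (rule infsum_cong_neutral) (auto simp: image_iff)
    also have "\<dots> = (\<Sum>i\<le>n. f (i, n - i))"
      by (simp add: sum.reindex inj_on_def)
    finally show "(\<Sum>\<^sub>\<infinity>k. if n = fst k + snd k then f k else 0) = (\<Sum>i\<le>n. f (i, n - i))" .
  qed
  finally show ?thesis .
qed

lemma adjoint_pair_map_sum: "adjoint_pair T T' \<Longrightarrow> T (sum f A) = (\<Sum>x\<in>A. T (f x))"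
  by (induction A rule: infinite_finite_induct) (auto simp: adjoint_pair_map_zero adjoint_pair_map_add)

lemma adj_shift_monomial:
  "diag.Z' (monomial (Suc i, j)) = monomial (i, j)" "diag.Z' (monomial (0, j)) = 0"
  "diag.W' (monomial (i, Suc j)) = monomial (i, j)" "diag.W' (monomial (i, 0)) = 0"
proof -
  show "diag.Z' (monomial (Suc i, j)) = monomial (i, j)" "diag.W' (monomial (i, Suc j)) = monomial (i, j)"
    by (simp_all only: shift_monomial[symmetric] diag.isoA diag.isoB)
  have "hcoeff (diag.Z' (monomial (0, j))) k = 0" "hcoeff (diag.W' (monomial (i, 0))) k = 0" for k
    using adjoint_pairD2[OF diag.adjA, of "monomial (0, j)" "monomial k"]
      adjoint_pairD2[OF diag.adjB, of "monomial (i, 0)" "monomial k"]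
    by (simp_all add: cinner_monomial_left hcoeff_shift)
  then show "diag.Z' (monomial (0, j)) = 0" "diag.W' (monomial (i, 0)) = 0"
    by (auto intro!: hardy2_eqI simp: fun_eq_iff)
qed

text \<open>
  The homogeneous polynomials \<open>(z\<^bsup>n+1\<^esup> - w\<^bsup>n+1\<^esup>) / (z - w)\<close>, whose closed span is the complement of \<open>[z - w]\<close>.
\<close>

definition hsum :: "nat \<Rightarrow> hardy2" where
  "hsum n = (\<Sum>i\<le>n. monomial (i, n - i))"

lemma adj_Z_hsum: "diag.Z' (hsum 0) = 0" "diag.Z' (hsum (Suc n)) = hsum n"
  by (simp_all add: hsum_def adj_shift_monomial adjoint_pair_map_sum[OF adjoint_pair_sym[OF diag.adjA]]
      sum.atMost_Suc_shift diag.linA' del: sum.atMost_Suc)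

lemma adj_W_hsum: "diag.W' (hsum 0) = 0" "diag.W' (hsum (Suc n)) = hsum n"
  by (simp_all add: hsum_def adj_shift_monomial adjoint_pair_map_sum[OF adjoint_pair_sym[OF diag.adjB]]
      Suc_diff_le diag.linB')

definition diag_basis :: "nat \<Rightarrow> hardy2" where
  "diag_basis n = scaleC (of_real (inverse (sqrt (real n + 1)))) (hsum n)"

abbreviation P where "P \<equiv> orth_proj diag.N"

lemmas adjoint_P = adjoint_pair_orth_proj[OF diag.closed_csubspace_N]

lemma P_eq_0_iff: "P g = 0 \<longleftrightarrow> diag.Z' g = diag.W' g"
proof
  assume "P g = 0"
  then have "cinner h g = 0" if "h \<in> diag.N" for h
    using orth_proj_cinner_right[OF diag.closed_csubspace_N that, of g] by simp
  then show "diag.Z' g = diag.W' g"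
    using diag.orth_N_iff by blast
next
  assume "diag.Z' g = diag.W' g"
  then have "\<forall>h\<in>diag.N. cinner h g = 0"
    using diag.orth_N_iff by blast
  then show "P g = 0"
    by (intro orth_proj_eq_0[OF diag.closed_csubspace_N]) (metis cinner_commute complex_cnj_zero)
qed

lemma P_complement: "P (f - P f) = 0"
  by (simp add: adjoint_pair_map_diff[OF adjoint_P] orth_proj_eq[OF diag.closed_csubspace_N orth_proj_in[OF diag.closed_csubspace_N]])

lemma P_diag_basis: "P (diag_basis n) = 0"
  by (cases n) (simp_all add: P_eq_0_iff diag_basis_def diag.linA' diag.linB' adj_Z_hsum adj_W_hsum)

lemma cinner_complement: "P g = 0 \<Longrightarrow> cinner (f - P f) g = cinner f g"
  by (simp add: cinner_simps adjoint_pairD[OF adjoint_P])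

lemma cinner_diag_basis: "cinner f (diag_basis n) = of_real (inverse (sqrt (real n + 1))) * (\<Sum>i\<le>n. hcoeff f (i, n - i))"
  by (simp add: diag_basis_def hsum_def cinner_simps cinner_sum_right)

text \<open>
  Agreement of the two adjoint shifts on \<open>g\<close> means that the coefficients of \<open>g\<close> are constant along each
  diagonal \<open>i + j = n\<close>, and pairing \<open>g\<close> with \<open>hsum n\<close> sums the coefficients on that diagonal.
\<close>

lemma complement_parseval:
  assumes "P g = 0"
  shows "(\<Sum>\<^sub>\<infinity>n. ennreal ((cmod (cinner g (diag_basis n)))\<^sup>2)) = ennreal ((norm g)\<^sup>2)"
proof -
  have "diag.Z' g = diag.W' g"
    using assms by (simp add: P_eq_0_iff)
  then have shift: "hcoeff g (Suc i, j) = hcoeff g (i, Suc j)" for i j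
    using adjoint_pairD2[OF diag.adjA, of g "monomial (i, j)"] adjoint_pairD2[OF diag.adjB, of g "monomial (i, j)"]
    by (simp add: shift_monomial)
  have diag: "hcoeff g (i, j) = hcoeff g (0, i + j)" for i j
    by (induction i arbitrary: j) (simp_all add: shift)
  have "(cmod (cinner g (diag_basis n)))\<^sup>2 = (\<Sum>i\<le>n. (cmod (hcoeff g (i, n - i)))\<^sup>2)" for n
  proof -
    have eq: "hcoeff g (i, n - i) = hcoeff g (0, n)" if "i \<le> n" for i
      using diag[of i "n - i"] that by simp
    have "(\<Sum>i\<le>n. hcoeff g (i, n - i)) = of_real (real n + 1) * hcoeff g (0, n)"
      by (simp add: eq)
    then have "cmod (cinner g (diag_basis n)) = inverse (sqrt (real n + 1)) * (real n + 1) * cmod (hcoeff g (0, n))"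
      by (simp add: cinner_diag_basis norm_mult norm_inverse del: of_real_add of_real_of_nat_eq)
    then have "(cmod (cinner g (diag_basis n)))\<^sup>2 = (real n + 1) * (cmod (hcoeff g (0, n)))\<^sup>2"
      by (simp add: power_mult_distrib power_inverse) (simp add: power2_eq_square field_simps)
    also have "\<dots> = (\<Sum>i\<le>n. (cmod (hcoeff g (i, n - i)))\<^sup>2)"
      by (simp add: eq)
    finally show ?thesis .
  qed
  then have "(\<Sum>\<^sub>\<infinity>n. ennreal ((cmod (cinner g (diag_basis n)))\<^sup>2)) = (\<Sum>\<^sub>\<infinity>k. ennreal ((cmod (hcoeff g k))\<^sup>2))"
    by (simp add: infsum_ennreal_diagonals)
  then show ?thesis
    by (simp add: infsum_hcoeff_sq)
qed

lemma norm_complement_sq: "ennreal ((norm (f - P f))\<^sup>2) = (\<Sum>\<^sub>\<infinity>n. ennreal ((cmod (cinner f (diag_basis n)))\<^sup>2))"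
  using complement_parseval[OF P_complement[of f]] by (simp add: cinner_complement P_diag_basis)

lemma norm_complement_monomial: "(norm (monomial (i, j) - P (monomial (i, j))))\<^sup>2 = inverse (real (i + j) + 1)"
proof -
  have "(\<Sum>m\<le>n. hcoeff (monomial (i, j)) (m, n - m)) = (if n = i + j then 1 else 0)" for n
  proof -
    have "(\<Sum>m\<le>n. hcoeff (monomial (i, j)) (m, n - m)) = (\<Sum>m\<le>n. if m = i then (if n = i + j then 1 else 0) else 0)"
      by (intro sum.cong) (auto simp: hcoeff_monomial)
    then show ?thesis by simp
  qed
  then have "ennreal ((norm (monomial (i, j) - P (monomial (i, j))))\<^sup>2) =
      (\<Sum>\<^sub>\<infinity>n. ennreal ((cmod (of_real (inverse (sqrt (real n + 1))) * (if n = i + j then 1 else 0)))\<^sup>2))"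
    by (simp add: norm_complement_sq cinner_diag_basis)
  also have "\<dots> = (\<Sum>\<^sub>\<infinity>n\<in>{i + j}. ennreal (inverse (real n + 1)))"
    by (rule infsum_cong_neutral) (auto simp: norm_inverse power_inverse simp del: of_real_add of_real_of_nat_eq)
  finally show ?thesis by simp
qed

text \<open>
  The component of \<open>z\<^sup>i w\<^sup>j\<close> in the complement has squared norm \<open>1 / (i + j + 1)\<close>, so convergence holds on
  the monomials.
\<close>

lemma complement_shift_tendsto_0: "(\<lambda>n. (diag.W ^^ n) f - P ((diag.W ^^ n) f)) \<longlonglongrightarrow> 0"
proof (rule contractions_tendsto_zero[where X = "range monomial"])
  show "adjoint_pair (\<lambda>f. (diag.W ^^ n) f - P ((diag.W ^^ n) f)) (\<lambda>f. (diag.W' ^^ n) (f - P f))" for n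
    by (rule adjoint_pair_comp[OF adjoint_pair_diff[OF adjoint_pair_id adjoint_P] diag.adj_pow_B])
  show "norm ((diag.W ^^ n) f - P ((diag.W ^^ n) f)) \<le> norm f" for n f
    by (rule power2_le_imp_le)
      (use norm_orth_proj_sq[OF diag.closed_csubspace_N, of "(diag.W ^^ n) f"] in auto)
  show "\<And>f. (\<And>x. x \<in> range monomial \<Longrightarrow> cinner f x = 0) \<Longrightarrow> f = 0"
    by (rule monomial_total)
  fix x assume "x \<in> range monomial"
  then obtain k where "x = monomial k" by blast
  then obtain i j where x: "x = monomial (i, j)" by (cases k) blast
  have pow: "(diag.W ^^ n) x = monomial (i, j + n)" for n
    by (induction n) (simp_all add: x shift_monomial)
  have "(\<lambda>n. inverse (real (i + (j + n)) + 1)) \<longlonglongrightarrow> 0"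
    by real_asymp
  then have "(\<lambda>n. sqrt ((norm ((diag.W ^^ n) x - P ((diag.W ^^ n) x)))\<^sup>2)) \<longlonglongrightarrow> sqrt 0"
    by (intro tendsto_real_sqrt) (simp only: pow norm_complement_monomial)
  then show "(\<lambda>n. (diag.W ^^ n) x - P ((diag.W ^^ n) x)) \<longlonglongrightarrow> 0"
    by (intro tendsto_norm_zero_cancel[where f = "\<lambda>n. (diag.W ^^ n) x - P ((diag.W ^^ n) x)"]) simp
qed

text \<open>
  Here \<open>T\<close> is one of the two coordinate shifts. Its compression to the complement is the Bergman shift,
  which takes the component along \<open>diag_basis m\<close> to the next one with the factor \<open>(m + 1) / (m + 2)\<close> in
  squared norm. What is lost lies in the submodule.
\<close>

lemma norm_P_shift_sq:
  assumes T: "adjoint_pair T T'" "\<And>f. norm (T f) = norm f" and H: "T' (hsum 0) = 0" "\<And>n. T' (hsum (Suc n)) = hsum n"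
    and g: "P g = 0"
  shows "ennreal ((norm (P (T g)))\<^sup>2) = (\<Sum>\<^sub>\<infinity>m. ennreal (inverse (real m + 2) * (cmod (cinner g (diag_basis m)))\<^sup>2))"
proof -
  define x where "x m = (cmod (cinner g (diag_basis m)))\<^sup>2" for m
  have x: "(x has_sum (norm g)\<^sup>2) UNIV"
    using complement_parseval[OF g] by (intro has_sum_real_ennreal) (simp_all add: x_def)
  have T0: "cinner (T g) (diag_basis 0) = 0"
    by (simp add: diag_basis_def cinner_simps adjoint_pairD[OF T(1)] H)
  have TS: "(cmod (cinner (T g) (diag_basis (Suc m))))\<^sup>2 = x m * ((real m + 1) / (real m + 2))" for m
  proof -
    have "(cmod (cinner (T g) (diag_basis (Suc m))))\<^sup>2 = (cmod (cinner g (hsum m)))\<^sup>2 / (real m + 2)"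
      by (simp add: diag_basis_def cinner_simps adjoint_pairD[OF T(1)] H norm_mult norm_inverse norm_divide
          power_mult_distrib power_inverse power_divide divide_inverse add.commute
          del: of_real_add of_real_of_nat_eq of_real_inverse)
    moreover have "x m = (cmod (cinner g (hsum m)))\<^sup>2 / (real m + 1)"
      by (simp add: x_def diag_basis_def cinner_simps norm_mult norm_inverse norm_divide
          power_mult_distrib power_inverse power_divide divide_inverse add.commute
          del: of_real_add of_real_of_nat_eq of_real_inverse)
    ultimately show ?thesis
      by (simp add: field_simps)
  qed
  have "ennreal ((norm (T g - P (T g)))\<^sup>2) = (\<Sum>\<^sub>\<infinity>m. ennreal (x m * ((real m + 1) / (real m + 2))))"
    unfolding norm_complement_sq by (subst infsum_ennreal_Suc) (simp add: T0 TS)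
  then have y: "((\<lambda>m. x m * ((real m + 1) / (real m + 2))) has_sum (norm (T g - P (T g)))\<^sup>2) UNIV"
    by (intro has_sum_real_ennreal) (simp_all add: x_def)
  have "(norm (P (T g)))\<^sup>2 = (norm g)\<^sup>2 + - 1 * (norm (T g - P (T g)))\<^sup>2"
    using norm_orth_proj_sq[OF diag.closed_csubspace_N, of "T g"] by (simp add: T)
  moreover have "x m + - 1 * (x m * ((real m + 1) / (real m + 2))) = inverse (real m + 2) * x m" for m
    by (simp add: field_simps)
  ultimately have "((\<lambda>m. inverse (real m + 2) * x m) has_sum (norm (P (T g)))\<^sup>2) UNIV"
    using has_sum_add[OF x has_sum_cmult_right[OF y, of "- 1"]] by (simp only:)
  from infsum_ennreal_has_sum[OF this] show ?thesis
    by (simp add: x_def)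
qed

section \<open>Invariance of the diagonal submodule under disk automorphisms\<close>

lemma one_minus_cnj_mult_nonzero: "norm a < 1 \<Longrightarrow> norm b < 1 \<Longrightarrow> 1 - cnj a * b \<noteq> 0" for a b :: complex
  using one_minus_mult_cnj_nonzero[of b a] by (simp add: mult.commute)

lemma disk_automorphism_involution:
  assumes "norm a < 1" "norm x < 1"
  shows "disk_automorphism a (disk_automorphism a x) = x"
proof -
  define d where "d = 1 - cnj a * x"
  have nz: "d \<noteq> 0" "1 - a * cnj a \<noteq> 0"
    using one_minus_cnj_mult_nonzero[of a x] one_minus_mult_cnj_nonzero[of a a] assms by (simp_all add: d_def)
  have \<phi>: "disk_automorphism a x = (a - x) / d"
    by (simp add: disk_automorphism_def d_def)
  have "a - disk_automorphism a x = (a * d - (a - x)) / d"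
    using nz(1) by (simp add: \<phi> diff_divide_distrib)
  also have "a * d - (a - x) = x * (1 - a * cnj a)"
    by (simp add: d_def algebra_simps)
  finally have "a - disk_automorphism a x = x * (1 - a * cnj a) / d" .
  moreover have "1 - cnj a * disk_automorphism a x = (d - cnj a * (a - x)) / d"
    using nz(1) by (simp add: \<phi> diff_divide_distrib right_diff_distrib)
  moreover have "d - cnj a * (a - x) = 1 - a * cnj a"
    by (simp add: d_def algebra_simps)
  ultimately show ?thesis
    using nz by (simp add: disk_automorphism_def[of a "disk_automorphism a x"])
qed

lemma norm_disk_automorphism_lt_1: "norm a < 1 \<Longrightarrow> norm x < 1 \<Longrightarrow> norm (disk_automorphism a x) < 1"
  by (rule inner_function_lt_1[OF inner_disk_automorphism disk_automorphism_nonconstant])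

lemma disk_automorphism_self [simp]: "disk_automorphism a a = 0"
  by (simp add: disk_automorphism_def)

lemma disk_automorphism_kernel':
  assumes "norm a < 1" "norm s < 1" "norm t < 1"
  shows "(1 - s * cnj a) * (1 - a * cnj t) / (1 - a * cnj a) * (1 - disk_automorphism a s * cnj (disk_automorphism a t)) = 1 - s * cnj t"
  using one_minus_cnj_mult_nonzero[of a s] one_minus_mult_cnj_nonzero[of a t] one_minus_mult_cnj_nonzero[of a a] assms
  by (simp add: disk_automorphism_kernel mult.commute)

text \<open>
  Applied to \<open>\<tau>\<^sub>a(s)\<close> and \<open>\<tau>\<^sub>a(t)\<close>, the identity also writes the difference of these values as a multiple
  of \<open>s - t\<close>, with polynomials in \<open>\<tau>\<^sub>a(s)\<close> and \<open>\<tau>\<^sub>a(t)\<close> as factors.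
\<close>

lemma disk_automorphism_diff:
  assumes "norm a < 1" "norm s < 1" "norm t < 1"
  shows "s - t = (disk_automorphism a s - disk_automorphism a t) * ((1 - cnj a * s) * (1 - cnj a * t) * (- 1 / (1 - a * cnj a)))"
proof -
  have nz: "1 - cnj a * s \<noteq> 0" "1 - cnj a * t \<noteq> 0" "1 - a * cnj a \<noteq> 0"
    using one_minus_cnj_mult_nonzero[of a s] one_minus_cnj_mult_nonzero[of a t] one_minus_mult_cnj_nonzero[of a a] assms by auto
  have e: "disk_automorphism a s * (1 - cnj a * s) = a - s" "disk_automorphism a t * (1 - cnj a * t) = a - t"
    using nz(1,2) by (simp_all add: disk_automorphism_def)
  have "(disk_automorphism a s - disk_automorphism a t) * ((1 - cnj a * s) * (1 - cnj a * t)) =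
      (disk_automorphism a s * (1 - cnj a * s)) * (1 - cnj a * t) - (disk_automorphism a t * (1 - cnj a * t)) * (1 - cnj a * s)"
    by (simp add: algebra_simps)
  also have "\<dots> = (a - s) * (1 - cnj a * t) - (a - t) * (1 - cnj a * s)"
    by (simp only: e)
  also have "\<dots> = (t - s) * (1 - a * cnj a)"
    by (simp add: algebra_simps)
  finally show ?thesis
    using nz(3) by (simp add: mult.assoc[symmetric] del: mult.assoc)
qed

lemma generated_submodule_subset:
  assumes "inner_pair \<theta>\<^sub>1 \<phi>\<^sub>1" "inner_pair \<theta>\<^sub>2 \<phi>\<^sub>2"
    and g: "\<And>f p. p \<in> bidisk \<Longrightarrow> (\<theta>\<^sub>1 (fst p) - \<phi>\<^sub>1 (snd p)) * hfun f p = (\<theta>\<^sub>2 (fst p) - \<phi>\<^sub>2 (snd p)) * hfun (g f) p"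
  shows "generated_submodule (\<lambda>(z, w). \<theta>\<^sub>1 z - \<phi>\<^sub>1 w) \<subseteq> generated_submodule (\<lambda>(z, w). \<theta>\<^sub>2 z - \<phi>\<^sub>2 w)"
proof -
  interpret i1: inner_pair \<theta>\<^sub>1 \<phi>\<^sub>1 by fact
  interpret i2: inner_pair \<theta>\<^sub>2 \<phi>\<^sub>2 by fact
  have "i1.D f = i2.D (g f)" for f
    unfolding hardy2_eq_iff by (auto simp: i1.hfun_D i2.hfun_D g)
  then have "range i1.D \<subseteq> range i2.D"
    by auto
  then show ?thesis
    unfolding i1.generated_submodule_eq i2.generated_submodule_eq by (rule closure_mono)
qed

text \<open>
  The generators \<open>z - w\<close> and \<open>\<tau>\<^sub>b(z) - \<tau>\<^sub>b(w)\<close> are multiples of each other. In either direction the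
  factor is a polynomial in multiplication operators by inner functions.
\<close>

lemma generated_submodule_automorphism:
  assumes b: "norm b < 1"
  shows "generated_submodule (\<lambda>(z, w). disk_automorphism b z - disk_automorphism b w) = diag.N"
proof -
  let ?\<beta> = "disk_automorphism b"
  note inn = inner_disk_automorphism[OF b]
  define E where "E \<alpha> f = scaleC (- 1 / (1 - b * cnj b)) ((f - scaleC (cnj b) (wmult \<alpha> f)) - scaleC (cnj b) (zmult \<alpha> (f - scaleC (cnj b) (wmult \<alpha> f))))" for \<alpha> f
  have E: "hfun (E \<alpha> f) p = (1 - cnj b * \<alpha> (fst p)) * (1 - cnj b * \<alpha> (snd p)) * (- 1 / (1 - b * cnj b)) * hfun f p"
    if "inner_function \<alpha>" "p \<in> bidisk" for \<alpha> f p
    unfolding E_def using that by (simp add: hfun_scaleC hfun_diff hfun_zmult hfun_wmult) (simp add: algebra_simps)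
  have p: "norm (fst p) < 1" "norm (snd p) < 1" if "p \<in> bidisk" for p
    using that by (auto simp: bidisk_def)
  show ?thesis
  proof
    show "generated_submodule (\<lambda>(z, w). ?\<beta> z - ?\<beta> w) \<subseteq> diag.N"
    proof (rule generated_submodule_subset[where g = "E ?\<beta>"])
      fix f q assume q: "q \<in> bidisk"
      have "?\<beta> (fst q) - ?\<beta> (snd q) = (fst q - snd q) * ((1 - cnj b * ?\<beta> (fst q)) * (1 - cnj b * ?\<beta> (snd q)) * (- 1 / (1 - b * cnj b)))"
        using disk_automorphism_diff[of b "?\<beta> (fst q)" "?\<beta> (snd q)"] b p[OF q]
        by (simp add: norm_disk_automorphism_lt_1 disk_automorphism_involution)
      then show "(?\<beta> (fst q) - ?\<beta> (snd q)) * hfun f q = (fst q - snd q) * hfun (E ?\<beta> f) q"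
        by (simp only: E[OF inn q] mult.assoc)
    qed (unfold_locales, (rule inn)+)
    show "diag.N \<subseteq> generated_submodule (\<lambda>(z, w). ?\<beta> z - ?\<beta> w)"
    proof (rule generated_submodule_subset[where g = "E (\<lambda>z. z)"])
      fix f q assume q: "q \<in> bidisk"
      show "(fst q - snd q) * hfun f q = (?\<beta> (fst q) - ?\<beta> (snd q)) * hfun (E (\<lambda>z. z) f) q"
        using disk_automorphism_diff[OF b p[OF q]] by (simp only: E[OF inner_function_id q] mult.assoc)
    qed (unfold_locales, (rule inn)+)
  qed
qed

lemma zero_in_bidisk: "(0, 0) \<in> bidisk"
  by (simp add: bidisk_def)

lemma (in nonconstant_inner_pair) l_zero_mult:
  assumes "p \<in> bidisk" "q \<in> bidisk"
  shows "hfun (l (0, 0)) q * cnj (hfun (l (0, 0)) p) =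
    ((1 - \<theta> (fst q) * cnj (\<theta> 0)) * (1 - \<theta> 0 * cnj (\<theta> (fst p))) / (1 - \<theta> 0 * cnj (\<theta> 0))) *
    ((1 - \<phi> (snd q) * cnj (\<phi> 0)) * (1 - \<phi> 0 * cnj (\<phi> (snd p))) / (1 - \<phi> 0 * cnj (\<phi> 0)))"
proof -
  note 0 = zero_in_bidisk
  define n where "n = complex_of_real (norm (L (0, 0)))"
  have n: "n * n = (1 - \<theta> 0 * cnj (\<theta> 0)) * (1 - \<phi> 0 * cnj (\<phi> 0))"
    using norm_L_sq[OF 0] by (simp add: n_def hfun_L[OF 0 0] hfun_szego[OF 0 0] power2_eq_square)
  have "hfun (l (0, 0)) q = hfun (L (0, 0)) q / n" "cnj (hfun (l (0, 0)) p) = cnj (hfun (L (0, 0)) p) / n"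
    by (simp_all add: l_def n_def hfun_scaleC divide_inverse)
  then have "hfun (l (0, 0)) q * cnj (hfun (l (0, 0)) p) = hfun (L (0, 0)) q * cnj (hfun (L (0, 0)) p) / (n * n)"
    by simp
  then show ?thesis
    using assms by (simp add: n hfun_L[OF 0] hfun_szego[OF 0] mult_ac)
qed

text \<open>
  The transfer isometry of the pair \<open>\<tau>\<^sub>b(z)\<close>, \<open>\<tau>\<^sub>b(w)\<close>, with \<open>l\<close> a multiple of the Szego kernel at \<open>(b, b)\<close>. It
  is onto, as comparison of kernels shows.
\<close>

lemma ex_unitary:
  assumes b: "norm b < 1"
  obtains U U' where "adjoint_pair U U'" "\<And>f. U' (U f) = f" "\<And>f. U (U' f) = f" "\<And>f. P (U f) = U (P f)"
    "\<And>f. zmult (disk_automorphism b) (U f) = U (diag.Z f)" "\<And>f. wmult (disk_automorphism b) (U f) = U (diag.W f)"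
proof -
  let ?\<beta> = "disk_automorphism b"
  interpret nonconstant_inner_pair ?\<beta> ?\<beta>
    by unfold_locales (rule inner_disk_automorphism[OF b] disk_automorphism_nonconstant[OF b])+
  note lw = l_wandering[OF zero_in_bidisk]
  define U U' where "U = V (l (0, 0))" and "U' = Vadj (l (0, 0))"
  have adj: "adjoint_pair U U'"
    unfolding U_def U'_def by (rule adjoint_V[OF lw])
  have "(\<lambda>f. U (U' f)) = (\<lambda>f. f)"
  proof (rule adjoint_pair_eq_szego[OF adjoint_pair_comp[OF adj adjoint_pair_sym[OF adj]] adjoint_pair_id])
    fix p assume p: "p \<in> bidisk"
    show "U (U' (szego p)) = szego p"
      unfolding hardy2_eq_iff
    proof
      fix q assume q: "q \<in> bidisk"
      have pq: "norm (fst p) < 1" "norm (snd p) < 1" "norm (fst q) < 1" "norm (snd q) < 1"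
        using p q by (auto simp: bidisk_def)
      have fac: "(1 - ?\<beta> x * cnj b) * (1 - b * cnj (?\<beta> y)) / (1 - b * cnj b) * (1 / (1 - ?\<beta> x * cnj (?\<beta> y))) = 1 / (1 - x * cnj y)"
        if "norm x < 1" "norm y < 1" for x y
      proof -
        have "(1 - ?\<beta> x * cnj b) * (1 - b * cnj (?\<beta> y)) / (1 - b * cnj b) * (1 - x * cnj y) = 1 - ?\<beta> x * cnj (?\<beta> y)"
          using disk_automorphism_kernel'[OF b, of "?\<beta> x" "?\<beta> y"] b that
          by (simp add: norm_disk_automorphism_lt_1 disk_automorphism_involution)
        moreover have "1 - b * cnj b \<noteq> 0"
          by (rule one_minus_mult_cnj_nonzero[OF b b])
        moreover have "1 - x * cnj y \<noteq> 0" "1 - ?\<beta> x * cnj (?\<beta> y) \<noteq> 0"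
          using b that by (intro one_minus_mult_cnj_nonzero norm_disk_automorphism_lt_1; simp)+
        ultimately show ?thesis
          by (simp add: divide_eq_eq eq_divide_eq mult_ac)
      qed
      have "hfun (U (U' (szego p))) q = (hfun (l (0, 0)) q * cnj (hfun (l (0, 0)) p)) * hfun (szego (\<Theta> p)) (\<Theta> q)"
        by (simp add: U_def U'_def hfun_V[OF lw q] Vadj_szego[OF lw p] hfun_scaleC adjoint_pair_map_scale[OF adjoint_V[OF lw]])
      also have "\<dots> = (1 / (1 - fst q * cnj (fst p))) * (1 / (1 - snd q * cnj (snd p)))"
        unfolding l_zero_mult[OF p q] hfun_szego[OF \<Theta>_bidisk[OF p] \<Theta>_bidisk[OF q]] fac[OF pq(3,1), symmetric] fac[OF pq(4,2), symmetric]
        by (simp add: \<Theta>_def)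
      also have "\<dots> = hfun (szego p) q"
        by (simp add: hfun_szego[OF p q])
      finally show "hfun (U (U' (szego p))) q = hfun (szego p) q" .
    qed
  qed
  then have 3: "U (U' f) = f" for f
    by (simp add: fun_eq_iff)
  show thesis
  proof (rule that[OF adj])
    show "U' (U f) = f" for f
      unfolding U_def U'_def by (rule Vadj_V[OF lw])
    show "P (U f) = U (P f)" for f
      using V_orth_proj[OF lw, of f] by (simp add: U_def generated_submodule_automorphism[OF b])
    show "zmult ?\<beta> (U f) = U (diag.Z f)" "wmult ?\<beta> (U f) = U (diag.W f)" for f
      unfolding U_def by (rule V_Z[OF lw, symmetric] V_W[OF lw, symmetric])+
  qed (rule 3)
qed

section \<open>The numerical invariant of the diagonal submodule\<close>

lemma unitary_norm: "adjoint_pair U U' \<Longrightarrow> (\<And>f. U' (U f) = f) \<Longrightarrow> norm (U f) = norm f"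
  using cinner_self[of "U f"] cinner_self[of f] adjoint_pairD[of U U' f "U f"]
  by (simp add: power2_eq_iff_nonneg del: of_real_power)

context
  fixes U U' :: "hardy2 \<Rightarrow> hardy2"
  assumes U: "adjoint_pair U U'" "\<And>f. U' (U f) = f" "\<And>f. U (U' f) = f" "\<And>f. P (U f) = U (P f)"
begin

lemma unitary_complement:
  assumes g: "P g = 0"
  shows "P (U' g) = 0"
proof -
  have "U (P (U' g)) = 0"
    using g by (simp add: U(3) flip: U(4))
  then show ?thesis
    using U(2)[of "P (U' g)"] adjoint_pair_map_zero[OF adjoint_pair_sym[OF U(1)]] by simp
qed

lemma unitary_parseval:
  assumes g: "P g = 0"
  shows "(\<Sum>\<^sub>\<infinity>n. ennreal ((cmod (cinner g (U (diag_basis n))))\<^sup>2)) = ennreal ((norm g)\<^sup>2)"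
  using complement_parseval[OF unitary_complement[OF g]] unitary_norm[OF adjoint_pair_sym[OF U(1)] U(3)]
  by (simp add: adjoint_pairD2[OF U(1)])

lemma norm_P_automorphism_sq:
  assumes T: "adjoint_pair T T'" "\<And>f. norm (T f) = norm f" "T' (hsum 0) = 0" "\<And>n. T' (hsum (Suc n)) = hsum n"
    and TU: "\<And>f. T\<^sub>1 (U f) = U (T f)" and g: "P g = 0"
  shows "ennreal ((norm (P (T\<^sub>1 g)))\<^sup>2) = (\<Sum>\<^sub>\<infinity>m. ennreal (inverse (real m + 2) * (cmod (cinner g (U (diag_basis m))))\<^sup>2))"
proof -
  have "norm (P (T\<^sub>1 g)) = norm (P (T (U' g)))"
    using TU[of "U' g"] by (simp add: U(3,4) unitary_norm[OF U(1,2)])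
  then show ?thesis
    using norm_P_shift_sq[OF T unitary_complement[OF g]] by (simp add: adjoint_pairD2[OF U(1)])
qed

end

text \<open>
  Comparison with the telescoping series of \<open>1 / ((m + 1) (m + 2))\<close>.
\<close>

lemma infsum_inverse_squares_le: "(\<Sum>\<^sub>\<infinity>m. ennreal ((inverse (real m + 2))\<^sup>2)) \<le> 1"
proof -
  have "(\<Sum>\<^sub>\<infinity>m. ennreal ((inverse (real m + 2))\<^sup>2)) \<le> (\<Sum>\<^sub>\<infinity>m. ennreal (inverse (real m + 1) - inverse (real (Suc m) + 1)))"
    by (intro infsum_ennreal_mono ennreal_leI) (auto simp: power2_eq_square field_simps intro!: frac_le add_pos_nonneg)
  also have "\<dots> = ennreal (inverse (real 0 + 1) - 0)"
  proof (rule infsum_ennreal_telescope)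
    show "(\<lambda>m. inverse (real m + 1)) \<longlonglongrightarrow> 0"
      by real_asymp
  qed (auto simp: field_simps)
  finally show ?thesis by simp
qed

lemma norm_diag_basis: "(norm (diag_basis m))\<^sup>2 = 1"
proof -
  have "(norm (hsum m))\<^sup>2 = real m + 1"
  proof -
    have "cinner (hsum m) (hsum m) = (\<Sum>i\<le>m. \<Sum>j\<le>m. if i = j then 1 else 0)"
      unfolding hsum_def cinner_sum_left cinner_sum_right by (intro sum.cong refl) (auto simp: hcoeff_monomial)
    then have "complex_of_real ((norm (hsum m))\<^sup>2) = complex_of_real (real m + 1)"
      by (simp add: cinner_self)
    then show ?thesis
      unfolding of_real_eq_iff .
  qed
  then show ?thesis
    by (simp add: diag_basis_def norm_inverse power_mult_distrib power_inverse del: of_real_add of_real_of_nat_eq of_real_inverse)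
qed

context
  fixes a b :: complex
  assumes a: "norm a < 1" and b: "norm b < 1"
begin

interpretation ab: invariant_subspace "zmult (disk_automorphism a)" "adj_on UNIV (zmult (disk_automorphism a))"
  "wmult (disk_automorphism b)" "adj_on UNIV (wmult (disk_automorphism b))" diag.N
  by (rule diag.invariant_subspace_N[OF inner_disk_automorphism[OF a] inner_disk_automorphism[OF b]])

lemma Sigma1_eq: "Sigma1 diag.N a b = hs_norm_sq diag.N ab.K"
  by (simp only: Sigma1_def ab.commutator_cross)

text \<open>
  On the submodule \<open>K = P B (1 - P) A'\<close>. The factor \<open>P B\<close> on the complement is measured in the basis \<open>\<eta>\<close>
  that diagonalizes the defect of \<open>\<tau>\<^sub>b\<close>, then \<open>P A\<close> in the basis \<open>\<nu>\<close> for \<open>\<tau>\<^sub>a\<close>. This turns the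
  Hilbert-Schmidt norm into the double series of \<open>d\<^sub>m d\<^sub>n |\<langle>\<eta>\<^sub>m, \<nu>\<^sub>n\<rangle>|\<^sup>2\<close>.
\<close>

lemma Sigma1_le: "Sigma1 diag.N a b \<le> 2"
proof -
  obtain U U' where U: "adjoint_pair U U'" "\<And>f. U' (U f) = f" "\<And>f. U (U' f) = f" "\<And>f. P (U f) = U (P f)"
    "\<And>f. zmult (disk_automorphism a) (U f) = U (diag.Z f)"
    by (rule ex_unitary[OF a]) blast
  obtain Y Y' where Y: "adjoint_pair Y Y'" "\<And>f. Y' (Y f) = f" "\<And>f. Y (Y' f) = f" "\<And>f. P (Y f) = Y (P f)"
    "\<And>f. wmult (disk_automorphism b) (Y f) = Y (diag.W f)"
    by (rule ex_unitary[OF b]) blast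
  define d where "d m = inverse (real m + 2)" for m :: nat
  define A B where "A = zmult (disk_automorphism a)" and "B = wmult (disk_automorphism b)"
  define \<nu> \<eta> where "\<nu> n = U (diag_basis n)" and "\<eta> m = Y (diag_basis m)" for n m
  have \<nu>0: "P (\<nu> n) = 0" and \<eta>0: "P (\<eta> n) = 0" for n
    by (simp_all add: \<nu>_def \<eta>_def U(4) Y(4) P_diag_basis adjoint_pair_map_zero[OF U(1)] adjoint_pair_map_zero[OF Y(1)])
  have A: "ennreal ((norm (P (A g)))\<^sup>2) = (\<Sum>\<^sub>\<infinity>n. ennreal (d n * (cmod (cinner g (\<nu> n)))\<^sup>2))" if "P g = 0" for g
    unfolding d_def A_def \<nu>_def by (rule norm_P_automorphism_sq[OF U(1-4) diag.adjA diag.norm_A adj_Z_hsum U(5) that])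
  have B: "ennreal ((norm (P (B g)))\<^sup>2) = (\<Sum>\<^sub>\<infinity>m. ennreal (d m * (cmod (cinner g (\<eta> m)))\<^sup>2))" if "P g = 0" for g
    unfolding d_def B_def \<eta>_def by (rule norm_P_automorphism_sq[OF Y(1-4) diag.adjB diag.norm_B adj_W_hsum Y(5) that])
  define e where "e = (SOME e. orthonormal_basis diag.N e)"
  have e: "orthonormal_basis diag.N e"
    unfolding e_def by (rule someI_ex[OF ex_orthonormal_basis[OF diag.closed_csubspace_N]])
  have K: "ennreal ((norm (ab.K f))\<^sup>2) = (\<Sum>\<^sub>\<infinity>m. ennreal (d m) * ennreal ((cmod (cinner (P (A (\<eta> m))) f))\<^sup>2))"
    if f: "f \<in> diag.N" for f
  proof -
    define x where "x = adj_on UNIV A f"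
    have "ab.K f = P (B (x - P x))"
      by (simp add: ab.K_def ab.dcomm ab.linB ab.linP ab.P_eq ab.BM x_def A_def B_def)
    moreover have "cinner (x - P x) (\<eta> m) = cnj (cinner (P (A (\<eta> m))) f)" for m
    proof -
      have "cinner (x - P x) (\<eta> m) = cinner f (A (\<eta> m))"
        unfolding cinner_complement[OF \<eta>0] x_def A_def by (rule adjoint_pairD2[OF ab.adjA])
      also have "\<dots> = cinner f (P (A (\<eta> m)))"
        by (rule orth_proj_cinner_right[OF diag.closed_csubspace_N f, symmetric])
      finally show ?thesis
        using cinner_commute by metis
    qed
    ultimately show ?thesis
      using B[OF P_complement[of x]] by (simp add: ennreal_mult d_def)
  qed
  have sum_\<nu>: "(\<Sum>\<^sub>\<infinity>n. ennreal ((cmod (cinner (\<eta> m) (\<nu> n)))\<^sup>2)) = 1" for m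
  proof -
    have "(\<Sum>\<^sub>\<infinity>n. ennreal ((cmod (cinner (\<eta> m) (\<nu> n)))\<^sup>2)) = ennreal ((norm (\<eta> m))\<^sup>2)"
      using U Y \<eta>0 unitary_parseval[OF U(1-4) \<eta>0] by (simp add: \<nu>_def)
    then show ?thesis
      using unitary_norm[OF Y(1,2)] by (simp add: \<eta>_def norm_diag_basis)
  qed
  have sum_\<eta>: "(\<Sum>\<^sub>\<infinity>m. ennreal ((cmod (cinner (\<eta> m) (\<nu> n)))\<^sup>2)) = 1" for n
  proof -
    have "(\<Sum>\<^sub>\<infinity>m. ennreal ((cmod (cinner (\<nu> n) (\<eta> m)))\<^sup>2)) = ennreal ((norm (\<nu> n))\<^sup>2)"
      using unitary_parseval[OF Y(1-4) \<nu>0] by (simp add: \<eta>_def)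
    moreover have "norm (\<nu> n) ^ 2 = 1"
      using unitary_norm[OF U(1,2)] by (simp add: \<nu>_def norm_diag_basis)
    ultimately show ?thesis
      by (simp only: cmod_cinner_commute[of "\<nu> n"] ennreal_1)
  qed
  have "Sigma1 diag.N a b = (\<Sum>\<^sub>\<infinity>f\<in>e. \<Sum>\<^sub>\<infinity>m. ennreal (d m) * ennreal ((cmod (cinner (P (A (\<eta> m))) f))\<^sup>2))"
    unfolding Sigma1_eq hs_norm_sq_def e_def[symmetric]
    using e by (intro infsum_cong K) (auto simp: orthonormal_basis_def)
  also have "\<dots> = (\<Sum>\<^sub>\<infinity>m. \<Sum>\<^sub>\<infinity>f\<in>e. ennreal (d m) * ennreal ((cmod (cinner (P (A (\<eta> m))) f))\<^sup>2))"
    by (rule infsum_ennreal_swap)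
  also have "\<dots> = (\<Sum>\<^sub>\<infinity>m. ennreal (d m) * ennreal ((norm (P (A (\<eta> m))))\<^sup>2))"
    by (simp add: infsum_ennreal_cmult parseval[OF diag.closed_csubspace_N e orth_proj_in[OF diag.closed_csubspace_N]])
  also have "\<dots> = (\<Sum>\<^sub>\<infinity>m. \<Sum>\<^sub>\<infinity>n. ennreal (d m * d n * (cmod (cinner (\<eta> m) (\<nu> n)))\<^sup>2))"
    by (simp add: A[OF \<eta>0] d_def ennreal_mult mult.assoc flip: infsum_ennreal_cmult)
  also have "\<dots> \<le> (\<Sum>\<^sub>\<infinity>m. \<Sum>\<^sub>\<infinity>n. ennreal ((d m)\<^sup>2) * ennreal ((cmod (cinner (\<eta> m) (\<nu> n)))\<^sup>2)
      + ennreal ((d n)\<^sup>2) * ennreal ((cmod (cinner (\<eta> m) (\<nu> n)))\<^sup>2))"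
  proof (intro infsum_ennreal_mono)
    fix m n
    have d0: "0 \<le> d m" "0 \<le> d n"
      by (simp_all add: d_def)
    \<comment> \<open>The bound without the factor 1/2 already suffices for the constant 2.\<close>
    have "d m * d n \<le> (d m)\<^sup>2 + (d n)\<^sup>2"
      using sum_squares_bound[of "d m" "d n"] mult_nonneg_nonneg[OF d0] by linarith
    then have "d m * d n * (cmod (cinner (\<eta> m) (\<nu> n)))\<^sup>2 \<le> ((d m)\<^sup>2 + (d n)\<^sup>2) * (cmod (cinner (\<eta> m) (\<nu> n)))\<^sup>2"
      by (rule mult_right_mono) simp
    then show "ennreal (d m * d n * (cmod (cinner (\<eta> m) (\<nu> n)))\<^sup>2) \<le> ennreal ((d m)\<^sup>2) * ennreal ((cmod (cinner (\<eta> m) (\<nu> n)))\<^sup>2)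
      + ennreal ((d n)\<^sup>2) * ennreal ((cmod (cinner (\<eta> m) (\<nu> n)))\<^sup>2)"
      by (simp add: distrib_right ennreal_leI flip: ennreal_mult ennreal_plus)
  qed
  also have "\<dots> = (\<Sum>\<^sub>\<infinity>m. ennreal ((d m)\<^sup>2) * (\<Sum>\<^sub>\<infinity>n. ennreal ((cmod (cinner (\<eta> m) (\<nu> n)))\<^sup>2)))
      + (\<Sum>\<^sub>\<infinity>m. \<Sum>\<^sub>\<infinity>n. ennreal ((d n)\<^sup>2) * ennreal ((cmod (cinner (\<eta> m) (\<nu> n)))\<^sup>2))"
    by (simp add: infsum_add nonneg_summable_on_complete infsum_ennreal_cmult)
  also have "(\<Sum>\<^sub>\<infinity>m. \<Sum>\<^sub>\<infinity>n. ennreal ((d n)\<^sup>2) * ennreal ((cmod (cinner (\<eta> m) (\<nu> n)))\<^sup>2)) =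
      (\<Sum>\<^sub>\<infinity>n. ennreal ((d n)\<^sup>2) * (\<Sum>\<^sub>\<infinity>m. ennreal ((cmod (cinner (\<eta> m) (\<nu> n)))\<^sup>2)))"
    by (subst infsum_ennreal_swap) (simp add: infsum_ennreal_cmult)
  also have "(\<Sum>\<^sub>\<infinity>m. ennreal ((d m)\<^sup>2) * (\<Sum>\<^sub>\<infinity>n. ennreal ((cmod (cinner (\<eta> m) (\<nu> n)))\<^sup>2))) =
      (\<Sum>\<^sub>\<infinity>m. ennreal ((d m)\<^sup>2) * 1)"
    by (simp only: sum_\<nu>)
  also have "(\<Sum>\<^sub>\<infinity>n. ennreal ((d n)\<^sup>2) * (\<Sum>\<^sub>\<infinity>m. ennreal ((cmod (cinner (\<eta> m) (\<nu> n)))\<^sup>2))) =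
      (\<Sum>\<^sub>\<infinity>n. ennreal ((d n)\<^sup>2) * 1)"
    by (simp only: sum_\<eta>)
  also have "(\<Sum>\<^sub>\<infinity>m. ennreal ((d m)\<^sup>2) * 1) + (\<Sum>\<^sub>\<infinity>n. ennreal ((d n)\<^sup>2) * 1) \<le> 1 + 1"
    using infsum_inverse_squares_le by (intro add_mono) (simp_all add: d_def)
  finally show ?thesis
    by (simp add: one_add_one)
qed

text \<open>
  The joint defect of \<open>\<tau>\<^sub>a(z)\<close> and \<open>\<tau>\<^sub>b(w)\<close> is the projection onto the Szego kernel at \<open>(a, b)\<close>. Strong
  convergence on the complement is inherited from the coordinate shift through the unitary for \<open>\<tau>\<^sub>b\<close>.
\<close>

lemma hs_core_automorphisms: "hs_norm_sq UNIV ab.C = 2 * Sigma1 diag.N a b + 1"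
proof -
  interpret nab: nonconstant_inner_pair "disk_automorphism a" "disk_automorphism b"
    by unfold_locales (rule inner_disk_automorphism[OF a] disk_automorphism_nonconstant[OF a]
        inner_disk_automorphism[OF b] disk_automorphism_nonconstant[OF b])+
  define s where "s = szego (a, b)"
  have abd: "(a, b) \<in> bidisk"
    using a b by (simp add: bidisk_def)
  have sq: "of_real ((norm s)\<^sup>2) = 1 / ((1 - a * cnj a) * (1 - b * cnj b))"
    using cinner_self[of s] cinner_szego[OF abd, of s] by (simp add: s_def hfun_szego[OF abd abd])
  have s0: "norm s \<noteq> 0"
    using hfun_szego_nonzero[OF abd abd] by (auto simp: s_def zero_hardy2.rep_eq)
  define \<kappa> where "\<kappa> = scaleC (of_real (inverse (norm s))) s"
  have \<kappa>1: "norm \<kappa> = 1"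
    using s0 by (simp add: \<kappa>_def norm_inverse)
  have \<kappa>2: "nab.W' \<kappa> = 0"
    by (simp add: \<kappa>_def s_def ab.linB' adj_wmult_szego[OF inner_disk_automorphism[OF b] abd])
  have defect: "f - nab.Z (nab.Z' f) - nab.W (nab.W' (f - nab.Z (nab.Z' f))) = scaleC (cinner f \<kappa>) \<kappa>" for f
  proof -
    have Y: "adjoint_pair (\<lambda>f. f - nab.Z (nab.Z' f)) (\<lambda>f. f - nab.Z (nab.Z' f))"
      by (intro adjoint_pair_diff adjoint_pair_id adjoint_pair_comp[OF ab.adjA adjoint_pair_sym[OF ab.adjA]])
    have X: "adjoint_pair (\<lambda>f. f - nab.W (nab.W' f)) (\<lambda>f. f - nab.W (nab.W' f))"
      by (intro adjoint_pair_diff adjoint_pair_id adjoint_pair_comp[OF ab.adjB adjoint_pair_sym[OF ab.adjB]])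
    have S: "adjoint_pair (\<lambda>f. scaleC (cinner f \<kappa>) \<kappa>) (\<lambda>f. scaleC (cinner f \<kappa>) \<kappa>)"
    proof -
      have "cinner (scaleC (cinner f \<kappa>) \<kappa>) g = cinner f (scaleC (cinner g \<kappa>) \<kappa>)" for f g
        using cinner_commute[of \<kappa> g] by (simp add: cinner_simps)
      then show ?thesis
        by (simp add: adjoint_pair_def)
    qed
    have "(\<lambda>f. (f - nab.Z (nab.Z' f)) - nab.W (nab.W' (f - nab.Z (nab.Z' f)))) = (\<lambda>f. scaleC (cinner f \<kappa>) \<kappa>)"
    proof (rule adjoint_pair_eq_szego[OF adjoint_pair_comp[OF X Y] S])
      fix p assume p: "p \<in> bidisk"
      have "nab.L p = scaleC (cinner (szego p) \<kappa>) \<kappa>"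
        unfolding hardy2_eq_iff
      proof
        fix q assume q: "q \<in> bidisk"
        have pq: "norm (fst p) < 1" "norm (snd p) < 1" "norm (fst q) < 1" "norm (snd q) < 1"
          using p q by (auto simp: bidisk_def)
        have nz: "1 - fst q * cnj (fst p) \<noteq> 0" "1 - snd q * cnj (snd p) \<noteq> 0"
          using pq by (intro one_minus_mult_cnj_nonzero; simp)+
        define n where "n = complex_of_real (norm s)"
        have n: "n * n = 1 / ((1 - a * cnj a) * (1 - b * cnj b))"
          using sq by (simp add: n_def power2_eq_square)
        have "hfun (scaleC (cinner (szego p) \<kappa>) \<kappa>) q = hfun (szego p) (a, b) * hfun s q / (n * n)"
          by (simp add: \<kappa>_def hfun_scaleC cinner_simps s_def cinner_szego[OF abd] n_def divide_inverse mult_ac)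
        also have "\<dots> = hfun (nab.L p) q"
          using nz by (simp add: n s_def hfun_szego[OF abd q] hfun_szego[OF p abd] nab.hfun_L[OF p q] hfun_szego[OF p q]
              disk_automorphism_kernel[OF a pq(3,1)] disk_automorphism_kernel[OF b pq(4,2)] mult_ac)
        finally show "hfun (nab.L p) q = hfun (scaleC (cinner (szego p) \<kappa>) \<kappa>) q" by simp
      qed
      then show "(szego p - nab.Z (nab.Z' (szego p))) - nab.W (nab.W' (szego p - nab.Z (nab.Z' (szego p)))) = scaleC (cinner (szego p) \<kappa>) \<kappa>"
        by (simp only: nab.L_eq_defect[OF p])
    qed
    from fun_cong[OF this, of f] show ?thesis .
  qed
  have compl: "(\<lambda>n. (nab.W ^^ n) f - P ((nab.W ^^ n) f)) \<longlonglongrightarrow> 0" for f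
  proof -
    obtain U U' where U: "adjoint_pair U U'" "\<And>f. U' (U f) = f" "\<And>f. U (U' f) = f" "\<And>f. P (U f) = U (P f)"
      "\<And>f. nab.W (U f) = U (diag.W f)"
      by (rule ex_unitary[OF b]) blast
    have "(nab.W ^^ n) (U g) = U ((diag.W ^^ n) g)" for n g
      by (induction n) (simp_all add: U(5))
    from this[of _ "U' f"] have W: "(nab.W ^^ n) f = U ((diag.W ^^ n) (U' f))" for n
      by (simp add: U(3))
    have "norm ((nab.W ^^ n) f - P ((nab.W ^^ n) f)) = norm ((diag.W ^^ n) (U' f) - P ((diag.W ^^ n) (U' f)))" for n
      unfolding W U(4) adjoint_pair_map_diff[OF U(1), symmetric] by (rule unitary_norm[OF U(1,2)])
    then have "(\<lambda>n. norm ((nab.W ^^ n) f - P ((nab.W ^^ n) f))) \<longlonglongrightarrow> 0"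
      using tendsto_norm_zero[OF complement_shift_tendsto_0[of "U' f"]] by simp
    then show ?thesis
      by (rule tendsto_norm_zero_cancel)
  qed
  have "(\<lambda>n. (nab.W' ^^ n) f) \<longlonglongrightarrow> 0" for f
    by (rule wmult_pure[OF nab.\<phi> nab.\<phi>_nc])
  from ab.hs_core_eq[OF this compl defect \<kappa>1 \<kappa>2] show ?thesis
    by (simp only: Sigma1_eq)
qed

end

section \<open>Core operators of submodules generated by differences of inner functions\<close>

text \<open>
  The factor \<open>l\<close> of the isometry is the normalized kernel \<open>L\<close> at the origin. Its values convert
  \<open>1 - \<tau>\<^sub>a(s) cnj (\<tau>\<^sub>a(t))\<close> into \<open>1 - s cnj t\<close>, and for \<open>s\<close>, \<open>t\<close> values of \<open>\<theta>\<close> this is the factor that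
  the kernel of the core operator of \<open>N\<close> contains.
\<close>

lemma (in nonconstant_inner_pair) hs_core_transfer:
  defines "a \<equiv> \<theta> 0" and "b \<equiv> \<phi> 0"
  shows "hs_norm_sq UNIV (invariant_subspace.C diag.Z diag.Z' diag.W diag.W' N) = 2 * Sigma1 diag.N a b + 1"
proof -
  have a: "norm a < 1" and b: "norm b < 1"
    using inner_function_lt_1[OF \<theta> \<theta>_nc, of 0] inner_function_lt_1[OF \<phi> \<phi>_nc, of 0] by (simp_all add: a_def b_def)
  note inn = inner_disk_automorphism[OF a] inner_disk_automorphism[OF b]
  interpret zw: invariant_subspace diag.Z diag.Z' diag.W diag.W' N
    by (rule invariant_subspace_N[OF inner_function_id inner_function_id])
  interpret ab: invariant_subspace "zmult (disk_automorphism a)" "adj_on UNIV (zmult (disk_automorphism a))"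
    "wmult (disk_automorphism b)" "adj_on UNIV (wmult (disk_automorphism b))" diag.N
    by (rule diag.invariant_subspace_N[OF inn])
  note lw = l_wandering[OF zero_in_bidisk]
  define S S' where "S = V (l (0, 0))" and "S' = Vadj (l (0, 0))"
  have adj: "adjoint_pair S S'"
    unfolding S_def S'_def by (rule adjoint_V[OF lw])
  have C: "zw.C = (\<lambda>f. S (ab.C (S' f)))"
  proof (rule adjoint_pair_eq_szego[OF zw.adjoint_C adjoint_pair_comp[OF adj adjoint_pair_comp[OF ab.adjoint_C adjoint_pair_sym[OF adj]]]])
    fix p assume p: "p \<in> bidisk"
    show "zw.C (szego p) = S (ab.C (S' (szego p)))"
      unfolding hardy2_eq_iff
    proof
      fix q assume q: "q \<in> bidisk"
      note \<Theta>pq = \<Theta>_bidisk[OF p] \<Theta>_bidisk[OF q]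
      have lt: "norm (\<theta> (fst p)) < 1" "norm (\<theta> (fst q)) < 1" "norm (\<phi> (snd p)) < 1" "norm (\<phi> (snd q)) < 1"
        using \<Theta>pq by (auto simp: \<Theta>_def bidisk_def)
      have nz: "1 - fst q * cnj (fst p) \<noteq> 0" "1 - snd q * cnj (snd p) \<noteq> 0"
        using p q by (auto simp: bidisk_def one_minus_mult_cnj_nonzero simp del: right_minus_eq)
      define k where "k = hfun (P (szego (\<Theta> p))) (\<Theta> q)"
      have "hfun (S (ab.C (S' (szego p)))) q =
          hfun (l (0, 0)) q * cnj (hfun (l (0, 0)) p) * hfun (ab.C (szego (\<Theta> p))) (\<Theta> q)"
        by (simp add: S_def S'_def hfun_V[OF lw q] Vadj_szego[OF lw p] adjoint_pair_map_scale[OF ab.adjoint_C] hfun_scaleC)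
      also have "\<dots> = (1 - \<theta> (fst q) * cnj (\<theta> (fst p))) * (1 - \<phi> (snd q) * cnj (\<phi> (snd p))) * k"
        unfolding l_zero_mult[OF p q] diag.hfun_core_szego[OF inn \<Theta>pq] k_def[symmetric]
          disk_automorphism_kernel'[OF a lt(2,1), symmetric] disk_automorphism_kernel'[OF b lt(4,3), symmetric]
        by (simp add: \<Theta>_def a_def b_def)
      also have "\<dots> = hfun (zw.C (szego p)) q"
        using nz by (simp add: hfun_core_szego[OF inner_function_id inner_function_id p q] orth_proj_szego[OF p q]
          hfun_L[OF p q] hfun_szego[OF p q] k_def)
      finally show "hfun (zw.C (szego p)) q = hfun (S (ab.C (S' (szego p)))) q" by simp
    qed
  qed
  have normS: "norm (S f) = norm f" for f
    unfolding S_def by (rule norm_V[OF lw])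
  have "hs_norm_sq UNIV zw.C = (\<Sum>\<^sub>\<infinity>k. ennreal ((norm (ab.C (S' (monomial k))))\<^sup>2))"
    unfolding zw.hs_C by (simp add: C normS)
  also have "\<dots> = (\<Sum>\<^sub>\<infinity>k. ennreal ((norm (S (ab.C (monomial k))))\<^sup>2))"
    using hs_norm_sq_UNIV_adjoint[OF adjoint_pair_comp[OF ab.adjoint_C adjoint_pair_sym[OF adj]]] by simp
  also have "\<dots> = hs_norm_sq UNIV ab.C"
    by (simp add: ab.hs_C normS)
  finally show ?thesis
    using hs_core_automorphisms[OF a b] by simp
qed

theorem corollary5p1:
  fixes \<theta> \<phi> :: "complex \<Rightarrow> complex"
  assumes "inner_function \<theta>" "\<not> \<theta> constant_on ball 0 1"
    and "inner_function \<phi>" "\<not> \<phi> constant_on ball 0 1"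
  shows "hilbert_schmidt_submodule (generated_submodule (\<lambda>(z, w). \<theta> z - \<phi> w)) \<and>
    hs_norm_sq UNIV (core_operator (generated_submodule (\<lambda>(z, w). \<theta> z - \<phi> w))) =
      2 * Sigma1 (generated_submodule (\<lambda>(z, w). z - w)) (\<theta> 0) (\<phi> 0) + 1 \<and>
    2 * Sigma1 (generated_submodule (\<lambda>(z, w). z - w)) (\<theta> 0) (\<phi> 0) + 1 \<le> 5"
proof -
  interpret nonconstant_inner_pair \<theta> \<phi>
    by unfold_locales (rule assms)+
  interpret zw: invariant_subspace diag.Z diag.Z' diag.W diag.W' N
    by (rule invariant_subspace_N[OF inner_function_id inner_function_id])
  have core: "core_operator N = zw.C"
    by (simp add: fun_eq_iff core_operator_def Let_def mult_op_fst mult_op_snd zw.C_def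
        adj_on_eq[OF zw.M diag.adjA] adj_on_eq[OF zw.M diag.adjB] zw.P_A'_P invariant_subspace.P_A'_P[OF zw.invariant_subspace_swap])
  have hs: "hs_norm_sq UNIV zw.C = 2 * Sigma1 diag.N (\<theta> 0) (\<phi> 0) + 1"
    by (rule hs_core_transfer)
  have "norm (\<theta> 0) < 1" "norm (\<phi> 0) < 1"
    using inner_function_lt_1[OF assms(1,2), of 0] inner_function_lt_1[OF assms(3,4), of 0] by simp_all
  then have "2 * Sigma1 diag.N (\<theta> 0) (\<phi> 0) + 1 \<le> 2 * 2 + 1"
    by (intro add_mono mult_left_mono Sigma1_le) auto
  then have le: "2 * Sigma1 diag.N (\<theta> 0) (\<phi> 0) + 1 \<le> 5"
    by simp
  then have fin: "hs_norm_sq UNIV zw.C < \<infinity>"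
    unfolding hs by (rule order.strict_trans1) (simp add: ennreal_numeral_less_top)
  have "hilbert_schmidt_submodule N"
    unfolding hilbert_schmidt_submodule_def Let_def mult_op_fst mult_op_snd
    using submodule_N order.strict_trans1[OF zw.hs_self_commutators_le fin] order.strict_trans1[OF zw.hs_K_le fin]
    by (simp add: zw.commutator_cross)
  with le show ?thesis
    by (simp add: core hs)
qed

end
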